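(* Let $c_1,c_2\in\mathcal C([0,1])$, let $\epsilon_1,\epsilon_2\in\mathcal C^1([0,1])$ with $\epsilon_1(x),\epsilon_2(x)>0$ on $[0,1]$, and let $q\in\mathbb R$, $q\neq0$. Consider the system for $w=[u\ v]^T$, $$u_t=-\epsilon_1(x)u_x+c_1(x)v,\qquad v_t=\epsilon_2(x)v_x+c_2(x)u,\qquad x\in[0,1],\ t\ge0,$$ with boundary conditions $u(0,t)=q\,v(0,t)$, $v(1,t)=U(t)$, with control law $$U(t)=\int_0^1K^{vu}(1,\xi)u(\xi,t)\,d\xi+\int_0^1K^{vv}(1,\xi)v(\xi,t)\,d\xi,$$ where $K^{vu},K^{vv}$ are the kernels defined in the context. Then for every $\lambda>0$ there exists $c>0$ such that for every initial condition $w_0\in L^2([0,1];\mathbb R^2)$ the solution satisfies $$\|w(\cdot,t)\|_{L^2}\le c\,e^{-\lambda t}\|w_0\|_{L^2},\qquad t\ge0.$$ In fact, the equilibrium $w\equiv0$ is reached in finite time $t=t_F$, where $$t_F=\int_0^1\left(\frac1{\epsilon_1(\xi)}+\frac1{\epsilon_2(\xi)}\right)d\xi .$$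
   Context: $\|w(\cdot,t)\|_{L^2}=\sqrt{\int_0^1(u^2(\xi,t)+v^2(\xi,t))\,d\xi}$. The kernels $K^{vu},K^{vv}$ are the unique continuous solution on the triangle $\mathcal T=\{(x,\xi):0\le\xi\le x\le1\}$ (in the sense of integration along characteristics) of $$\epsilon_2(x)K^{vu}_x-\epsilon_1(\xi)K^{vu}_\xi=\epsilon_1'(\xi)K^{vu}+c_2(\xi)K^{vv},$$ $$\epsilon_2(x)K^{vv}_x+\epsilon_2(\xi)K^{vv}_\xi=-\epsilon_2'(\xi)K^{vv}+c_1(\xi)K^{vu},$$ $$K^{vu}(x,x)=-\frac{c_2(x)}{\epsilon_1(x)+\epsilon_2(x)},\qquad K^{vv}(x,0)=\frac{q\,\epsilon_1(0)}{\epsilon_2(0)}K^{vu}(x,0).$$ Solutions of the system with $L^2$ initial data are understood in the usual weak ($L^2$) sense. *)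

theory Defs
  imports "HOL-Analysis.Analysis"
begin

definition C1_on :: "real set \<Rightarrow> (real \<Rightarrow> real) \<Rightarrow> (real \<Rightarrow> real) \<Rightarrow> bool" where
  "C1_on S f f' \<longleftrightarrow>
     (\<forall>x\<in>S. (f has_real_derivative f' x) (at x within S)) \<and> continuous_on S f'"

definition L2_on :: "real set \<Rightarrow> (real \<Rightarrow> real) \<Rightarrow> bool" where
  "L2_on S f \<longleftrightarrow>
     f \<in> borel_measurable (lebesgue_on S) \<and> integrable (lebesgue_on S) (\<lambda>x. (f x)\<^sup>2)"

definition L2_norm :: "(real \<Rightarrow> real) \<Rightarrow> (real \<Rightarrow> real) \<Rightarrow> real" where
  "L2_norm f g = sqrt (LINT x|lebesgue_on {0..1}. (f x)\<^sup>2 + (g x)\<^sup>2)"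

definition triangle :: "(real \<times> real) set" where
  "triangle = {(x, \<xi>). 0 \<le> \<xi> \<and> \<xi> \<le> x \<and> x \<le> 1}"

text \<open>An integral curve in the triangle of the vector field with components
  \<open>a x\<close> and \<open>b \<xi>\<close>, parametrized on the time interval from 0 to \<open>S\<close>.\<close>

definition characteristic ::
  "(real \<Rightarrow> real) \<Rightarrow> (real \<Rightarrow> real) \<Rightarrow> real \<Rightarrow> (real \<Rightarrow> real) \<Rightarrow> (real \<Rightarrow> real) \<Rightarrow> bool" where
  "characteristic a b S X Y \<longleftrightarrow>
     0 \<le> S \<and>
     (\<forall>s\<in>{0..S}. (X s, Y s) \<in> triangle \<and>
        (X has_real_derivative a (X s)) (at s within {0..S}) \<and>
        (Y has_real_derivative b (Y s)) (at s within {0..S}))"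

text \<open>Continuous solutions of the kernel equations. Each first-order equation is imposed in
  integrated form along every arc of its characteristics (which are different for the two
  equations); the kernels themselves need not have partial derivatives.\<close>

definition kernel_solution ::
  "(real \<Rightarrow> real) \<Rightarrow> (real \<Rightarrow> real) \<Rightarrow> (real \<Rightarrow> real) \<Rightarrow> (real \<Rightarrow> real) \<Rightarrow>
   (real \<Rightarrow> real) \<Rightarrow> (real \<Rightarrow> real) \<Rightarrow> real \<Rightarrow>
   (real \<Rightarrow> real \<Rightarrow> real) \<Rightarrow> (real \<Rightarrow> real \<Rightarrow> real) \<Rightarrow> bool" where
  "kernel_solution \<epsilon>\<^sub>1 \<epsilon>\<^sub>1' \<epsilon>\<^sub>2 \<epsilon>\<^sub>2' c\<^sub>1 c\<^sub>2 q Kvu Kvv \<longleftrightarrow>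
     continuous_on triangle (\<lambda>(x, \<xi>). Kvu x \<xi>) \<and>
     continuous_on triangle (\<lambda>(x, \<xi>). Kvv x \<xi>) \<and>
     (\<forall>S X Y. characteristic \<epsilon>\<^sub>2 (\<lambda>\<xi>. - \<epsilon>\<^sub>1 \<xi>) S X Y \<longrightarrow>
        ((\<lambda>s. \<epsilon>\<^sub>1' (Y s) * Kvu (X s) (Y s) + c\<^sub>2 (Y s) * Kvv (X s) (Y s))
           has_integral (Kvu (X S) (Y S) - Kvu (X 0) (Y 0))) {0..S}) \<and>
     (\<forall>S X Y. characteristic \<epsilon>\<^sub>2 \<epsilon>\<^sub>2 S X Y \<longrightarrow>
        ((\<lambda>s. - \<epsilon>\<^sub>2' (Y s) * Kvv (X s) (Y s) + c\<^sub>1 (Y s) * Kvu (X s) (Y s))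
           has_integral (Kvv (X S) (Y S) - Kvv (X 0) (Y 0))) {0..S}) \<and>
     (\<forall>x\<in>{0..1}. Kvu x x = - c\<^sub>2 x / (\<epsilon>\<^sub>1 x + \<epsilon>\<^sub>2 x)) \<and>
     (\<forall>x\<in>{0..1}. Kvv x 0 = q * \<epsilon>\<^sub>1 0 / \<epsilon>\<^sub>2 0 * Kvu x 0)"

text \<open>Functions of time (first argument) and space that are continuously differentiable on
  a closed rectangle, with one-sided derivatives on its edges.\<close>

definition C1_rectangle ::
  "real \<Rightarrow> (real \<Rightarrow> real \<Rightarrow> real) \<Rightarrow> (real \<Rightarrow> real \<Rightarrow> real) \<Rightarrow> (real \<Rightarrow> real \<Rightarrow> real) \<Rightarrow> bool" where
  "C1_rectangle \<tau> \<phi> \<phi>t \<phi>x \<longleftrightarrow>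
     (\<forall>t\<in>{0..\<tau>}. \<forall>x\<in>{0..1}.
        ((\<lambda>s. \<phi> s x) has_real_derivative \<phi>t t x) (at t within {0..\<tau>}) \<and>
        ((\<lambda>y. \<phi> t y) has_real_derivative \<phi>x t x) (at x within {0..1})) \<and>
     continuous_on ({0..\<tau>} \<times> {0..1}) (\<lambda>(t, x). \<phi>t t x) \<and>
     continuous_on ({0..\<tau>} \<times> {0..1}) (\<lambda>(t, x). \<phi>x t x)"

text \<open>Test pairs on the rectangle: the two boundary conditions are those that cancel the
  unprescribed traces \<open>u(1,t)\<close> and \<open>v(0,t)\<close> in the integration by parts, the boundary
  condition \<open>u(0,t) = q v(0,t)\<close> having been used for the latter.\<close>

definition test_pair ::
  "(real \<Rightarrow> real) \<Rightarrow> (real \<Rightarrow> real) \<Rightarrow> real \<Rightarrow> real \<Rightarrow>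
   (real \<Rightarrow> real \<Rightarrow> real) \<Rightarrow> (real \<Rightarrow> real \<Rightarrow> real) \<Rightarrow> (real \<Rightarrow> real \<Rightarrow> real) \<Rightarrow>
   (real \<Rightarrow> real \<Rightarrow> real) \<Rightarrow> (real \<Rightarrow> real \<Rightarrow> real) \<Rightarrow> (real \<Rightarrow> real \<Rightarrow> real) \<Rightarrow> bool" where
  "test_pair \<epsilon>\<^sub>1 \<epsilon>\<^sub>2 q \<tau> \<phi> \<phi>t \<phi>x \<psi> \<psi>t \<psi>x \<longleftrightarrow>
     C1_rectangle \<tau> \<phi> \<phi>t \<phi>x \<and> C1_rectangle \<tau> \<psi> \<psi>t \<psi>x \<and>
     (\<forall>t\<in>{0..\<tau>}. \<phi> t 1 = 0 \<and> \<epsilon>\<^sub>2 0 * \<psi> t 0 = q * \<epsilon>\<^sub>1 0 * \<phi> t 0)"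

text \<open>Weak solutions in \<open>C([0,\<infinity>); L\<^sup>2)\<close> of
    \<open>u\<^sub>t = - \<epsilon>\<^sub>1 u\<^sub>x + c\<^sub>1 v\<close>,  \<open>v\<^sub>t = \<epsilon>\<^sub>2 v\<^sub>x + c\<^sub>2 u\<close>,  \<open>u(0,t) = q v(0,t)\<close>,  \<open>v(1,t) = U(t)\<close>
  with initial data \<open>(u0, v0)\<close>; here \<open>u t x\<close> stands for \<open>u(x,t)\<close>. The identity is obtained
  by multiplying the equations by \<open>\<phi>\<close> and \<open>\<psi>\<close>, adding, and integrating by parts over the
  rectangle; \<open>\<epsilon>\<^sub>1' \<phi> + \<epsilon>\<^sub>1 \<phi>\<^sub>x\<close> is the \<open>x\<close>-derivative of \<open>\<epsilon>\<^sub>1 \<phi>\<close>. Since \<open>u\<close> and \<open>v\<close> are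
  continuous in time with values in \<open>L\<^sup>2\<close>, the inner space integral is continuous in \<open>t\<close>, so
  the iterated integral makes sense without joint measurability.\<close>

definition weak_solution ::
  "(real \<Rightarrow> real) \<Rightarrow> (real \<Rightarrow> real) \<Rightarrow> (real \<Rightarrow> real) \<Rightarrow> (real \<Rightarrow> real) \<Rightarrow>
   (real \<Rightarrow> real) \<Rightarrow> (real \<Rightarrow> real) \<Rightarrow> real \<Rightarrow> (real \<Rightarrow> real) \<Rightarrow>
   (real \<Rightarrow> real) \<Rightarrow> (real \<Rightarrow> real) \<Rightarrow>
   (real \<Rightarrow> real \<Rightarrow> real) \<Rightarrow> (real \<Rightarrow> real \<Rightarrow> real) \<Rightarrow> bool" where
  "weak_solution \<epsilon>\<^sub>1 \<epsilon>\<^sub>1' \<epsilon>\<^sub>2 \<epsilon>\<^sub>2' c\<^sub>1 c\<^sub>2 q U u0 v0 u v \<longleftrightarrow>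
     (\<forall>t\<ge>0. L2_on {0..1} (u t) \<and> L2_on {0..1} (v t)) \<and>
     (\<forall>t\<^sub>0\<ge>0. ((\<lambda>t. L2_norm (\<lambda>x. u t x - u t\<^sub>0 x) (\<lambda>x. v t x - v t\<^sub>0 x)) \<longlongrightarrow> 0)
        (at t\<^sub>0 within {0..})) \<and>
     (\<forall>\<tau>>0. L2_on {0..\<tau>} U) \<and>
     (AE x in lebesgue_on {0..1}. u 0 x = u0 x \<and> v 0 x = v0 x) \<and>
     (\<forall>\<tau>>0. \<forall>\<phi> \<phi>t \<phi>x \<psi> \<psi>t \<psi>x. test_pair \<epsilon>\<^sub>1 \<epsilon>\<^sub>2 q \<tau> \<phi> \<phi>t \<phi>x \<psi> \<psi>t \<psi>x \<longrightarrow>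
        (LINT x|lebesgue_on {0..1}. \<phi> \<tau> x * u \<tau> x + \<psi> \<tau> x * v \<tau> x)
        - (LINT x|lebesgue_on {0..1}. \<phi> 0 x * u0 x + \<psi> 0 x * v0 x)
        = (LINT t|lebesgue_on {0..\<tau>}. \<epsilon>\<^sub>2 1 * \<psi> t 1 * U t)
          + (LINT t|lebesgue_on {0..\<tau>}. LINT x|lebesgue_on {0..1}.
               (\<phi>t t x + (\<epsilon>\<^sub>1' x * \<phi> t x + \<epsilon>\<^sub>1 x * \<phi>x t x) + c\<^sub>2 x * \<psi> t x) * u t x
               + (\<psi>t t x - (\<epsilon>\<^sub>2' x * \<psi> t x + \<epsilon>\<^sub>2 x * \<psi>x t x) + c\<^sub>1 x * \<phi> t x) * v t x))"

definition feedback ::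
  "(real \<Rightarrow> real \<Rightarrow> real) \<Rightarrow> (real \<Rightarrow> real \<Rightarrow> real) \<Rightarrow>
   (real \<Rightarrow> real \<Rightarrow> real) \<Rightarrow> (real \<Rightarrow> real \<Rightarrow> real) \<Rightarrow> real \<Rightarrow> real" where
  "feedback Kvu Kvv u v t =
     (LINT \<xi>|lebesgue_on {0..1}. Kvu 1 \<xi> * u t \<xi>) + (LINT \<xi>|lebesgue_on {0..1}. Kvv 1 \<xi> * v t \<xi>)"

end

theory Submission
  imports Defs
begin

text \<open>The kernels are merely continuous and the solution merely square integrable in space, so
  \<beta> cannot be differentiated directly: every derivative must fall on a smooth profile, and the
  transformation is moved onto the test functions. The integrals subtracted there are adjoint
  Volterra operators applied to g; paired with (u, v) they turn v into \<beta>. The profiles P and F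
  are free solutions of the adjoint transport equations, and F(t) = q P(-t) is the adjoint form of
  the reflection u = q v at x = 0. Transforming u as well would take two further kernels; without
  them the coupling in the u-equation stays as a source. It does not spoil extinction because
  everything is causal: recovering v from \<beta> at x involves only points to the left of x, and
  the characteristic of u through (x, t) has at an earlier time s lost exactly t - s of travel time
  z. So Gronwall closes on z(x) < t - y(1), and with zero data it gives zero. Weighting norms by the
  reciprocal speeds turns transport into translation in travel time, which never increases the norm
  of a profile that initially lies inside the interval.\<close>

text \<open>The argument is by duality and uses only the \<open>v\<close>-component of the backstepping
  transformation, \<open>\<beta> = v - \<integral>\<^sub>0\<^sup>x K\<^sup>v\<^sup>u u - \<integral>\<^sub>0\<^sup>x K\<^sup>v\<^sup>v v\<close>, which formally solves
  \<open>\<beta>\<^sub>t = \<epsilon>\<^sub>2 \<beta>\<^sub>x\<close>, \<open>\<beta>(1,t) = 0\<close>. Let \<open>z\<close> and \<open>y\<close> be the travel times from \<open>0\<close> to \<open>x\<close> at speeds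
  \<open>\<epsilon>\<^sub>1\<close> and \<open>\<epsilon>\<^sub>2\<close>. Although the kernels are merely continuous, they are differentiable along
  characteristics, so that
  \<open>\<phi> = P(z - t)/\<epsilon>\<^sub>1 - \<integral>\<^sub>x\<^sup>1 g K\<^sup>v\<^sup>u\<close>, \<open>\<psi> = g - \<integral>\<^sub>x\<^sup>1 g K\<^sup>v\<^sup>v\<close> with \<open>g = F(t + y)/\<epsilon>\<^sub>2\<close>
  is an admissible test pair whenever \<open>P\<close>, \<open>F\<close> are continuously differentiable, \<open>P(z(1) - t) = 0\<close>
  and \<open>F(t) = q P(-t)\<close> for \<open>0 \<le> t \<le> \<tau>\<close>. In the weak formulation the feedback cancels and only the
  source \<open>c\<^sub>1 v\<close> tested with \<open>P(z - t)/\<epsilon>\<^sub>1\<close> survives. Taking \<open>P = 0\<close> and \<open>F\<close> arbitrary beyond \<open>\<tau>\<close>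
  transports \<open>\<beta>\<close>, which therefore vanishes for \<open>t \<ge> y(1)\<close>. Taking \<open>P\<close> arbitrary gives \<open>u\<close> by
  duality: with \<open>v\<close> controlled by \<open>\<beta>\<close> and \<open>u\<close> through a Volterra inequality, Gronwall's argument
  bounds \<open>u\<close>, and applied on the region \<open>z(x) < t - y(1)\<close>, where no data enter, it
  yields \<open>u = v = 0\<close> there. This region is everything once \<open>t \<ge> z(1) + y(1) = t\<^sub>F\<close>.\<close>

subsection \<open>Oriented integrals, flows and a Gronwall argument\<close>

text \<open>The oriented integral from \<open>a\<close> to \<open>b\<close>, rescaled to a fixed interval so that continuity and
  differentiability in the limits need no case distinction on their order.\<close>

definition oint :: "real \<Rightarrow> real \<Rightarrow> (real \<Rightarrow> real) \<Rightarrow> real" where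
  "oint a b f = integral {0..1} (\<lambda>\<theta>. (b - a) * f (a + \<theta> * (b - a)))"

lemma oint_FTC:
  assumes "\<And>x. (G has_real_derivative f x) (at x)"
  shows "oint a b f = G b - G a"
proof -
  have "((\<lambda>\<theta>. G (a + \<theta> * (b - a))) has_real_derivative f (a + \<theta> * (b - a)) * (b - a)) (at \<theta>)" for \<theta>
    by (rule DERIV_chain2[OF assms]) (auto intro!: derivative_eq_intros)
  then have "((\<lambda>\<theta>. (b - a) * f (a + \<theta> * (b - a))) has_integral
      (G (a + 1 * (b - a)) - G (a + 0 * (b - a)))) {0..1}"
    by (intro fundamental_theorem_of_calculus)
      (auto intro: has_vector_derivative_at_within simp: mult.commute[of "b - a"] has_real_derivative_iff_has_vector_derivative)
  then show ?thesis
    by (simp only: oint_def integral_unique) simp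
qed

lemma antiderivative_exists:
  fixes f :: "real \<Rightarrow> real"
  assumes "continuous_on UNIV f"
  obtains G where "\<And>x. (G has_real_derivative f x) (at x)"
proof -
  have "\<And>x. isCont f x"
    using assms continuous_on_eq_continuous_at open_UNIV by blast
  then have "\<exists>F. \<forall>x. -\<infinity> < ereal x \<longrightarrow> ereal x < \<infinity> \<longrightarrow> (F has_vector_derivative f x) (at x)"
    by (intro einterval_antiderivative) auto
  then obtain G where "\<And>x. (G has_real_derivative f x) (at x)"
    by (auto simp: has_real_derivative_iff_has_vector_derivative)
  then show ?thesis
    by (rule that)
qed

lemma oint_eq_integral:
  assumes "continuous_on UNIV f" "a \<le> b"
  shows "oint a b f = integral {a..b} f"
proof -
  obtain G where G: "\<And>x. (G has_real_derivative f x) (at x)"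
    using antiderivative_exists[OF assms(1)] by blast
  have "(f has_integral (G b - G a)) {a..b}"
    using assms(2) G
    by (intro fundamental_theorem_of_calculus)
      (auto intro: has_vector_derivative_at_within simp: has_real_derivative_iff_has_vector_derivative)
  then show ?thesis
    using oint_FTC[OF G] by (simp add: integral_unique)
qed

lemma oint_add:
  assumes "continuous_on UNIV f" "continuous_on UNIV g"
  shows "oint a b (\<lambda>x. f x + g x) = oint a b f + oint a b g"
proof -
  obtain G H where G: "\<And>x. (G has_real_derivative f x) (at x)" and H: "\<And>x. (H has_real_derivative g x) (at x)"
    using antiderivative_exists assms by metis
  have "oint a b (\<lambda>x. f x + g x) = (G b + H b) - (G a + H a)"
    by (rule oint_FTC) (intro DERIV_add G H)
  then show ?thesis
    using oint_FTC[OF G] oint_FTC[OF H] by simp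
qed

lemma oint_mult: "oint a b (\<lambda>x. c * f x) = c * oint a b f"
  unfolding oint_def by (subst integral_mult_right[symmetric]) (simp add: algebra_simps)

lemma oint_shift: "oint (a + c) (b + c) f = oint a b (\<lambda>x. f (x + c))"
  unfolding oint_def by (simp add: algebra_simps)

lemma oint_refl [simp]: "oint a a f = 0"
  by (simp add: oint_def)

lemma oint_cong:
  assumes "\<And>x. x \<in> closed_segment a b \<Longrightarrow> f x = g x"
  shows "oint a b f = oint a b g"
  unfolding oint_def
proof (rule integral_cong)
  fix \<theta> :: real assume "\<theta> \<in> {0..1}"
  then have "a + \<theta> * (b - a) \<in> closed_segment a b"
    by (auto simp: in_segment intro!: exI[of _ \<theta>]) (simp add: algebra_simps)
  then show "(b - a) * f (a + \<theta> * (b - a)) = (b - a) * g (a + \<theta> * (b - a))"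
    using assms by simp
qed

lemma oint_subst:
  assumes "continuous_on UNIV f" "\<And>x. (g has_real_derivative g' x) (at x)"
  shows "oint (g a) (g b) f = oint a b (\<lambda>x. f (g x) * g' x)"
proof -
  obtain G where G: "\<And>x. (G has_real_derivative f x) (at x)"
    using antiderivative_exists[OF assms(1)] by blast
  have "oint a b (\<lambda>x. f (g x) * g' x) = G (g b) - G (g a)"
    by (rule oint_FTC) (rule DERIV_chain2[OF G assms(2)])
  then show ?thesis
    using oint_FTC[OF G] by simp
qed

lemma continuous_on_oint:
  assumes f: "continuous_on UNIV (\<lambda>(z, s). f z s)"
    and g: "continuous_on A (g :: 'a::topological_space \<Rightarrow> 'b::topological_space)" and l: "continuous_on A l" and r: "continuous_on A r"
  shows "continuous_on A (\<lambda>x. oint (l x) (r x) (f (g x)))"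
proof -
  let ?S = "A \<times> cbox 0 (1::real)"
  have fst: "continuous_on ?S (\<lambda>x. h (fst x))" if "continuous_on A h" for h :: "'a \<Rightarrow> 'b"
    by (rule continuous_on_compose2[OF that]) (auto intro: continuous_intros)
  have fst': "continuous_on ?S (\<lambda>x. h (fst x))" if "continuous_on A h" for h :: "'a \<Rightarrow> real"
    by (rule continuous_on_compose2[OF that]) (auto intro: continuous_intros)
  have "continuous_on ?S (\<lambda>x. (\<lambda>(z, s). f z s) (g (fst x), l (fst x) + snd x * (r (fst x) - l (fst x))))"
    by (rule continuous_on_compose2[OF f]) (intro continuous_on_Pair continuous_on_add continuous_on_mult
        continuous_on_diff fst[OF g] fst'[OF l] fst'[OF r] continuous_on_snd continuous_on_id subset_UNIV)+
  then have "continuous_on ?S (\<lambda>x. (r (fst x) - l (fst x)) *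
      (\<lambda>(z, s). f z s) (g (fst x), l (fst x) + snd x * (r (fst x) - l (fst x))))"
    by (intro continuous_on_mult continuous_on_diff fst'[OF l] fst'[OF r])
  then have "continuous_on ?S (\<lambda>(x, \<theta>). (r x - l x) * f (g x) (l x + \<theta> * (r x - l x)))"
    by (simp add: case_prod_unfold)
  from integral_continuous_on_param[OF this] show ?thesis
    by (simp add: oint_def)
qed

text \<open>Only integrals starting at 0 are differentiated: as a function of the parameter and the
  upper limit such an integral has both partial derivatives, the one in the limit being jointly
  continuous. Hence it is jointly differentiable, and the chain rule covers moving limits.\<close>

lemma oint_leibniz:
  fixes f fz :: "real \<Rightarrow> real \<Rightarrow> real"
  assumes f: "continuous_on UNIV (\<lambda>(z, s). f z s)"
    and fz: "continuous_on UNIV (\<lambda>(z, s). fz z s)"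
    and D: "\<And>z s. ((\<lambda>z. f z s) has_real_derivative fz z s) (at z)"
    and l: "(l has_real_derivative l') (at z0)" and r: "(r has_real_derivative r') (at z0)"
  shows "((\<lambda>z. oint (l z) (r z) (f z)) has_real_derivative
      (oint (l z0) (r z0) (fz z0) + r' * f z0 (r z0) - l' * f z0 (l z0))) (at z0)"
proof -
  have fc: "continuous_on UNIV (f z)" for z
    by (rule continuous_on_compose2[OF f, of UNIV "\<lambda>s. (z, s)", simplified]) (intro continuous_intros)
  have fzc: "continuous_on UNIV (fz z)" for z
    by (rule continuous_on_compose2[OF fz, of UNIV "\<lambda>s. (z, s)", simplified]) (intro continuous_intros)
  have FTC: "((\<lambda>p. oint 0 p (f z)) has_real_derivative f z p) (at p)" for z p
  proof -
    obtain G where G: "\<And>x. (G has_real_derivative f z x) (at x)"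
      using antiderivative_exists[OF fc] by blast
    show ?thesis
      unfolding oint_FTC[OF G] by (auto intro!: derivative_eq_intros G)
  qed
  have split: "oint a b (f z) = oint 0 b (f z) - oint 0 a (f z)"
    and splitz: "oint a b (fz z) = oint 0 b (fz z) - oint 0 a (fz z)" for a b z
  proof -
    obtain G where G: "\<And>x. (G has_real_derivative f z x) (at x)"
      using antiderivative_exists[OF fc] by blast
    show "oint a b (f z) = oint 0 b (f z) - oint 0 a (f z)"
      unfolding oint_FTC[OF G] by simp
    obtain H where H: "\<And>x. (H has_real_derivative fz z x) (at x)"
      using antiderivative_exists[OF fzc] by blast
    show "oint a b (fz z) = oint 0 b (fz z) - oint 0 a (fz z)"
      unfolding oint_FTC[OF H] by simp
  qed
  have Dz: "((\<lambda>z. oint 0 p (f z)) has_real_derivative oint 0 p (fz z)) (at z)" for p z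
  proof -
    have "((\<lambda>z. integral (cbox 0 1) (\<lambda>\<theta>. (p - 0) * f z (0 + \<theta> * (p - 0)))) has_field_derivative
        integral (cbox 0 1) (\<lambda>\<theta>. (p - 0) * fz z (0 + \<theta> * (p - 0)))) (at z within UNIV)"
    proof (rule leibniz_rule_field_derivative)
      show "((\<lambda>x. (p - 0) * f x (0 + t * (p - 0))) has_real_derivative (p - 0) * fz x (0 + t * (p - 0))) (at x within UNIV)" for x t
        by (intro DERIV_cmult D)
      show "(\<lambda>\<theta>. (p - 0) * f x (0 + \<theta> * (p - 0))) integrable_on cbox 0 1" for x
        by (intro integrable_continuous continuous_intros continuous_on_compose2[OF fc]) auto
      have "continuous_on (UNIV \<times> cbox 0 1) (\<lambda>x. (\<lambda>(z, s). fz z s) (fst x, 0 + snd x * (p - 0)))"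
        by (intro continuous_intros continuous_on_compose2[OF fz]) auto
      then show "continuous_on (UNIV \<times> cbox 0 1) (\<lambda>(x, t). (p - 0) * fz x (0 + t * (p - 0)))"
        unfolding case_prod_unfold by (intro continuous_on_mult_left) auto
    qed auto
    then show ?thesis
      by (simp add: oint_def)
  qed
  have joint: "((\<lambda>(z, p). oint 0 p (f z)) has_derivative
      (\<lambda>(tx, ty). oint 0 p (fz z0) * tx + blinfun_apply (blinfun_scaleR_left (f z0 p)) ty)) (at (z0, p) within UNIV \<times> UNIV)" for p
  proof (rule has_derivative_partialsI)
    show "((\<lambda>x. oint 0 p (f x)) has_derivative (*) (oint 0 p (fz z0))) (at z0 within UNIV)"
      using Dz[of p z0] by (simp add: has_field_derivative_def)
    show "((\<lambda>y. oint 0 y (f x)) has_derivative blinfun_apply (blinfun_scaleR_left (f x y))) (at y within UNIV)" for x y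
      using FTC[of x y] by (simp add: has_field_derivative_def mult.commute[of _ "f x y"] mult_commute_abs)
    have "isCont (\<lambda>(z, s). f z s) (z0, p)"
      using f continuous_on_eq_continuous_at open_UNIV by blast
    then have "isCont (\<lambda>x. f (fst x) (snd x)) (z0, p)"
      by (simp add: case_prod_unfold)
    then show "continuous (at (z0, p) within UNIV \<times> UNIV) (\<lambda>(x, y). blinfun_scaleR_left (f x y))"
      by (simp only: case_prod_unfold UNIV_Times_UNIV bounded_linear.continuous[OF bounded_linear_blinfun_scaleR_left])
  qed auto
  have chain: "((\<lambda>z. oint 0 (h z) (f z)) has_real_derivative
      (oint 0 (h z0) (fz z0) + h' * f z0 (h z0))) (at z0)"
    if h: "(h has_real_derivative h') (at z0)" for h h'
  proof -
    have g: "((\<lambda>z. (z, h z)) has_derivative (\<lambda>t. (t, h' * t))) (at z0)"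
      using h by (auto intro!: derivative_eq_intros simp: has_field_derivative_def)
    have "((\<lambda>(z, p). oint 0 p (f z)) has_derivative
        (\<lambda>(tx, ty). oint 0 (h z0) (fz z0) * tx + blinfun_apply (blinfun_scaleR_left (f z0 (h z0))) ty)) (at (z0, h z0))"
      using joint[of "h z0"] by simp
    from has_derivative_compose[OF g this]
    have "((\<lambda>z. oint 0 (h z) (f z)) has_derivative
        (\<lambda>t. oint 0 (h z0) (fz z0) * t + (h' * t) * f z0 (h z0))) (at z0)"
      by simp
    also have "(\<lambda>t. oint 0 (h z0) (fz z0) * t + (h' * t) * f z0 (h z0)) = (*) (oint 0 (h z0) (fz z0) + h' * f z0 (h z0))"
      by (auto simp: algebra_simps)
    finally show ?thesis
      unfolding has_field_derivative_def .
  qed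
  have "((\<lambda>z. oint 0 (r z) (f z) - oint 0 (l z) (f z)) has_real_derivative
      (oint 0 (r z0) (fz z0) + r' * f z0 (r z0)) - (oint 0 (l z0) (fz z0) + l' * f z0 (l z0))) (at z0)"
    by (intro DERIV_diff chain l r)
  then show ?thesis
    by (simp add: split[of "l _"] splitz[of "l _"] algebra_simps)
qed

text \<open>The upper bound on the speed makes travel times grow at least linearly, so
  \<open>z\<close> is onto and its inverse, the flow \<open>Z\<close>, exists for all times. Working
  on the whole line avoids any discussion of when a flow leaves the unit interval.\<close>

lemma flow_coordinates:
  fixes e :: "real \<Rightarrow> real"
  assumes e: "continuous_on UNIV e" and pos: "\<And>x. 0 < e x" and bd: "\<And>x. e x \<le> B"
  obtains z Z where "z 0 = 0" "\<And>x. (z has_real_derivative 1 / e x) (at x)"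
    "\<And>s. (Z has_real_derivative e (Z s)) (at s)" "\<And>x. Z (z x) = x" "\<And>s. z (Z s) = s"
    "strict_mono z" "strict_mono Z"
proof -
  have B: "B > 0"
    using pos[of 0] bd[of 0] by simp
  have "continuous_on UNIV (\<lambda>x. 1 / e x)"
    using pos by (intro continuous_on_divide continuous_on_const e) (metis less_irrefl)
  then obtain G where G: "\<And>x. (G has_real_derivative 1 / e x) (at x)"
    using antiderivative_exists by blast
  define z where "z = (\<lambda>x. G x - G 0)"
  have z: "(z has_real_derivative 1 / e x) (at x)" for x
    unfolding z_def using DERIV_diff[OF G[of x] DERIV_const] by simp
  have mono: "strict_mono z"
  proof (rule strict_monoI)
    fix a b :: real assume "a < b"
    have ex: "\<exists>y. (z has_real_derivative y) (at x) \<and> 0 < y" for x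
      using z[of x] pos[of x] by (intro exI[of _ "1 / e x"]) simp
    show "z a < z b"
      by (rule DERIV_pos_imp_increasing[OF \<open>a < b\<close>]) (rule ex)
  qed
  have cont: "continuous_on S z" for S
    by (rule DERIV_continuous_on[of S z "\<lambda>x. 1 / e x"]) (rule DERIV_subset[OF z subset_UNIV])
  have grow: "z b - z a \<ge> (b - a) / B" if "a \<le> b" for a b
  proof -
    have "(\<lambda>x. z x - x / B) a \<le> (\<lambda>x. z x - x / B) b"
    proof (rule DERIV_nonneg_imp_nondecreasing[OF that])
      fix x
      have "1 / e x - 1 / B \<ge> 0"
        using pos[of x] bd[of x] by (simp add: frac_le)
      moreover have "((\<lambda>x. z x - x / B) has_real_derivative 1 / e x - 1 / B) (at x)"
        by (intro DERIV_diff z DERIV_cdivide DERIV_ident)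
      ultimately show "\<exists>y. ((\<lambda>x. z x - x / B) has_real_derivative y) (at x) \<and> 0 \<le> y"
        by blast
    qed
    then show ?thesis
      by (simp add: diff_divide_distrib)
  qed
  have "\<exists>x. z x = s" for s
  proof -
    define b where "b = B * \<bar>s\<bar>"
    have b: "b \<ge> 0" "b / B = \<bar>s\<bar>"
      using B by (auto simp: b_def)
    have "z 0 = 0" by (simp add: z_def)
    with grow[of 0 b] grow[of "-b" 0] b have "z (-b) \<le> s" "s \<le> z b"
      by auto
    then show ?thesis
      using IVT'[of z "-b" s b] cont b by auto
  qed
  then obtain Z where zZ: "\<And>s. z (Z s) = s"
    by metis
  have Zz: "Z (z x) = x" for x
    using mono zZ strict_mono_eq by blast
  have Zmono: "strict_mono Z"
    using mono zZ unfolding strict_mono_def by (metis linorder_neqE not_less_iff_gr_or_eq)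
  have Zcont: "isCont Z s" for s
  proof -
    have "isCont Z (z (Z s))"
      by (rule isCont_inverse_function[of 1 _ Z z])
        (use Zz DERIV_isCont[OF z] in auto)
    then show ?thesis by (simp add: zZ)
  qed
  have "(Z has_real_derivative inverse (1 / e (Z s))) (at s)" for s
    by (rule DERIV_inverse_function[where f = z and a = "s - 1" and b = "s + 1"])
      (use z[of "Z s"] zZ Zcont pos[of "Z s"] in auto)
  then have "(Z has_real_derivative e (Z s)) (at s)" for s
    by simp
  then show ?thesis
    using that[of z Z] z mono Zmono Zz zZ by (simp add: z_def)
qed

text \<open>The integral hypothesis of Gronwall's lemma is replaced by its effect on bounds of the form
  \<open>m exp(B t)\<close>, so that no measurability of \<open>f\<close> is needed.\<close>

lemma gronwall_sup:
  fixes f :: "real \<Rightarrow> real"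
  assumes T: "0 \<le> T" and bd: "\<And>t. t \<in> {0..T} \<Longrightarrow> f t \<le> M" and nn: "\<And>t. t \<in> {0..T} \<Longrightarrow> 0 \<le> f t"
    and B: "0 \<le> B"
    and step: "\<And>m t. 0 \<le> m \<Longrightarrow> (\<And>s. s \<in> {0..T} \<Longrightarrow> f s \<le> m * exp (B * s)) \<Longrightarrow> t \<in> {0..T} \<Longrightarrow>
      f t \<le> A * exp (B * t) + m / 2 * exp (B * t)"
    and t: "t \<in> {0..T}"
  shows "f t \<le> 2 * A * exp (B * t)"
proof -
  let ?g = "\<lambda>s. f s * exp (- B * s)"
  define m where "m = (SUP s\<in>{0..T}. ?g s)"
  have g: "?g s \<le> M" if "s \<in> {0..T}" for s
  proof -
    have "?g s \<le> f s * 1"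
      using nn[OF that] B that by (intro mult_left_mono) auto
    then show ?thesis
      using bd[OF that] by simp
  qed
  have bdd: "bdd_above (?g ` {0..T})"
    using g unfolding bdd_above_def by blast
  have le: "?g s \<le> m" if "s \<in> {0..T}" for s
    unfolding m_def by (rule cSUP_upper[OF that bdd])
  have m0: "0 \<le> m"
    using le[of 0] nn[of 0] T by auto
  have conv: "(f s \<le> c * exp (B * s)) = (?g s \<le> c)" for s c
    by (simp add: exp_minus field_simps)
  have "f s \<le> (A + m / 2) * exp (B * s)" if "s \<in> {0..T}" for s
    using step[OF m0 _ that] le conv by (simp add: algebra_simps)
  then have "?g s \<le> A + m / 2" if "s \<in> {0..T}" for s
    using that conv by blast
  \<comment> \<open>The least admissible constant \<open>m\<close>, finite because of
    \<open>M\<close>, improves itself and is therefore at most \<open>2 * A\<close>.\<close>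
  then have "m \<le> A + m / 2"
    unfolding m_def using T by (intro cSUP_least) auto
  then have "?g t \<le> 2 * A"
    using le[OF t] by simp
  then show ?thesis
    using conv by blast
qed

text \<open>Forward averages over windows of length at most \<open>d\<close>: the support grows only
  to the left and never beyond \<open>b\<close>. They are difference quotients of an antiderivative,
  hence continuously differentiable.\<close>

lemma C1_approximation:
  fixes p :: "real \<Rightarrow> real"
  assumes p: "continuous_on UNIV p" and M: "\<And>s. \<bar>p s\<bar> \<le> M"
    and supp: "\<And>s. s \<le> a \<or> b \<le> s \<Longrightarrow> p s = 0"
    and d: "0 < d"
  obtains P P' where "\<And>n s. (P n has_real_derivative P' n s) (at s)" "\<And>n. continuous_on UNIV (P' n)"
    "\<And>n s. \<bar>P n s\<bar> \<le> M" "\<And>n s. s \<le> a - d \<or> b \<le> s \<Longrightarrow> P n s = (0::real)" "\<And>s. (\<lambda>n. P n s) \<longlonglongrightarrow> p s"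
proof -
  define h where "h = (\<lambda>n. d / real (Suc n))"
  have h: "0 < h n" "h n \<le> d" for n
    using d by (auto simp: h_def field_simps)
  define P where "P = (\<lambda>n s. oint 0 1 (\<lambda>\<theta>. p (s + h n * \<theta>)))"
  obtain G where G: "\<And>x. (G has_real_derivative p x) (at x)"
    using antiderivative_exists[OF p] by blast
  have PG: "P n s = (G (s + h n) - G s) / h n" for n s
  proof -
    have "P n s = G (s + h n * 1) / h n - G (s + h n * 0) / h n"
      unfolding P_def
    proof (rule oint_FTC)
      show "((\<lambda>x. G (s + h n * x) / h n) has_real_derivative p (s + h n * x)) (at x)" for x
        using h(1)[of n] by (auto intro!: derivative_eq_intros DERIV_chain2[OF G])
    qed
    then show ?thesis by (simp add: diff_divide_distrib)
  qed
  \<comment> \<open>Each average is a value of \<open>p\<close> inside its window, which yields the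
    bound, the support and the convergence at once.\<close>
  have mvt: "\<exists>x. s < x \<and> x < s + h n \<and> P n s = p x" for n s
    using MVT2[of s "s + h n" G p] G h(1)[of n] unfolding PG by auto
  show ?thesis
  proof
    show "(P n has_real_derivative (p (s + h n) - p s) / h n) (at s)" for n s
      unfolding PG[abs_def] using h(1)[of n]
      by (auto intro!: derivative_eq_intros DERIV_chain2[OF G])
    show "continuous_on UNIV (\<lambda>s. (p (s + h n) - p s) / h n)" for n
      using h(1)[of n] by (intro continuous_intros continuous_on_compose2[OF p]) auto
    show "\<bar>P n s\<bar> \<le> M" for n s
      using mvt[of s n] M by auto
    show "P n s = 0" if "s \<le> a - d \<or> b \<le> s" for n s
    proof -
      obtain x where x: "s < x" "x < s + h n" "P n s = p x"
        using mvt by blast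
      then have "x \<le> a \<or> b \<le> x"
        using that h(2)[of n] by auto
      then show ?thesis using x supp by simp
    qed
    show "(\<lambda>n. P n s) \<longlonglongrightarrow> p s" for s
    proof -
      obtain x where x: "\<And>n. s < x n \<and> x n < s + h n \<and> P n s = p (x n)"
        using mvt by metis
      have h0: "(\<lambda>n. s + h n) \<longlonglongrightarrow> s + 0"
        unfolding h_def by (intro tendsto_add tendsto_const LIMSEQ_Suc[OF lim_const_over_n])
      have "x \<longlonglongrightarrow> s"
        by (rule tendsto_sandwich[of "\<lambda>_. s" _ _ "\<lambda>n. s + h n"]) (use x h0 in \<open>auto intro!: always_eventually less_imp_le\<close>)
      moreover have "isCont p s"
        using p continuous_on_eq_continuous_at open_UNIV by blast
      ultimately have "(\<lambda>n. p (x n)) \<longlonglongrightarrow> p s"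
        by (rule isCont_tendsto_compose[rotated])
      then show ?thesis
        using x by simp
    qed
  qed
qed

subsection \<open>Dual test functions built from the kernels\<close>

text \<open>This retraction onto the unit interval extends the coefficients by constants, so that
  travel times, flows and integrals along characteristics live on the whole line.\<close>

definition clip :: "real \<Rightarrow> real" where
  "clip x = max 0 (min 1 x)"

lemma clip_in [simp]: "0 \<le> clip x" "clip x \<le> 1"
  by (auto simp: clip_def)

lemma clip_id: "x \<in> {0..1} \<Longrightarrow> clip x = x"
  by (auto simp: clip_def)

lemma continuous_on_clip: "continuous_on S f \<Longrightarrow> continuous_on S (\<lambda>x. clip (f x))"
  unfolding clip_def by (intro continuous_intros)

lemma continuous_on_compose_clip:
  assumes "continuous_on {0..1} f" "continuous_on S g"
  shows "continuous_on S (\<lambda>x. f (clip (g x)))"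
  by (rule continuous_on_compose2[OF assms(1) continuous_on_clip[OF assms(2)]]) auto

lemma cont_compose2:
  assumes "continuous_on UNIV (\<lambda>(x, y). f x y)" "continuous_on S g" "continuous_on S h"
  shows "continuous_on S (\<lambda>x. f (g x) (h x))"
  using continuous_on_compose2[OF assms(1) continuous_on_Pair[OF assms(2,3)]] by simp

lemma cont_compose:
  fixes f :: "real \<Rightarrow> real"
  assumes "continuous_on UNIV f" "continuous_on S g"
  shows "continuous_on S (\<lambda>x. f (g x))"
  by (rule continuous_on_compose2[OF assms]) simp

lemma C1_rectangle_diff:
  assumes f: "C1_rectangle \<tau> f ft fx" and g: "C1_rectangle \<tau> g gt gx"
  shows "C1_rectangle \<tau> (\<lambda>t x. f t x - g t x) (\<lambda>t x. ft t x - gt t x) (\<lambda>t x. fx t x - gx t x)"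
  unfolding C1_rectangle_def case_prod_unfold
proof (intro conjI ballI)
  fix t x assume t: "t \<in> {0..\<tau>}" and x: "x \<in> {0..1::real}"
  show "((\<lambda>s. f s x - g s x) has_real_derivative ft t x - gt t x) (at t within {0..\<tau>})"
    "((\<lambda>y. f t y - g t y) has_real_derivative fx t x - gx t x) (at x within {0..1})"
    by (rule DERIV_diff; use f g t x in \<open>simp add: C1_rectangle_def\<close>)+
next
  show "continuous_on ({0..\<tau>} \<times> {0..1}) (\<lambda>p. ft (fst p) (snd p) - gt (fst p) (snd p))"
    "continuous_on ({0..\<tau>} \<times> {0..1}) (\<lambda>p. fx (fst p) (snd p) - gx (fst p) (snd p))"
    by (rule continuous_on_diff; use f g in \<open>simp add: C1_rectangle_def case_prod_unfold\<close>)+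
qed

lemma DERIV_shift_add:
  assumes "\<And>s. (F has_real_derivative F' s) (at s)"
  shows "((\<lambda>s. F (a + s)) has_real_derivative F' (a + s)) (at s)"
proof -
  have "((\<lambda>s. F (a + s)) has_real_derivative F' (a + s) * 1) (at s)"
    by (rule DERIV_chain2[OF assms]) (auto intro!: derivative_eq_intros)
  then show ?thesis by simp
qed

lemma quotient_deriv_eq: "e \<noteq> 0 \<Longrightarrow> (a * (1 / e) * e - b * d) / (e * e) = (a / e - b * d / e) / e" for e :: real
  by (simp add: divide_simps)

text \<open>\<open>z\<close>, \<open>Z\<close> and \<open>y\<close>, \<open>Y\<close> are the travel
  times and flows at the two extended speeds. \<open>W\<close> inverts \<open>y + z\<close>: a
  characteristic of the first kernel keeps y(x) + z(\<xi>) fixed, and \<open>W\<close> locates the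
  point where it meets the diagonal.\<close>

locale backstepping =
  fixes c1 c2 e1 e1' e2 e2' :: "real \<Rightarrow> real"
    and q :: real
    and Kvu Kvv :: "real \<Rightarrow> real \<Rightarrow> real"
    and z Z y Y W :: "real \<Rightarrow> real"
  assumes c1: "continuous_on {0..1} c1" and c2: "continuous_on {0..1} c2"
    and e1: "C1_on {0..1} e1 e1'" and e2: "C1_on {0..1} e2 e2'"
    and e1_pos: "\<And>x. x \<in> {0..1} \<Longrightarrow> e1 x > 0" and e2_pos: "\<And>x. x \<in> {0..1} \<Longrightarrow> e2 x > 0"
    and kernel: "kernel_solution e1 e1' e2 e2' c1 c2 q Kvu Kvv"
    and z0: "z 0 = 0" and Dz: "\<And>x. (z has_real_derivative 1 / e1 (clip x)) (at x)"
    and DZ: "\<And>s. (Z has_real_derivative e1 (clip (Z s))) (at s)"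
    and Zz: "\<And>x. Z (z x) = x" and zZ: "\<And>s. z (Z s) = s" and mz: "strict_mono z" and mZ: "strict_mono Z"
    and y0: "y 0 = 0" and Dy: "\<And>x. (y has_real_derivative 1 / e2 (clip x)) (at x)"
    and DY: "\<And>s. (Y has_real_derivative e2 (clip (Y s))) (at s)"
    and Yy: "\<And>x. Y (y x) = x" and yY: "\<And>s. y (Y s) = s" and my: "strict_mono y" and mY: "strict_mono Y"
    and W: "continuous_on UNIV W" and yzW: "\<And>s. y (W s) + z (W s) = s"
begin

lemma continuous_coordinates:
  "continuous_on UNIV z" "continuous_on UNIV Z" "continuous_on UNIV y" "continuous_on UNIV Y"
  using DERIV_continuous_on[of UNIV, OF Dz] DERIV_continuous_on[of UNIV, OF DZ]
    DERIV_continuous_on[of UNIV, OF Dy] DERIV_continuous_on[of UNIV, OF DY] by blast+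

lemmas cont_z = cont_compose[OF continuous_coordinates(1)]
  and cont_Z = cont_compose[OF continuous_coordinates(2)]
  and cont_y = cont_compose[OF continuous_coordinates(3)]
  and cont_Y = cont_compose[OF continuous_coordinates(4)]
  and cont_W = cont_compose[OF W]

lemma mono_le [simp]: "z a \<le> z b \<longleftrightarrow> a \<le> b" "y a \<le> y b \<longleftrightarrow> a \<le> b"
    "Z a \<le> Z b \<longleftrightarrow> a \<le> b" "Y a \<le> Y b \<longleftrightarrow> a \<le> b"
  using mz my mZ mY by (simp_all add: strict_mono_less_eq)

lemma mono_less [simp]: "z a < z b \<longleftrightarrow> a < b" "y a < y b \<longleftrightarrow> a < b"
    "Z a < Z b \<longleftrightarrow> a < b" "Y a < Y b \<longleftrightarrow> a < b"
  using mz my mZ mY by (simp_all add: strict_mono_less)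

lemma Z_le_iff: "Z s \<le> x \<longleftrightarrow> s \<le> z x" "x \<le> Z s \<longleftrightarrow> z x \<le> s"
  by (metis mono_le(1) zZ)+

lemma Y_le_iff: "Y s \<le> x \<longleftrightarrow> s \<le> y x" "x \<le> Y s \<longleftrightarrow> y x \<le> s"
  by (metis mono_le(2) yY)+

lemma T_pos: "0 < z 1" "0 < y 1"
  using mono_less(1)[of 0 1] mono_less(2)[of 0 1] by (simp_all add: z0 y0)

lemma e_continuous: "continuous_on {0..1} e1" "continuous_on {0..1} e2"
    "continuous_on {0..1} e1'" "continuous_on {0..1} e2'"
  using e1 e2 DERIV_continuous_on unfolding C1_on_def by blast+

lemma e_deriv: "x \<in> {0..1} \<Longrightarrow> (e1 has_real_derivative e1' x) (at x within {0..1})"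
    "x \<in> {0..1} \<Longrightarrow> (e2 has_real_derivative e2' x) (at x within {0..1})"
  using e1 e2 unfolding C1_on_def by blast+

text \<open>Composition with a retraction of the plane onto the triangle keeps the kernel continuous
  and gives a meaning to integrals along lines that leave the triangle.\<close>

definition Ku :: "real \<Rightarrow> real \<Rightarrow> real" where
  "Ku x \<xi> = Kvu (clip x) (min (clip \<xi>) (clip x))"

definition Kv :: "real \<Rightarrow> real \<Rightarrow> real" where
  "Kv x \<xi> = Kvv (clip x) (min (clip \<xi>) (clip x))"

lemma Ku_eq: "0 \<le> \<xi> \<Longrightarrow> \<xi> \<le> x \<Longrightarrow> x \<le> 1 \<Longrightarrow> Ku x \<xi> = Kvu x \<xi>"
  and Kv_eq: "0 \<le> \<xi> \<Longrightarrow> \<xi> \<le> x \<Longrightarrow> x \<le> 1 \<Longrightarrow> Kv x \<xi> = Kvv x \<xi>"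
  by (auto simp: Ku_def Kv_def clip_def)

lemma continuous_Ku_Kv: "continuous_on UNIV (\<lambda>(x, \<xi>). Ku x \<xi>)" "continuous_on UNIV (\<lambda>(x, \<xi>). Kv x \<xi>)"
proof -
  have r: "continuous_on UNIV (\<lambda>p. (clip (fst p), min (clip (snd p)) (clip (fst p))))"
    by (intro continuous_intros continuous_on_clip)
  have sub: "(\<lambda>p. (clip (fst p), min (clip (snd p)) (clip (fst p)))) ` UNIV \<subseteq> triangle"
    by (auto simp: triangle_def)
  have k: "continuous_on triangle (\<lambda>(x, \<xi>). Kvu x \<xi>)" "continuous_on triangle (\<lambda>(x, \<xi>). Kvv x \<xi>)"
    using kernel unfolding kernel_solution_def by blast+
  show "continuous_on UNIV (\<lambda>(x, \<xi>). Ku x \<xi>)" "continuous_on UNIV (\<lambda>(x, \<xi>). Kv x \<xi>)"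
    using continuous_on_compose2[OF k(1) r sub] continuous_on_compose2[OF k(2) r sub]
    by (simp_all add: Ku_def Kv_def case_prod_unfold)
qed

lemmas cont_Ku = cont_compose2[OF continuous_Ku_Kv(1)]
  and cont_Kv = cont_compose2[OF continuous_Ku_Kv(2)]

section \<open>The kernels along their characteristics\<close>

definition R1 :: "real \<Rightarrow> real \<Rightarrow> real" where
  "R1 x \<xi> = e1' (clip \<xi>) * Ku x \<xi> + c2 (clip \<xi>) * Kv x \<xi>"

definition R2 :: "real \<Rightarrow> real \<Rightarrow> real" where
  "R2 x \<xi> = - e2' (clip \<xi>) * Kv x \<xi> + c1 (clip \<xi>) * Ku x \<xi>"

lemma cont_R1: "continuous_on S g \<Longrightarrow> continuous_on S h \<Longrightarrow> continuous_on S (\<lambda>x. R1 (g x) (h x))"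
  and cont_R2: "continuous_on S g \<Longrightarrow> continuous_on S h \<Longrightarrow> continuous_on S (\<lambda>x. R2 (g x) (h x))"
  unfolding R1_def R2_def
  by (intro continuous_on_add continuous_on_mult continuous_on_minus cont_Ku cont_Kv
      continuous_on_compose_clip[OF c1] continuous_on_compose_clip[OF c2]
      continuous_on_compose_clip[OF e_continuous(3)] continuous_on_compose_clip[OF e_continuous(4)]; assumption)+

text \<open>The kernels in the coordinate that is constant along their characteristics,
  \<open>\<sigma> = y(x) + z(\<xi>)\<close> for the first and \<open>\<sigma> = y(x) - y(\<xi>)\<close> for the second, continued
  beyond the triangle by integrating the extended right-hand sides from the diagonal
  (at \<open>W \<sigma>\<close>) and from the side \<open>\<xi> = 0\<close>. In these coordinates they are differentiable in \<open>\<zeta>\<close>.\<close>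

definition \<kappa>u :: "real \<Rightarrow> real \<Rightarrow> real" where
  "\<kappa>u \<zeta> \<sigma> = Ku (W \<sigma>) (W \<sigma>) - oint (z (W \<sigma>)) \<zeta> (\<lambda>s. R1 (Y (\<sigma> - s)) (Z s))"

definition \<kappa>v :: "real \<Rightarrow> real \<Rightarrow> real" where
  "\<kappa>v \<zeta> \<sigma> = Kv (Y \<sigma>) 0 + oint 0 \<zeta> (\<lambda>s. R2 (Y (\<sigma> + s)) (Y s))"

lemma R1_line: "continuous_on UNIV (\<lambda>(\<sigma>, s). R1 (Y (\<sigma> - s)) (Z s))"
  and R2_line: "continuous_on UNIV (\<lambda>(\<sigma>, s). R2 (Y (\<sigma> + s)) (Y s))"
  unfolding case_prod_unfold by (intro cont_R1 cont_R2 cont_Y cont_Z continuous_intros)+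

lemma cont_\<kappa>u: "continuous_on S g \<Longrightarrow> continuous_on S h \<Longrightarrow> continuous_on S (\<lambda>x. \<kappa>u (g x) (h x))"
  for g h :: "'z::topological_space \<Rightarrow> real"
  unfolding \<kappa>u_def
  by (intro continuous_on_diff cont_Ku cont_W cont_z continuous_on_oint[OF R1_line])

lemma cont_\<kappa>v: "continuous_on S g \<Longrightarrow> continuous_on S h \<Longrightarrow> continuous_on S (\<lambda>x. \<kappa>v (g x) (h x))"
  for g h :: "'z::topological_space \<Rightarrow> real"
  unfolding \<kappa>v_def
  by (intro continuous_on_add cont_Kv cont_Y continuous_on_const continuous_on_oint[OF R2_line])

lemma deriv_\<kappa>u: "((\<lambda>\<zeta>. \<kappa>u \<zeta> \<sigma>) has_real_derivative - R1 (Y (\<sigma> - \<zeta>)) (Z \<zeta>)) (at \<zeta>)"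
  and deriv_\<kappa>v: "((\<lambda>\<zeta>. \<kappa>v \<zeta> \<sigma>) has_real_derivative R2 (Y (\<sigma> + \<zeta>)) (Y \<zeta>)) (at \<zeta>)"
proof -
  have "continuous_on UNIV (\<lambda>s. R1 (Y (\<sigma> - s)) (Z s))"
    by (intro cont_R1 cont_Y cont_Z continuous_intros)
  then obtain G where G: "\<And>s. (G has_real_derivative R1 (Y (\<sigma> - s)) (Z s)) (at s)"
    using antiderivative_exists by blast
  show "((\<lambda>\<zeta>. \<kappa>u \<zeta> \<sigma>) has_real_derivative - R1 (Y (\<sigma> - \<zeta>)) (Z \<zeta>)) (at \<zeta>)"
    unfolding \<kappa>u_def oint_FTC[OF G] using DERIV_diff[OF DERIV_const DERIV_diff[OF G DERIV_const]] by simp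
  have "continuous_on UNIV (\<lambda>s. R2 (Y (\<sigma> + s)) (Y s))"
    by (intro cont_R2 cont_Y continuous_intros)
  then obtain H where H: "\<And>s. (H has_real_derivative R2 (Y (\<sigma> + s)) (Y s)) (at s)"
    using antiderivative_exists by blast
  show "((\<lambda>\<zeta>. \<kappa>v \<zeta> \<sigma>) has_real_derivative R2 (Y (\<sigma> + \<zeta>)) (Y \<zeta>)) (at \<zeta>)"
    unfolding \<kappa>v_def oint_FTC[OF H] using DERIV_add[OF DERIV_const DERIV_diff[OF H DERIV_const]] by simp
qed

text \<open>The bounds on \<open>\<sigma>\<close> place the characteristic between the diagonal
  point \<open>W \<sigma>\<close> and height \<open>x\<close> inside the triangle. There the
  extended right-hand side is the genuine one, and the integrated kernel equation gives the value at
  the end point.\<close>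

lemma \<kappa>u_eq:
  assumes x: "0 \<le> x" "x \<le> 1" and \<sigma>: "y x + z x \<le> \<sigma>" "\<sigma> \<le> y 1 + z x"
  shows "\<kappa>u (z x) \<sigma> = Ku (Y (\<sigma> - z x)) x"
proof -
  define p where "p = W \<sigma>"
  have p: "y p + z p = \<sigma>"
    using yzW by (simp add: p_def)
  have xp: "x \<le> p"
  proof (rule ccontr)
    assume "\<not> x \<le> p"
    then have "y p < y x" "z p < z x" by auto
    then show False using p \<sigma>(1) by linarith
  qed
  have p1: "p \<le> 1"
  proof (rule ccontr)
    assume "\<not> p \<le> 1"
    then have "y 1 < y p" "z 1 < z p" by auto
    moreover have "z x \<le> z 1" using x by simp
    ultimately show False using p \<sigma>(2) by linarith
  qed
  \<comment> \<open>The time needed at speed \<open>e1\<close> to descend from the diagonal point to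
    height \<open>x\<close>; meanwhile the first coordinate moves right at speed
    \<open>e2\<close>.\<close>
  define S where "S = z p - z x"
  have S: "0 \<le> S" using xp by (simp add: S_def)
  define X where "X = (\<lambda>s. Y (y p + s))"
  define X' where "X' = (\<lambda>s. Z (z p - s))"
  have rng: "p \<le> X s" "X s \<le> 1" "x \<le> X' s" "X' s \<le> p" if "s \<in> {0..S}" for s
    using that p \<sigma>(2) unfolding X_def X'_def S_def by (auto simp: Z_le_iff Y_le_iff)
  have char: "characteristic e2 (\<lambda>\<xi>. - e1 \<xi>) S X X'"
    unfolding characteristic_def
  proof (intro conjI ballI S)
    fix s assume s: "s \<in> {0..S}"
    show "(X s, X' s) \<in> triangle"
      using rng[OF s] x by (auto simp: triangle_def)
    have "(X has_real_derivative e2 (clip (X s))) (at s)"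
      unfolding X_def by (rule DERIV_shift_add[OF DY])
    then show "(X has_real_derivative e2 (X s)) (at s within {0..S})"
      using rng[OF s] x by (auto simp: clip_id intro: has_field_derivative_at_within)
    have "(X' has_real_derivative e1 (clip (X' s)) * (-1)) (at s)"
      unfolding X'_def by (rule DERIV_chain2[OF DZ]) (auto intro!: derivative_eq_intros)
    then show "(X' has_real_derivative - e1 (X' s)) (at s within {0..S})"
      using rng[OF s] x p1 by (auto simp: clip_id intro: has_field_derivative_at_within)
  qed
  then have "((\<lambda>s. e1' (X' s) * Kvu (X s) (X' s) + c2 (X' s) * Kvv (X s) (X' s))
           has_integral (Kvu (X S) (X' S) - Kvu (X 0) (X' 0))) {0..S}"
    using kernel unfolding kernel_solution_def by blast
  moreover have "e1' (X' s) * Kvu (X s) (X' s) + c2 (X' s) * Kvv (X s) (X' s) = R1 (X s) (X' s)"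
    if "s \<in> {0..S}" for s
    using rng[OF that] x by (simp add: R1_def Ku_eq Kv_eq clip_id)
  ultimately have "((\<lambda>s. R1 (X s) (X' s)) has_integral (Kvu (X S) (X' S) - Kvu (X 0) (X' 0))) {0..S}"
    by (subst has_integral_cong[where g = "\<lambda>s. e1' (X' s) * Kvu (X s) (X' s) + c2 (X' s) * Kvv (X s) (X' s)"]) auto
  moreover have R: "continuous_on UNIV (\<lambda>s. R1 (X s) (X' s))"
    unfolding X_def X'_def by (intro cont_R1 cont_Y cont_Z continuous_intros)
  ultimately have "oint 0 S (\<lambda>s. R1 (X s) (X' s)) = Kvu (X S) (X' S) - Kvu (X 0) (X' 0)"
    using S by (simp add: oint_eq_integral integral_unique)
  moreover have "X 0 = p" "X' 0 = p" "X' S = x" "X S = Y (\<sigma> - z x)"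
    using p by (auto simp: X_def X'_def Yy Zz S_def algebra_simps intro!: arg_cong[where f = Y])
  moreover have "Kvu p p = Ku p p" "Kvu (X S) x = Ku (X S) x"
    using Ku_eq[of p p] Ku_eq[of x "X S"] rng[of S] S xp p1 x by auto
  \<comment> \<open>Along the curve the coordinate z(\<xi>) decreases, while
    \<open>\<kappa>u\<close> integrates in that coordinate; the substitution by
    \<open>z p - s\<close> accounts for the sign.\<close>
  moreover have "oint (z p) (z x) (\<lambda>s. R1 (Y (\<sigma> - s)) (Z s)) = - oint 0 S (\<lambda>s. R1 (X s) (X' s))"
  proof -
    have 1: "continuous_on UNIV (\<lambda>s. R1 (Y (\<sigma> - s)) (Z s))"
      by (intro cont_R1 cont_Y cont_Z continuous_intros)
    have 2: "((\<lambda>s. z p - s) has_real_derivative - 1) (at s)" for s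
      by (auto intro!: derivative_eq_intros)
    have "oint (z p - 0) (z p - S) (\<lambda>s. R1 (Y (\<sigma> - s)) (Z s)) =
        oint 0 S (\<lambda>s. R1 (Y (\<sigma> - (z p - s))) (Z (z p - s)) * - 1)"
      by (rule oint_subst[OF 1 2])
    also have "(\<lambda>s. R1 (Y (\<sigma> - (z p - s))) (Z (z p - s)) * - 1) = (\<lambda>s. (- 1) * R1 (X s) (X' s))"
      using p by (auto simp: X_def X'_def algebra_simps)
    finally show ?thesis
      by (simp only: oint_mult) (simp add: S_def)
  qed
  ultimately show ?thesis
    by (simp add: \<kappa>u_def p_def)
qed

text \<open>In travel time these characteristics are parallel to the diagonal. They start on the
  side \<xi> = 0 at \<open>Y \<sigma>\<close>, and their time parameter is already the coordinate
  y(\<xi>), so no reparametrization as for \<open>\<kappa>u_eq\<close> occurs.\<close>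

lemma \<kappa>v_eq:
  assumes x: "0 \<le> x" "x \<le> 1" and \<sigma>: "0 \<le> \<sigma>" "\<sigma> \<le> y 1 - y x"
  shows "\<kappa>v (y x) \<sigma> = Kv (Y (\<sigma> + y x)) x"
proof -
  define S where "S = y x"
  have S: "0 \<le> S" using x mono_le(2)[of 0 x] by (simp add: S_def y0)
  define X where "X = (\<lambda>s. Y (\<sigma> + s))"
  have rng: "Y s \<le> X s" "X s \<le> 1" "0 \<le> Y s" if "s \<in> {0..S}" for s
    using that \<sigma> unfolding X_def S_def by (auto simp: Y_le_iff y0 yY)
  have char: "characteristic e2 e2 S X Y"
    unfolding characteristic_def
  proof (intro conjI ballI S)
    fix s assume s: "s \<in> {0..S}"
    show "(X s, Y s) \<in> triangle"
      using rng[OF s] by (auto simp: triangle_def)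
    have "(X has_real_derivative e2 (clip (X s))) (at s)"
      unfolding X_def by (rule DERIV_shift_add[OF DY])
    then show "(X has_real_derivative e2 (X s)) (at s within {0..S})"
      using rng[OF s] by (auto simp: clip_id intro: has_field_derivative_at_within)
    show "(Y has_real_derivative e2 (Y s)) (at s within {0..S})"
      using rng[OF s] DY[of s] by (auto simp: clip_id intro: has_field_derivative_at_within)
  qed
  then have "((\<lambda>s. - e2' (Y s) * Kvv (X s) (Y s) + c1 (Y s) * Kvu (X s) (Y s))
           has_integral (Kvv (X S) (Y S) - Kvv (X 0) (Y 0))) {0..S}"
    using kernel unfolding kernel_solution_def by blast
  moreover have "- e2' (Y s) * Kvv (X s) (Y s) + c1 (Y s) * Kvu (X s) (Y s) = R2 (X s) (Y s)"
    if "s \<in> {0..S}" for s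
    using rng[OF that] by (simp add: R2_def Ku_eq Kv_eq clip_id)
  ultimately have "((\<lambda>s. R2 (X s) (Y s)) has_integral (Kvv (X S) (Y S) - Kvv (X 0) (Y 0))) {0..S}"
    by (subst has_integral_cong[where g = "\<lambda>s. - e2' (Y s) * Kvv (X s) (Y s) + c1 (Y s) * Kvu (X s) (Y s)"]) auto
  moreover have R: "continuous_on UNIV (\<lambda>s. R2 (X s) (Y s))"
    unfolding X_def by (intro cont_R2 cont_Y continuous_intros)
  ultimately have "oint 0 S (\<lambda>s. R2 (X s) (Y s)) = Kvv (X S) (Y S) - Kvv (X 0) (Y 0)"
    using S by (simp add: oint_eq_integral integral_unique)
  moreover have "Y 0 = 0" "Y S = x"
    using Yy[of 0] by (auto simp: y0 S_def Yy)
  moreover have "Kvv (X 0) 0 = Kv (X 0) 0" "Kvv (X S) x = Kv (X S) x"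
    using Kv_eq[of 0 "X 0"] Kv_eq[of x "X S"] rng[of S] rng[of 0] S x \<open>Y 0 = 0\<close> \<open>Y S = x\<close> by auto
  ultimately show ?thesis
    by (simp add: \<kappa>v_def X_def S_def)
qed

section \<open>The kernel integrals of the test pair and their derivatives\<close>

text \<open>With \<eta> = y(s) this is the integral of g(t, s) K(s, x) over s from x to 1, where g =
  F(t + y) / \<open>e2\<close>. In the variable \<eta> time is a mere shift of \<open>F\<close>, so
  time derivatives fall on \<open>F\<close>.\<close>

definition H :: "(real \<Rightarrow> real \<Rightarrow> real) \<Rightarrow> (real \<Rightarrow> real) \<Rightarrow> real \<Rightarrow> real \<Rightarrow> real" where
  "H K F t x = oint (y x) (y 1) (\<lambda>\<eta>. F (t + \<eta>) * K (Y \<eta>) x)"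

lemma continuous_H:
  assumes "continuous_on UNIV F" "continuous_on UNIV (\<lambda>(x, \<xi>). K x \<xi>)"
  shows "continuous_on S (\<lambda>(t, x). H K F t x)"
  unfolding H_def case_prod_unfold
proof (rule continuous_on_oint[of "\<lambda>p \<eta>. F (fst p + \<eta>) * K (Y \<eta>) (snd p)" S "\<lambda>p. p", simplified])
  show "continuous_on UNIV (\<lambda>(z, s). F (fst z + s) * K (Y s) (snd z))"
    unfolding case_prod_unfold
    by (intro continuous_on_mult cont_compose[OF assms(1)] cont_compose2[OF assms(2)]
       cont_Y continuous_intros)
qed (intro cont_y continuous_intros)+

lemma deriv_H_t:
  assumes F: "\<And>s. (F has_real_derivative F' s) (at s)" "continuous_on UNIV F'"
    and K: "continuous_on UNIV (\<lambda>(x, \<xi>). K x \<xi>)"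
  shows "((\<lambda>t. H K F t x) has_real_derivative H K F' t x) (at t)"
proof -
  have Fc: "continuous_on UNIV F"
    using DERIV_continuous_on[of UNIV, OF F(1)] .
  have "((\<lambda>t. oint (y x) (y 1) (\<lambda>\<eta>. F (t + \<eta>) * K (Y \<eta>) x)) has_real_derivative
      oint (y x) (y 1) (\<lambda>\<eta>. F' (t + \<eta>) * K (Y \<eta>) x) + 0 * (F (t + y 1) * K (Y (y 1)) x) -
      0 * (F (t + y x) * K (Y (y x)) x)) (at t)"
  proof (rule oint_leibniz)
    show "continuous_on UNIV (\<lambda>(t, s). F (t + s) * K (Y s) x)"
      unfolding case_prod_unfold
      by (intro continuous_on_mult cont_compose[OF Fc] cont_compose2[OF K]
         cont_Y continuous_intros)
    show "continuous_on UNIV (\<lambda>(t, s). F' (t + s) * K (Y s) x)"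
      unfolding case_prod_unfold
      by (intro continuous_on_mult cont_compose[OF F(2)] cont_compose2[OF K]
         cont_Y continuous_intros)
    show "((\<lambda>t. F (t + s) * K (Y s) x) has_real_derivative F' (t + s) * K (Y s) x) (at t)" for t s
      by (rule DERIV_cmult_right) (simp add: add.commute[of _ s] DERIV_shift_add[OF F(1)])
  qed auto
  then show ?thesis
    by (simp add: H_def)
qed

lemma H_R1:
  assumes "continuous_on UNIV F" "x \<in> {0..1}"
  shows "H R1 F t x = e1' x * H Ku F t x + c2 x * H Kv F t x"
proof -
  have "H R1 F t x = oint (y x) (y 1) (\<lambda>\<eta>. e1' x * (F (t + \<eta>) * Ku (Y \<eta>) x) + c2 x * (F (t + \<eta>) * Kv (Y \<eta>) x))"
    unfolding H_def using assms(2) by (intro oint_cong) (simp add: R1_def clip_id algebra_simps)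
  also have "\<dots> = e1' x * H Ku F t x + c2 x * H Kv F t x"
    unfolding H_def oint_mult[symmetric]
    by (intro oint_add continuous_on_mult continuous_on_const cont_compose[OF assms(1)]
        cont_Ku cont_Kv cont_Y continuous_intros)
  finally show ?thesis .
qed

lemma H_R2:
  assumes "continuous_on UNIV F" "x \<in> {0..1}"
  shows "H R2 F t x = - e2' x * H Kv F t x + c1 x * H Ku F t x"
proof -
  have "H R2 F t x = oint (y x) (y 1) (\<lambda>\<eta>. - e2' x * (F (t + \<eta>) * Kv (Y \<eta>) x) + c1 x * (F (t + \<eta>) * Ku (Y \<eta>) x))"
    unfolding H_def using assms(2) by (intro oint_cong) (simp add: R2_def clip_id algebra_simps)
  also have "\<dots> = - e2' x * H Kv F t x + c1 x * H Ku F t x"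
    unfolding H_def oint_mult[symmetric]
    by (intro oint_add continuous_on_mult continuous_on_const cont_compose[OF assms(1)]
        cont_Ku cont_Kv cont_Y continuous_intros)
  finally show ?thesis .
qed

lemma diagonal: "x \<in> {0..1} \<Longrightarrow> Ku x x = - c2 x / (e1 x + e2 x)"
  using kernel Ku_eq[of x x] unfolding kernel_solution_def by simp

lemma Y_between: "x \<in> {0..1} \<Longrightarrow> \<eta> \<in> closed_segment (y x) (y 1) \<Longrightarrow> x \<le> Y \<eta> \<and> Y \<eta> \<le> 1"
  by (auto simp: closed_segment_eq_real_ivl Y_le_iff split: if_splits)

text \<open>This and \<open>Hv_x\<close> are the space derivatives of \<open>H Ku F\<close> and
  \<open>H Kv F\<close> with all derivatives of the kernels eliminated. The terms at
  \<open>t + y 1\<close> come from the end x = 1 of the integral, the one at \<open>t + y x\<close>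
  from the diagonal condition, and the last two from the right-hand side of the kernel
  equation.\<close>

definition Hu_x :: "(real \<Rightarrow> real) \<Rightarrow> (real \<Rightarrow> real) \<Rightarrow> real \<Rightarrow> real \<Rightarrow> real" where
  "Hu_x F F' t x = (F (t + y 1) * Kvu 1 x + c2 x * (F (t + y x) / e2 x) - H Ku F' t x
     - e1' x * H Ku F t x - c2 x * H Kv F t x) / e1 x"

definition Hv_x :: "(real \<Rightarrow> real) \<Rightarrow> (real \<Rightarrow> real) \<Rightarrow> real \<Rightarrow> real \<Rightarrow> real" where
  "Hv_x F F' t x = (H Kv F' t x - F (t + y 1) * Kvv 1 x - e2' x * H Kv F t x + c1 x * H Ku F t x) / e2 x"

lemma e_nonzero: "x \<in> {0..1} \<Longrightarrow> e1 x \<noteq> 0" "x \<in> {0..1} \<Longrightarrow> e2 x \<noteq> 0"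
  using e1_pos e2_pos by force+

lemma snd_continuous:
  "continuous_on {0..1} f \<Longrightarrow> continuous_on ({0..\<tau>::real} \<times> {0..1::real}) (\<lambda>p. f (snd p))"
  by (rule continuous_on_compose2[of "{0..1}" f]) (auto intro: continuous_intros)

lemma kernel_at_1: "x \<in> {0..1} \<Longrightarrow> Kvu 1 x = Ku 1 x" "x \<in> {0..1} \<Longrightarrow> Kvv 1 x = Kv 1 x"
  by (simp_all add: Ku_eq Kv_eq)

context
  fixes F F' :: "real \<Rightarrow> real"
  assumes F: "\<And>s. (F has_real_derivative F' s) (at s)" and F': "continuous_on UNIV F'"
begin

lemma F_cont: "continuous_on UNIV F"
  using DERIV_continuous_on[of UNIV, OF F] .

text \<open>After the shift \<sigma> = \<eta> + z(x) the kernel enters as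
  \<open>\<kappa>u (z x) \<sigma>\<close>, which for fixed \<sigma> varies along a single
  characteristic and is differentiable there. Both limits move, and the lower one picks up the
  kernel on the diagonal.\<close>

lemma deriv_Hu_x:
  assumes x: "x \<in> {0..1}"
  shows "((\<lambda>x. H Ku F t x) has_real_derivative Hu_x F F' t x) (at x within {0..1})"
proof -
  define f where "f = (\<lambda>x \<sigma>. F (t + \<sigma> - z x) * \<kappa>u (z x) \<sigma>)"
  define fx where "fx = (\<lambda>x \<sigma>. - (1 / e1 (clip x)) *
     (F' (t + \<sigma> - z x) * \<kappa>u (z x) \<sigma> + F (t + \<sigma> - z x) * R1 (Y (\<sigma> - z x)) x))"
  have H: "H Ku F t w = oint (y w + z w) (y 1 + z w) (f w)" if w: "w \<in> {0..1}" for w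
    unfolding oint_shift H_def f_def
  proof (rule oint_cong)
    fix \<eta> assume \<eta>: "\<eta> \<in> closed_segment (y w) (y 1)"
    have "\<kappa>u (z w) (\<eta> + z w) = Ku (Y (\<eta> + z w - z w)) w"
      by (rule \<kappa>u_eq) (use w \<eta> in \<open>auto simp: closed_segment_eq_real_ivl split: if_splits\<close>)
    then show "F (t + \<eta>) * Ku (Y \<eta>) w = F (t + (\<eta> + z w) - z w) * \<kappa>u (z w) (\<eta> + z w)"
      by (simp add: algebra_simps)
  qed
  have pos: "0 < e1 (clip x)" "0 < e2 (clip x)" for x
    by (auto intro: e1_pos e2_pos)
  have nz: "e1 (clip x) \<noteq> 0" for x
    using pos(1)[of x] by simp
  have "((\<lambda>w. oint (y w + z w) (y 1 + z w) (f w)) has_real_derivative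
      (oint (y x + z x) (y 1 + z x) (fx x) + 1 / e1 (clip x) * f x (y 1 + z x)
        - (1 / e2 (clip x) + 1 / e1 (clip x)) * f x (y x + z x))) (at x)"
  proof (rule oint_leibniz)
    show "continuous_on UNIV (\<lambda>(w, s). f w s)"
      unfolding f_def case_prod_unfold
      by (intro continuous_on_mult cont_compose[OF F_cont] cont_\<kappa>u cont_z continuous_intros)
    show "continuous_on UNIV (\<lambda>(w, s). fx w s)"
      unfolding fx_def case_prod_unfold
      by (intro continuous_on_mult continuous_on_add continuous_on_minus continuous_on_divide continuous_on_const
          cont_compose[OF F_cont] cont_compose[OF F'] cont_\<kappa>u cont_R1 cont_z cont_Y
          continuous_on_compose_clip[OF e_continuous(1)] continuous_intros) (use nz in auto)
    show "((\<lambda>w. f w s) has_real_derivative fx w s) (at w)" for w s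
    proof -
      have 1: "((\<lambda>w. F (t + s - z w)) has_real_derivative F' (t + s - z w) * (0 - 1 / e1 (clip w))) (at w)"
        by (rule DERIV_chain2[OF F]) (intro DERIV_diff Dz DERIV_const)
      have 2: "((\<lambda>w. \<kappa>u (z w) s) has_real_derivative (- R1 (Y (s - z w)) (Z (z w))) * (1 / e1 (clip w))) (at w)"
        by (rule DERIV_chain2[OF deriv_\<kappa>u Dz])
      show ?thesis
        unfolding f_def using DERIV_mult[OF 1 2] by (simp add: fx_def Zz algebra_simps)
    qed
    show "((\<lambda>w. y w + z w) has_real_derivative 1 / e2 (clip x) + 1 / e1 (clip x)) (at x)"
      by (intro DERIV_add Dy Dz)
    show "((\<lambda>w. y 1 + z w) has_real_derivative 1 / e1 (clip x)) (at x)"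
      using DERIV_add[OF DERIV_const Dz] by simp
  qed
  also have "oint (y x + z x) (y 1 + z x) (fx x) = - (1 / e1 x) * (H Ku F' t x + H R1 F t x)"
  proof -
    have "oint (y x + z x) (y 1 + z x) (fx x) = oint (y x) (y 1)
       (\<lambda>\<eta>. - (1 / e1 x) * (F' (t + \<eta>) * Ku (Y \<eta>) x + F (t + \<eta>) * R1 (Y \<eta>) x))"
      unfolding oint_shift fx_def
    proof (rule oint_cong)
      fix \<eta> assume \<eta>: "\<eta> \<in> closed_segment (y x) (y 1)"
      have "\<kappa>u (z x) (\<eta> + z x) = Ku (Y (\<eta> + z x - z x)) x"
        by (rule \<kappa>u_eq) (use x \<eta> in \<open>auto simp: closed_segment_eq_real_ivl split: if_splits\<close>)
      then show "- (1 / e1 (clip x)) * (F' (t + (\<eta> + z x) - z x) * \<kappa>u (z x) (\<eta> + z x) + F (t + (\<eta> + z x) - z x) * R1 (Y (\<eta> + z x - z x)) x)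
        = - (1 / e1 x) * (F' (t + \<eta>) * Ku (Y \<eta>) x + F (t + \<eta>) * R1 (Y \<eta>) x)"
        using x by (simp add: algebra_simps clip_id)
    qed
    also have "\<dots> = - (1 / e1 x) * (H Ku F' t x + H R1 F t x)"
      unfolding oint_mult H_def
      by (subst oint_add) (auto intro!: continuous_on_mult continuous_on_const cont_compose[OF F_cont]
        cont_compose[OF F'] cont_Ku cont_R1 continuous_coordinates continuous_on_add continuous_on_id)
    finally show ?thesis .
  qed
  also have "f x (y 1 + z x) = F (t + y 1) * Kvu 1 x"
  proof -
    have "\<kappa>u (z x) (y 1 + z x) = Ku (Y (y 1 + z x - z x)) x"
      by (rule \<kappa>u_eq) (use x in auto)
    then show ?thesis
      unfolding f_def using x Ku_eq[of x 1] by (simp add: Yy)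
  qed
  also have "f x (y x + z x) = F (t + y x) * Ku x x"
  proof -
    have "\<kappa>u (z x) (y x + z x) = Ku (Y (y x + z x - z x)) x"
      by (rule \<kappa>u_eq) (use x in auto)
    then show ?thesis
      unfolding f_def by (simp add: Yy)
  qed
  also have "- (1 / e1 x) * (H Ku F' t x + H R1 F t x) + 1 / e1 (clip x) * (F (t + y 1) * Kvu 1 x)
        - (1 / e2 (clip x) + 1 / e1 (clip x)) * (F (t + y x) * Ku x x) = Hu_x F F' t x"
  proof -
    \<comment> \<open>The sum of the reciprocal speeds is (\<open>e1\<close> + \<open>e2\<close>) /
      (\<open>e1\<close> \<open>e2\<close>), so the denominator of the diagonal value cancels and
      what remains is \<open>c2\<close> times g, divided by \<open>e1\<close>.\<close>
    have "(1 / e2 x + 1 / e1 x) * (F (t + y x) * Ku x x) = - c2 x * F (t + y x) / (e1 x * e2 x)"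
      using e1_pos[OF x] e2_pos[OF x] by (simp add: diagonal[OF x] divide_simps)
    note k = this
    show ?thesis
      unfolding H_R1[OF F_cont x] clip_id[OF x] Hu_x_def k
      using e1_pos[OF x] e2_pos[OF x] by (simp add: field_simps)
  qed
  finally have "((\<lambda>w. oint (y w + z w) (y 1 + z w) (f w)) has_real_derivative Hu_x F F' t x) (at x within {0..1})"
    by (rule has_field_derivative_at_within)
  then show ?thesis
    by (rule has_field_derivative_transform_within[OF _ zero_less_one x]) (simp add: H)
qed

text \<open>The shift \<sigma> = \<eta> - y(x) freezes the lower limit at 0, because this family of
  characteristics is parallel to the diagonal. Hence no diagonal term arises and only the end x = 1
  contributes a boundary value.\<close>

lemma deriv_Hv_x:
  assumes x: "x \<in> {0..1}"
  shows "((\<lambda>x. H Kv F t x) has_real_derivative Hv_x F F' t x) (at x within {0..1})"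
proof -
  define f where "f = (\<lambda>x \<sigma>. F (t + \<sigma> + y x) * \<kappa>v (y x) \<sigma>)"
  define fx where "fx = (\<lambda>x \<sigma>. (1 / e2 (clip x)) *
     (F' (t + \<sigma> + y x) * \<kappa>v (y x) \<sigma> + F (t + \<sigma> + y x) * R2 (Y (\<sigma> + y x)) x))"
  have shift: "oint (y w) (y 1) g = oint 0 (y 1 - y w) (\<lambda>\<sigma>. g (\<sigma> + y w))" for w g
    using oint_shift[of 0 "y w" "y 1 - y w" g] by simp
  have H: "H Kv F t w = oint 0 (y 1 - y w) (f w)" if w: "w \<in> {0..1}" for w
    unfolding shift H_def f_def
  proof (rule oint_cong)
    fix \<sigma> assume \<sigma>: "\<sigma> \<in> closed_segment 0 (y 1 - y w)"
    have "\<kappa>v (y w) \<sigma> = Kv (Y (\<sigma> + y w)) w"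
      by (rule \<kappa>v_eq) (use w \<sigma> in \<open>auto simp: closed_segment_eq_real_ivl split: if_splits\<close>)
    then show "F (t + (\<sigma> + y w)) * Kv (Y (\<sigma> + y w)) w = F (t + \<sigma> + y w) * \<kappa>v (y w) \<sigma>"
      by (simp add: algebra_simps)
  qed
  have pos: "0 < e2 (clip x)" for x
    by (auto intro: e2_pos)
  have nz: "e2 (clip x) \<noteq> 0" for x
    using pos[of x] by simp
  have "((\<lambda>w. oint 0 (y 1 - y w) (f w)) has_real_derivative
      (oint 0 (y 1 - y x) (fx x) + (- (1 / e2 (clip x))) * f x (y 1 - y x) - 0 * f x 0)) (at x)"
  proof (rule oint_leibniz)
    show "continuous_on UNIV (\<lambda>(w, s). f w s)"
      unfolding f_def case_prod_unfold
      by (intro continuous_on_mult cont_compose[OF F_cont] cont_\<kappa>v cont_y continuous_intros)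
    show "continuous_on UNIV (\<lambda>(w, s). fx w s)"
      unfolding fx_def case_prod_unfold
      by (intro continuous_on_mult continuous_on_add continuous_on_divide continuous_on_const
          cont_compose[OF F_cont] cont_compose[OF F'] cont_\<kappa>v cont_R2 cont_y cont_Y
          continuous_on_compose_clip[OF e_continuous(2)] continuous_intros) (use nz in auto)
    show "((\<lambda>w. f w s) has_real_derivative fx w s) (at w)" for w s
    proof -
      have 1: "((\<lambda>w. F (t + s + y w)) has_real_derivative F' (t + s + y w) * (0 + 1 / e2 (clip w))) (at w)"
        by (rule DERIV_chain2[OF F]) (intro DERIV_add Dy DERIV_const)
      have 2: "((\<lambda>w. \<kappa>v (y w) s) has_real_derivative (R2 (Y (s + y w)) (Y (y w))) * (1 / e2 (clip w))) (at w)"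
        by (rule DERIV_chain2[OF deriv_\<kappa>v Dy])
      show ?thesis
        unfolding f_def using DERIV_mult[OF 1 2] by (simp add: fx_def Yy algebra_simps)
    qed
    show "((\<lambda>w. y 1 - y w) has_real_derivative - (1 / e2 (clip x))) (at x)"
      using DERIV_diff[OF DERIV_const Dy] by simp
  qed simp
  also have "oint 0 (y 1 - y x) (fx x) = (1 / e2 x) * (H Kv F' t x + H R2 F t x)"
  proof -
    have "oint 0 (y 1 - y x) (fx x) = oint 0 (y 1 - y x)
       (\<lambda>\<sigma>. (1 / e2 x) * (F' (t + (\<sigma> + y x)) * Kv (Y (\<sigma> + y x)) x + F (t + (\<sigma> + y x)) * R2 (Y (\<sigma> + y x)) x))"
      unfolding fx_def
    proof (rule oint_cong)
      fix \<sigma> assume \<sigma>: "\<sigma> \<in> closed_segment 0 (y 1 - y x)"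
      have "\<kappa>v (y x) \<sigma> = Kv (Y (\<sigma> + y x)) x"
        by (rule \<kappa>v_eq) (use x \<sigma> in \<open>auto simp: closed_segment_eq_real_ivl split: if_splits\<close>)
      then show "1 / e2 (clip x) * (F' (t + \<sigma> + y x) * \<kappa>v (y x) \<sigma> + F (t + \<sigma> + y x) * R2 (Y (\<sigma> + y x)) x)
        = 1 / e2 x * (F' (t + (\<sigma> + y x)) * Kv (Y (\<sigma> + y x)) x + F (t + (\<sigma> + y x)) * R2 (Y (\<sigma> + y x)) x)"
        using x by (simp add: algebra_simps clip_id)
    qed
    also have "\<dots> = oint (y x) (y 1)
       (\<lambda>\<eta>. (1 / e2 x) * (F' (t + \<eta>) * Kv (Y \<eta>) x + F (t + \<eta>) * R2 (Y \<eta>) x))"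
      unfolding shift ..
    also have "\<dots> = (1 / e2 x) * (H Kv F' t x + H R2 F t x)"
      unfolding oint_mult H_def
      by (subst oint_add) (auto intro!: continuous_on_mult continuous_on_const cont_compose[OF F_cont]
        cont_compose[OF F'] cont_Kv cont_R2 continuous_coordinates continuous_on_add continuous_on_id)
    finally show ?thesis .
  qed
  also have "f x (y 1 - y x) = F (t + y 1) * Kvv 1 x"
  proof -
    have "\<kappa>v (y x) (y 1 - y x) = Kv (Y (y 1 - y x + y x)) x"
      by (rule \<kappa>v_eq) (use x in auto)
    then show ?thesis
      unfolding f_def using x Kv_eq[of x 1] by (simp add: Yy)
  qed
  also have "(1 / e2 x) * (H Kv F' t x + H R2 F t x) + (- (1 / e2 (clip x))) * (F (t + y 1) * Kvv 1 x)
        - 0 * f x 0 = Hv_x F F' t x"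
    unfolding H_R2[OF F_cont x] clip_id[OF x] Hv_x_def using e2_pos[OF x]
    by (simp add: field_simps)
  finally have "((\<lambda>w. oint 0 (y 1 - y w) (f w)) has_real_derivative Hv_x F F' t x) (at x within {0..1})"
    by (rule has_field_derivative_at_within)
  then show ?thesis
    by (rule has_field_derivative_transform_within[OF _ zero_less_one x]) (simp add: H)
qed

lemma C1_Hu: "C1_rectangle \<tau> (\<lambda>t x. H Ku F t x) (\<lambda>t x. H Ku F' t x) (Hu_x F F')"
  unfolding C1_rectangle_def
proof (intro conjI ballI)
  fix t x assume x: "x \<in> {0..1::real}"
  show "((\<lambda>s. H Ku F s x) has_real_derivative H Ku F' t x) (at t within {0..\<tau>})"
    by (rule has_field_derivative_at_within[OF deriv_H_t[OF F F' continuous_Ku_Kv(1)]])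
  show "((\<lambda>x. H Ku F t x) has_real_derivative Hu_x F F' t x) (at x within {0..1})"
    by (rule deriv_Hu_x[OF x])
next
  show "continuous_on ({0..\<tau>} \<times> {0..1}) (\<lambda>(t, x). H Ku F' t x)"
    by (rule continuous_H[OF F' continuous_Ku_Kv(1)])
  note hs = continuous_H[OF F' continuous_Ku_Kv(1), of "{0..\<tau>} \<times> {0..1}", unfolded case_prod_unfold]
    continuous_H[OF F_cont continuous_Ku_Kv(1), of "{0..\<tau>} \<times> {0..1}", unfolded case_prod_unfold]
    continuous_H[OF F_cont continuous_Ku_Kv(2), of "{0..\<tau>} \<times> {0..1}", unfolded case_prod_unfold]
  have "continuous_on ({0..\<tau>} \<times> {0..1}) (\<lambda>p. (F (fst p + y 1) * Ku 1 (snd p) + c2 (snd p) * (F (fst p + y (snd p)) / e2 (snd p)) - H Ku F' (fst p) (snd p)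
     - e1' (snd p) * H Ku F (fst p) (snd p) - c2 (snd p) * H Kv F (fst p) (snd p)) / e1 (snd p))"
    by (intro continuous_on_add continuous_on_diff continuous_on_mult continuous_on_divide snd_continuous[OF c2] snd_continuous[OF e_continuous(1)]
      snd_continuous[OF e_continuous(2)] snd_continuous[OF e_continuous(3)] cont_Ku cont_y cont_compose[OF F_cont] hs
      continuous_on_fst continuous_on_snd continuous_on_id continuous_on_const) (auto simp: e_nonzero)
  then show "continuous_on ({0..\<tau>} \<times> {0..1}) (\<lambda>(t, x). Hu_x F F' t x)"
    by (rule continuous_on_eq) (auto simp: Hu_x_def kernel_at_1)
qed

lemma C1_Hv: "C1_rectangle \<tau> (\<lambda>t x. H Kv F t x) (\<lambda>t x. H Kv F' t x) (Hv_x F F')"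
  unfolding C1_rectangle_def
proof (intro conjI ballI)
  fix t x assume x: "x \<in> {0..1::real}"
  show "((\<lambda>s. H Kv F s x) has_real_derivative H Kv F' t x) (at t within {0..\<tau>})"
    by (rule has_field_derivative_at_within[OF deriv_H_t[OF F F' continuous_Ku_Kv(2)]])
  show "((\<lambda>x. H Kv F t x) has_real_derivative Hv_x F F' t x) (at x within {0..1})"
    by (rule deriv_Hv_x[OF x])
next
  show "continuous_on ({0..\<tau>} \<times> {0..1}) (\<lambda>(t, x). H Kv F' t x)"
    by (rule continuous_H[OF F' continuous_Ku_Kv(2)])
  note hs = continuous_H[OF F' continuous_Ku_Kv(2), of "{0..\<tau>} \<times> {0..1}", unfolded case_prod_unfold]
    continuous_H[OF F_cont continuous_Ku_Kv(1), of "{0..\<tau>} \<times> {0..1}", unfolded case_prod_unfold]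
    continuous_H[OF F_cont continuous_Ku_Kv(2), of "{0..\<tau>} \<times> {0..1}", unfolded case_prod_unfold]
  have "continuous_on ({0..\<tau>} \<times> {0..1}) (\<lambda>p. (H Kv F' (fst p) (snd p) - F (fst p + y 1) * Kv 1 (snd p)
     - e2' (snd p) * H Kv F (fst p) (snd p) + c1 (snd p) * H Ku F (fst p) (snd p)) / e2 (snd p))"
    by (intro continuous_on_add continuous_on_diff continuous_on_mult continuous_on_divide snd_continuous[OF c1]       snd_continuous[OF e_continuous(2)] snd_continuous[OF e_continuous(4)] cont_Kv cont_compose[OF F_cont] hs
      continuous_on_fst continuous_on_snd continuous_on_id continuous_on_const) (auto simp: e_nonzero)
  then show "continuous_on ({0..\<tau>} \<times> {0..1}) (\<lambda>(t, x). Hv_x F F' t x)"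
    by (rule continuous_on_eq) (auto simp: Hv_x_def kernel_at_1)
qed

section \<open>Transported profiles and the assembled test pair\<close>

context
  fixes P P' :: "real \<Rightarrow> real"
  assumes P: "\<And>s. (P has_real_derivative P' s) (at s)" and P': "continuous_on UNIV P'"
begin

lemma P_cont: "continuous_on UNIV P"
  using DERIV_continuous_on[of UNIV, OF P] .

text \<open>Since \<open>e1\<close> times this profile is P(z - t) and z has derivative 1 /
  \<open>e1\<close>, the profile solves the adjoint equation \<phi>_t + (\<open>e1\<close> \<phi>)_x
  = 0; its counterpart below solves \<psi>_t - (\<open>e2\<close> \<psi>)_x = 0.\<close>

lemma C1_transport_left:
  "C1_rectangle \<tau> (\<lambda>t x. P (z x - t) / e1 x) (\<lambda>t x. - P' (z x - t) / e1 x)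
    (\<lambda>t x. (P' (z x - t) / e1 x - P (z x - t) * e1' x / e1 x) / e1 x)"
  unfolding C1_rectangle_def
proof (intro conjI ballI)
  fix t x assume x: "x \<in> {0..1::real}"
  have "((\<lambda>s. P (z x - s)) has_real_derivative P' (z x - t) * (0 - 1)) (at t)"
    by (rule DERIV_chain2[OF P]) (intro DERIV_diff DERIV_const DERIV_ident)
  from DERIV_cdivide[OF this, of "e1 x"]
  show "((\<lambda>s. P (z x - s) / e1 x) has_real_derivative - P' (z x - t) / e1 x) (at t within {0..\<tau>})"
    using has_field_derivative_at_within by fastforce
  have "((\<lambda>w. P (z w - t)) has_real_derivative P' (z x - t) * (1 / e1 (clip x) - 0)) (at x)"
    by (rule DERIV_chain2[OF P]) (intro DERIV_diff DERIV_const Dz)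
  from DERIV_divide[OF has_field_derivative_at_within[OF this] e_deriv(1)[OF x] e_nonzero(1)[OF x]]
  show "((\<lambda>w. P (z w - t) / e1 w) has_real_derivative (P' (z x - t) / e1 x - P (z x - t) * e1' x / e1 x) / e1 x) (at x within {0..1})"
    by (simp only: clip_id[OF x] diff_0_right quotient_deriv_eq[OF e_nonzero(1)[OF x]])
next
  show "continuous_on ({0..\<tau>} \<times> {0..1}) (\<lambda>(t, x). - P' (z x - t) / e1 x)"
    "continuous_on ({0..\<tau>} \<times> {0..1}) (\<lambda>(t, x). (P' (z x - t) / e1 x - P (z x - t) * e1' x / e1 x) / e1 x)"
    unfolding case_prod_unfold
    by (intro continuous_on_diff continuous_on_mult continuous_on_divide continuous_on_minus snd_continuous[OF e_continuous(1)]
      snd_continuous[OF e_continuous(3)] cont_z cont_compose[OF P_cont] cont_compose[OF P']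
      continuous_on_fst continuous_on_snd continuous_on_id continuous_on_const; auto simp: e_nonzero)+
qed

lemma C1_transport_right:
  "C1_rectangle \<tau> (\<lambda>t x. F (t + y x) / e2 x) (\<lambda>t x. F' (t + y x) / e2 x)
    (\<lambda>t x. (F' (t + y x) / e2 x - F (t + y x) * e2' x / e2 x) / e2 x)"
  unfolding C1_rectangle_def
proof (intro conjI ballI)
  fix t x assume x: "x \<in> {0..1::real}"
  have "((\<lambda>s. F (s + y x)) has_real_derivative F' (t + y x) * (1 + 0)) (at t)"
    by (rule DERIV_chain2[OF F]) (intro DERIV_add DERIV_const DERIV_ident)
  from DERIV_cdivide[OF this, of "e2 x"]
  show "((\<lambda>s. F (s + y x) / e2 x) has_real_derivative F' (t + y x) / e2 x) (at t within {0..\<tau>})"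
    using has_field_derivative_at_within by fastforce
  have "((\<lambda>w. F (t + y w)) has_real_derivative F' (t + y x) * (0 + 1 / e2 (clip x))) (at x)"
    by (rule DERIV_chain2[OF F]) (intro DERIV_add DERIV_const Dy)
  from DERIV_divide[OF has_field_derivative_at_within[OF this] e_deriv(2)[OF x] e_nonzero(2)[OF x]]
  show "((\<lambda>w. F (t + y w) / e2 w) has_real_derivative (F' (t + y x) / e2 x - F (t + y x) * e2' x / e2 x) / e2 x) (at x within {0..1})"
    by (simp only: clip_id[OF x] add_0_left quotient_deriv_eq[OF e_nonzero(2)[OF x]])
next
  show "continuous_on ({0..\<tau>} \<times> {0..1}) (\<lambda>(t, x). F' (t + y x) / e2 x)"
    "continuous_on ({0..\<tau>} \<times> {0..1}) (\<lambda>(t, x). (F' (t + y x) / e2 x - F (t + y x) * e2' x / e2 x) / e2 x)"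
    unfolding case_prod_unfold
    by (intro continuous_on_diff continuous_on_mult continuous_on_divide continuous_on_add snd_continuous[OF e_continuous(2)]
      snd_continuous[OF e_continuous(4)] cont_y cont_compose[OF F_cont] cont_compose[OF F']
      continuous_on_fst continuous_on_snd continuous_on_id continuous_on_const; auto simp: e_nonzero)+
qed

text \<open>At x = 1 the kernel integrals run over a degenerate interval and vanish. At x = 0 the
  kernel condition makes \<open>H Kv F\<close> and \<open>H Ku F\<close> satisfy the adjoint
  boundary condition by themselves, so only the profiles are left to be matched.\<close>

lemma dual_test_pair:
  assumes "\<And>t. t \<in> {0..\<tau>} \<Longrightarrow> P (z 1 - t) = 0" "\<And>t. t \<in> {0..\<tau>} \<Longrightarrow> F t = q * P (- t)"
  shows "test_pair e1 e2 q \<tau>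
    (\<lambda>t x. P (z x - t) / e1 x - H Ku F t x) (\<lambda>t x. - P' (z x - t) / e1 x - H Ku F' t x)
    (\<lambda>t x. (P' (z x - t) / e1 x - P (z x - t) * e1' x / e1 x) / e1 x - Hu_x F F' t x)
    (\<lambda>t x. F (t + y x) / e2 x - H Kv F t x) (\<lambda>t x. F' (t + y x) / e2 x - H Kv F' t x)
    (\<lambda>t x. (F' (t + y x) / e2 x - F (t + y x) * e2' x / e2 x) / e2 x - Hv_x F F' t x)"
  unfolding test_pair_def
proof (rule conjI[OF C1_rectangle_diff[OF C1_transport_left C1_Hu]
      conjI[OF C1_rectangle_diff[OF C1_transport_right C1_Hv]]], intro ballI conjI)
  fix t assume t: "t \<in> {0..\<tau>}"
  show "P (z 1 - t) / e1 1 - H Ku F t 1 = 0"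
    using assms(1)[OF t] by (simp add: H_def)
  have K0: "Kv x 0 = q * e1 0 / e2 0 * Ku x 0" if "x \<in> {0..1}" for x
    using kernel that Ku_eq[of 0 x] Kv_eq[of 0 x] unfolding kernel_solution_def by auto
  have "H Kv F t 0 = oint (y 0) (y 1) (\<lambda>\<eta>. q * e1 0 / e2 0 * (F (t + \<eta>) * Ku (Y \<eta>) 0))"
    unfolding H_def by (rule oint_cong) (use Y_between[of 0] K0 in auto)
  then have H0: "H Kv F t 0 = q * e1 0 / e2 0 * H Ku F t 0"
    unfolding oint_mult H_def .
  show "e2 0 * (F (t + y 0) / e2 0 - H Kv F t 0) = q * e1 0 * (P (z 0 - t) / e1 0 - H Ku F t 0)"
    using e_nonzero[of 0] unfolding H0 by (simp add: y0 z0 assms(2)[OF t] field_simps)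
qed

text \<open>The right-hand sides are the residuals of the adjoint system. The terms with
  \<open>F (t + y 1)\<close> reproduce the integrand of the feedback law and will be cancelled by
  the control; the \<open>c1\<close> term stays because \<open>P\<close> is transported freely,
  without regard to that coupling.\<close>

lemma dual_equations:
  assumes x: "x \<in> {0..1}"
  shows "(- P' (z x - t) / e1 x - H Ku F' t x) + (e1' x * (P (z x - t) / e1 x - H Ku F t x)
      + e1 x * ((P' (z x - t) / e1 x - P (z x - t) * e1' x / e1 x) / e1 x - Hu_x F F' t x))
      + c2 x * (F (t + y x) / e2 x - H Kv F t x) = - F (t + y 1) * Kvu 1 x"
    and "(F' (t + y x) / e2 x - H Kv F' t x) - (e2' x * (F (t + y x) / e2 x - H Kv F t x)
      + e2 x * ((F' (t + y x) / e2 x - F (t + y x) * e2' x / e2 x) / e2 x - Hv_x F F' t x))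
      + c1 x * (P (z x - t) / e1 x - H Ku F t x) = - F (t + y 1) * Kvv 1 x + c1 x * (P (z x - t) / e1 x)"
proof -
  have u: "e1 x * Hu_x F F' t x = F (t + y 1) * Kvu 1 x + c2 x * (F (t + y x) / e2 x) - H Ku F' t x
     - e1' x * H Ku F t x - c2 x * H Kv F t x"
    using e_nonzero(1)[OF x] by (simp add: Hu_x_def)
  have v: "e2 x * Hv_x F F' t x = H Kv F' t x - F (t + y 1) * Kvv 1 x - e2' x * H Kv F t x + c1 x * H Ku F t x"
    using e_nonzero(2)[OF x] by (simp add: Hv_x_def)
  have cancel: "e1 x * (r / e1 x) = r" "e2 x * (r / e2 x) = r" for r
    using e_nonzero[OF x] by simp_all
  show "(- P' (z x - t) / e1 x - H Ku F' t x) + (e1' x * (P (z x - t) / e1 x - H Ku F t x)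
      + e1 x * ((P' (z x - t) / e1 x - P (z x - t) * e1' x / e1 x) / e1 x - Hu_x F F' t x))
      + c2 x * (F (t + y x) / e2 x - H Kv F t x) = - F (t + y 1) * Kvu 1 x"
    unfolding right_diff_distrib[of "e1 x"] right_diff_distrib[of "e2 x"] u v cancel
    by (simp add: right_diff_distrib)
  show "(F' (t + y x) / e2 x - H Kv F' t x) - (e2' x * (F (t + y x) / e2 x - H Kv F t x)
      + e2 x * ((F' (t + y x) / e2 x - F (t + y x) * e2' x / e2 x) / e2 x - Hv_x F F' t x))
      + c1 x * (P (z x - t) / e1 x - H Ku F t x) = - F (t + y 1) * Kvv 1 x + c1 x * (P (z x - t) / e1 x)"
    unfolding right_diff_distrib[of "e1 x"] right_diff_distrib[of "e2 x"] u v cancel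
    by (simp add: right_diff_distrib)
qed

end

end

end

subsection \<open>Weighted square-integrable functions on the unit interval\<close>

abbreviation U01 :: "real measure" where
  "U01 \<equiv> lebesgue_on {0..1}"

lemma finite_U01: "finite_measure U01"
  by (rule finite_measure_lebesgue_on) simp

lemma sigma_finite_U01: "sigma_finite_measure U01"
  using finite_U01 by (simp add: finite_measure_def)

lemma measurable_real_U01: "f \<in> borel_measurable borel \<Longrightarrow> f \<in> borel_measurable U01" for f :: "real \<Rightarrow> real"
  by (intro measurable_restrict_space1) (simp add: measurable_completion)

lemma continuous_imp_measurable_U01:
  fixes f :: "real \<Rightarrow> real"
  shows "continuous_on {0..1} f \<Longrightarrow> f \<in> borel_measurable U01"
  by (rule continuous_imp_measurable_on_sets_lebesgue) auto

lemma integrable_bounded_U01: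
  fixes f :: "real \<Rightarrow> real"
  assumes "f \<in> borel_measurable U01" "\<And>x. x \<in> {0..1} \<Longrightarrow> \<bar>f x\<bar> \<le> K"
  shows "integrable U01 f"
  by (rule finite_measure.integrable_const_bound[OF finite_U01 _ assms(1), of K]) (auto intro!: AE_I2 assms)

lemma continuous_bounded_01:
  fixes f :: "real \<Rightarrow> real"
  assumes "continuous_on {0..1} f"
  obtains K where "0 < K" "\<And>x. x \<in> {0..1} \<Longrightarrow> \<bar>f x\<bar> \<le> K"
proof -
  have "bounded (f ` {0..1})"
    by (intro compact_imp_bounded compact_continuous_image assms) simp
  then show ?thesis
    using that by (auto simp: bounded_pos)
qed

lemma integrable_continuous_U01:
  fixes f :: "real \<Rightarrow> real"
  assumes "continuous_on {0..1} f"
  shows "integrable U01 f"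
  using continuous_bounded_01[OF assms] integrable_bounded_U01[OF continuous_imp_measurable_U01[OF assms]] by metis

lemma LINT_continuous_U01:
  fixes f :: "real \<Rightarrow> real"
  assumes "continuous_on {0..1} f"
  shows "(LINT x|U01. f x) = integral {0..1} f"
  by (rule lebesgue_integral_eq_integral[OF integrable_continuous_U01[OF assms]]) simp

lemma LINT_nonneg_U01: "(\<And>x. x \<in> {0..1} \<Longrightarrow> 0 \<le> f x) \<Longrightarrow> 0 \<le> (LINT x|U01. f x)" for f :: "real \<Rightarrow> real"
  by (rule Bochner_Integration.integral_nonneg) simp

lemma LINT_mono_U01:
  fixes f g :: "real \<Rightarrow> real"
  shows "integrable U01 f \<Longrightarrow> integrable U01 g \<Longrightarrow> (\<And>x. x \<in> {0..1} \<Longrightarrow> f x \<le> g x) \<Longrightarrow> (LINT x|U01. f x) \<le> (LINT x|U01. g x)"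
  by (rule Bochner_Integration.integral_mono) auto

lemma LINT_cong_U01:
  fixes f g :: "real \<Rightarrow> real"
  shows "(\<And>x. x \<in> {0..1} \<Longrightarrow> f x = g x) \<Longrightarrow> (LINT x|U01. f x) = (LINT x|U01. g x)"
  by (rule Bochner_Integration.integral_cong) auto

lemma L2_on_measurable: "L2_on S f \<Longrightarrow> f \<in> borel_measurable (lebesgue_on S)"
  and L2_on_square: "L2_on S f \<Longrightarrow> integrable (lebesgue_on S) (\<lambda>x. (f x)\<^sup>2)"
  by (simp_all add: L2_on_def)

lemma L2_on_mult_integrable:
  assumes "L2_on S f" "L2_on S g"
  shows "integrable (lebesgue_on S) (\<lambda>x. f x * g x)"
proof (rule Bochner_Integration.integrable_bound)
  show "integrable (lebesgue_on S) (\<lambda>x. (f x)\<^sup>2 + (g x)\<^sup>2)"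
    using assms by (simp add: L2_on_def)
  show "(\<lambda>x. f x * g x) \<in> borel_measurable (lebesgue_on S)"
    using assms by (auto simp: L2_on_def)
  have "\<bar>a * b\<bar> \<le> a\<^sup>2 + b\<^sup>2" for a b :: real
  proof -
    have "2 * (\<bar>a\<bar> * \<bar>b\<bar>) \<le> a\<^sup>2 + b\<^sup>2"
      using sum_squares_bound[of "\<bar>a\<bar>" "\<bar>b\<bar>"] by (simp add: mult.assoc)
    moreover have "0 \<le> \<bar>a\<bar> * \<bar>b\<bar>" by simp
    ultimately show ?thesis
      unfolding abs_mult by linarith
  qed
  then show "AE x in lebesgue_on S. norm (f x * g x) \<le> norm ((f x)\<^sup>2 + (g x)\<^sup>2)"
    by simp
qed

lemma L2_on_add:
  assumes "L2_on S f" "L2_on S g"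
  shows "L2_on S (\<lambda>x. f x + g x)"
proof -
  have "integrable (lebesgue_on S) (\<lambda>x. (f x)\<^sup>2 + (g x)\<^sup>2 + 2 * (f x * g x))"
    using assms L2_on_mult_integrable[OF assms] by (simp add: L2_on_def)
  then show ?thesis
    using assms by (auto simp: L2_on_def power2_sum mult.assoc)
qed

lemma L2_on_cmult: "L2_on S f \<Longrightarrow> L2_on S (\<lambda>x. c * f x)"
  by (auto simp: L2_on_def power_mult_distrib)

lemma L2_on_diff: "L2_on S f \<Longrightarrow> L2_on S g \<Longrightarrow> L2_on S (\<lambda>x. f x - g x)"
  using L2_on_add[of S f "\<lambda>x. (- 1) * g x"] L2_on_cmult[of S g "- 1"] by simp

lemma L2_on_bounded_mult:
  assumes "g \<in> borel_measurable U01" "\<And>x. x \<in> {0..1} \<Longrightarrow> \<bar>g x\<bar> \<le> K" "L2_on {0..1} f"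
  shows "L2_on {0..1} (\<lambda>x. g x * f x)"
  unfolding L2_on_def
proof
  show m: "(\<lambda>x. g x * f x) \<in> borel_measurable U01"
    using assms(1) L2_on_measurable[OF assms(3)] by simp
  show "integrable U01 (\<lambda>x. (g x * f x)\<^sup>2)"
  proof (rule Bochner_Integration.integrable_bound)
    show "integrable U01 (\<lambda>x. K\<^sup>2 * (f x)\<^sup>2)"
      using L2_on_square[OF assms(3)] by simp
    have "(g x * f x)\<^sup>2 \<le> K\<^sup>2 * (f x)\<^sup>2" if "x \<in> {0..1}" for x
      unfolding power_mult_distrib using assms(2)[OF that]
      by (intro mult_right_mono) (auto simp: abs_le_square_iff[symmetric])
    then show "AE x in U01. norm ((g x * f x)\<^sup>2) \<le> norm (K\<^sup>2 * (f x)\<^sup>2)"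
      by (intro AE_I2) auto
    show "(\<lambda>x. (g x * f x)\<^sup>2) \<in> borel_measurable U01"
      using m by simp
  qed
qed

lemma L2_on_bounded:
  assumes "g \<in> borel_measurable U01" "\<And>x. x \<in> {0..1} \<Longrightarrow> \<bar>g x\<bar> \<le> K"
  shows "L2_on {0..1} g"
proof -
  have "L2_on {0..1} (\<lambda>x. 1 :: real)"
    using integrable_bounded_U01[of "\<lambda>x. 1" 1] by (simp add: L2_on_def)
  from L2_on_bounded_mult[OF assms this] show ?thesis by simp
qed

lemma L2_on_continuous: "continuous_on {0..1} g \<Longrightarrow> L2_on {0..1} g"
  using continuous_bounded_01[of g] L2_on_bounded continuous_imp_measurable_U01 by metis

lemma L2_on_integrable: "L2_on {0..1} f \<Longrightarrow> integrable U01 f"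
  using L2_on_mult_integrable[of "{0..1}" f "\<lambda>_. 1"] L2_on_continuous[of "\<lambda>_. 1"] by simp

lemma Cauchy_Schwarz_LINT:
  assumes f: "L2_on S f" and g: "L2_on S g"
  shows "\<bar>LINT x|lebesgue_on S. f x * g x\<bar> \<le>
    sqrt (LINT x|lebesgue_on S. (f x)\<^sup>2) * sqrt (LINT x|lebesgue_on S. (g x)\<^sup>2)"
proof -
  let ?I = "\<lambda>h. LINT x|lebesgue_on S. h x"
  define a b c where "a = ?I (\<lambda>x. (f x)\<^sup>2)" and "b = ?I (\<lambda>x. f x * g x)" and "c = ?I (\<lambda>x. (g x)\<^sup>2)"
  have quad: "0 \<le> r\<^sup>2 * a - 2 * (r * s * b) + s\<^sup>2 * c" for r s
  proof -
    have "0 \<le> ?I (\<lambda>x. (r * f x - s * g x)\<^sup>2)"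
      by (rule Bochner_Integration.integral_nonneg) simp
    also have "(\<lambda>x. (r * f x - s * g x)\<^sup>2) = (\<lambda>x. r\<^sup>2 * (f x)\<^sup>2 - 2 * (r * s) * (f x * g x) + s\<^sup>2 * (g x)\<^sup>2)"
      by (auto simp: power2_eq_square algebra_simps)
    also have "?I \<dots> = r\<^sup>2 * a - 2 * (r * s * b) + s\<^sup>2 * c"
      using L2_on_square[OF f] L2_on_square[OF g] L2_on_mult_integrable[OF f g]
      by (simp add: a_def b_def c_def)
    finally show ?thesis .
  qed
  have ac: "0 \<le> a" "0 \<le> c"
    unfolding a_def c_def by (rule Bochner_Integration.integral_nonneg; simp)+
  have "b\<^sup>2 \<le> a * c"
  proof (cases "c = 0")
    case True
    have "0 \<le> r * (r * a - 2 * b)" for r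
      using quad[of r 1] True by (simp add: power2_eq_square algebra_simps)
    \<comment> \<open>For c = 0 the form is nonnegative only if b = 0. This value of r turns it into
      a negative multiple of b^2; the denominator a + 1 also covers a = 0.\<close>
    from this[of "b / (a + 1)"] have "0 \<le> - (b\<^sup>2 * (a + 2)) / (a + 1)\<^sup>2"
      using ac(1) by (simp add: power2_eq_square field_simps)
    then have "b\<^sup>2 * (a + 2) \<le> 0"
      using ac(1) by (simp add: divide_le_0_iff zero_le_divide_iff)
    then show ?thesis
      using ac(1) True by (simp add: mult_le_0_iff)
  next
    case False
    with ac have c: "0 < c" by simp
    have "0 \<le> c * (a * c - b\<^sup>2)"
      using quad[of c b] by (simp add: power2_eq_square algebra_simps)
    then show ?thesis
      using c by (simp add: zero_le_mult_iff)
  qed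
  then have "\<bar>b\<bar> \<le> sqrt (a * c)"
    by (intro real_le_rsqrt) simp
  then show ?thesis
    by (simp add: a_def b_def c_def real_sqrt_mult)
qed

section \<open>Weighted norms and their characterization by duality\<close>

definition weight :: "(real \<Rightarrow> real) \<Rightarrow> bool" where
  "weight w \<longleftrightarrow> w \<in> borel_measurable U01 \<and> (\<forall>x\<in>{0..1}. 0 \<le> w x) \<and> (\<exists>B. \<forall>x\<in>{0..1}. w x \<le> B)"

text \<open>The weights in use are reciprocal speeds, possibly cut off by an indicator. Reciprocal
  speeds are the derivatives of the travel times, so the norm of p(z(x)) becomes the unweighted norm
  of p in travel time.\<close>

definition wnorm :: "(real \<Rightarrow> real) \<Rightarrow> (real \<Rightarrow> real) \<Rightarrow> real" where
  "wnorm w f = sqrt (LINT x|U01. w x * (f x)\<^sup>2)"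

lemma weight_sqrt: "weight w \<Longrightarrow> L2_on {0..1} f \<Longrightarrow> L2_on {0..1} (\<lambda>x. sqrt (w x) * f x)"
proof -
  assume w: "weight w" and f: "L2_on {0..1} f"
  then obtain B where B: "\<forall>x\<in>{0..1}. w x \<le> B" and w0: "\<forall>x\<in>{0..1}. 0 \<le> w x" and m: "w \<in> borel_measurable U01"
    by (auto simp: weight_def)
  show ?thesis
    by (rule L2_on_bounded_mult[OF _ _ f, of _ "sqrt B"]) (use m B w0 in auto)
qed

lemma weight_integrable:
  assumes "weight w" "L2_on {0..1} f" "L2_on {0..1} g"
  shows "integrable U01 (\<lambda>x. w x * (f x * g x))"
proof -
  have "integrable U01 (\<lambda>x. sqrt (w x) * f x * (sqrt (w x) * g x))"
    by (intro L2_on_mult_integrable weight_sqrt assms)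
  then show ?thesis
    by (rule Bochner_Integration.integrable_cong[THEN iffD1, rotated 2])
      (use assms(1) in \<open>auto simp: weight_def algebra_simps simp flip: real_sqrt_mult\<close>)
qed

lemma weight_integrable_square: "weight w \<Longrightarrow> L2_on {0..1} f \<Longrightarrow> integrable U01 (\<lambda>x. w x * (f x)\<^sup>2)"
  using weight_integrable[of w f f] by (simp add: power2_eq_square)

lemma wnorm_nonneg: "weight w \<Longrightarrow> 0 \<le> wnorm w f"
  unfolding wnorm_def weight_def by (intro real_sqrt_ge_zero LINT_nonneg_U01) auto

lemma wnorm_square: "weight w \<Longrightarrow> (wnorm w f)\<^sup>2 = (LINT x|U01. w x * (f x)\<^sup>2)"
  unfolding wnorm_def weight_def by (intro real_sqrt_pow2 LINT_nonneg_U01) auto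

lemma wnorm_Cauchy_Schwarz:
  assumes w: "weight w" and f: "L2_on {0..1} f" and g: "L2_on {0..1} g"
  shows "\<bar>LINT x|U01. w x * (f x * g x)\<bar> \<le> wnorm w f * wnorm w g"
proof -
  have "\<bar>LINT x|U01. sqrt (w x) * f x * (sqrt (w x) * g x)\<bar> \<le>
      sqrt (LINT x|U01. (sqrt (w x) * f x)\<^sup>2) * sqrt (LINT x|U01. (sqrt (w x) * g x)\<^sup>2)"
    by (intro Cauchy_Schwarz_LINT weight_sqrt assms)
  moreover have "(LINT x|U01. sqrt (w x) * f x * (sqrt (w x) * g x)) = (LINT x|U01. w x * (f x * g x))"
    using w by (intro LINT_cong_U01) (auto simp: weight_def algebra_simps simp flip: real_sqrt_mult)
  moreover have "(LINT x|U01. (sqrt (w x) * h x)\<^sup>2) = (LINT x|U01. w x * (h x)\<^sup>2)" for h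
    using w by (intro LINT_cong_U01) (auto simp: weight_def power_mult_distrib)
  ultimately show ?thesis
    by (simp add: wnorm_def)
qed

lemma weight_indicator: "weight w \<Longrightarrow> weight (\<lambda>x. indicator {..<X} x * w x)"
  unfolding weight_def
proof (elim conjE exE, intro conjI)
  fix B assume B: "\<forall>x\<in>{0..1}. w x \<le> B" and "\<forall>x\<in>{0..1}. 0 \<le> w x"
  then show "\<exists>B. \<forall>x\<in>{0..1}. indicator {..<X} x * w x \<le> B"
    by (intro exI[of _ B]) (auto split: split_indicator intro: order_trans)
  show "(\<lambda>x. indicator {..<X} x * w x) \<in> borel_measurable U01" if "w \<in> borel_measurable U01"
    using that measurable_real_U01[of "indicator {..<X}"] by auto
qed (auto split: split_indicator)

lemma wnorm_eq_0_imp_AE: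
  assumes "weight w" "L2_on {0..1} f" "wnorm w f = 0" "AE x in U01. w x > 0"
  shows "AE x in U01. f x = 0"
proof -
  have "(LINT x|U01. w x * (f x)\<^sup>2) = 0"
    using assms(3) wnorm_square[OF assms(1), of f] by simp
  then have "AE x in U01. w x * (f x)\<^sup>2 = 0"
    by (subst (asm) integral_nonneg_eq_0_iff_AE[OF weight_integrable_square[OF assms(1,2)]])
      (use assms(1) in \<open>auto simp: weight_def intro!: AE_I2\<close>)
  with assms(4) show ?thesis
    by eventually_elim auto
qed

lemma AE_U01_neq: "AE x in U01. x \<noteq> (a::real)"
proof -
  have "AE x in lebesgue. x \<noteq> a"
    by (rule AE_I'[of "{a}"]) (auto simp: negligible_iff_null_sets[symmetric])
  then show ?thesis
    by (subst AE_restrict_space_iff) auto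
qed

lemma wnorm_cong_AE:
  assumes "f \<in> borel_measurable U01" "g \<in> borel_measurable U01" "w \<in> borel_measurable U01" "AE x in U01. f x = g x"
  shows "wnorm w f = wnorm w g"
  unfolding wnorm_def using assms by (intro arg_cong[where f = sqrt] integral_cong_AE) auto

text \<open>Dominated convergence applies to both sides: the uniform bound \<open>K\<close> gives
  the majorants w K |h| and w K^2, integrable since \<open>w\<close> is bounded and \<open>h\<close>
  square integrable.\<close>

lemma dual_bound_closed:
  assumes w: "weight w" and h: "L2_on {0..1} h"
    and g: "\<And>n. g n \<in> borel_measurable U01" "\<And>n x. x \<in> {0..1} \<Longrightarrow> \<bar>g n x\<bar> \<le> K"
    and lim: "AE x in U01. (\<lambda>n. g n x) \<longlonglongrightarrow> g' x" and g': "g' \<in> borel_measurable U01"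
    and bound: "\<And>n. \<bar>LINT x|U01. w x * (g n x * h x)\<bar> \<le> C * sqrt (LINT x|U01. w x * (g n x)\<^sup>2)"
  shows "\<bar>LINT x|U01. w x * (g' x * h x)\<bar> \<le> C * sqrt (LINT x|U01. w x * (g' x)\<^sup>2)"
proof -
  have K: "0 \<le> K"
    using g(2)[of 0 0] by simp
  have wm: "w \<in> borel_measurable U01" and w0: "\<And>x. x \<in> {0..1} \<Longrightarrow> 0 \<le> w x"
    using w by (auto simp: weight_def)
  have hm: "h \<in> borel_measurable U01"
    by (rule L2_on_measurable[OF h])
  have c: "L2_on {0..1} (\<lambda>_. K)"
    by (rule L2_on_continuous) simp
  have 1: "(\<lambda>n. LINT x|U01. w x * (g n x * h x)) \<longlonglongrightarrow> (LINT x|U01. w x * (g' x * h x))"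
  proof (rule integral_dominated_convergence)
    show "integrable U01 (\<lambda>x. w x * (K * \<bar>h x\<bar>))"
    proof -
      have "L2_on {0..1} (\<lambda>x. \<bar>h x\<bar>)"
        using h by (auto simp: L2_on_def)
      from weight_integrable[OF w c this] show ?thesis .
    qed
    show "AE x in U01. norm (w x * (g n x * h x)) \<le> w x * (K * \<bar>h x\<bar>)" for n
      by (intro AE_I2) (use w0 g(2) in \<open>auto simp: abs_mult intro!: mult_left_mono mult_right_mono\<close>)
    show "AE x in U01. (\<lambda>n. w x * (g n x * h x)) \<longlonglongrightarrow> w x * (g' x * h x)"
      using lim by eventually_elim (intro tendsto_intros)
  qed (use wm hm g(1) g' in auto)
  have 2: "(\<lambda>n. LINT x|U01. w x * (g n x)\<^sup>2) \<longlonglongrightarrow> (LINT x|U01. w x * (g' x)\<^sup>2)"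
  proof (rule integral_dominated_convergence)
    show "integrable U01 (\<lambda>x. w x * K\<^sup>2)"
      by (rule weight_integrable_square[OF w c])
    show "AE x in U01. norm (w x * (g n x)\<^sup>2) \<le> w x * K\<^sup>2" for n
      by (intro AE_I2) (use w0 g(2) K in \<open>auto simp: abs_mult abs_le_square_iff[symmetric] intro!: mult_left_mono\<close>)
    show "AE x in U01. (\<lambda>n. w x * (g n x)\<^sup>2) \<longlonglongrightarrow> w x * (g' x)\<^sup>2"
      using lim by eventually_elim (intro tendsto_intros)
  qed (use wm hm g(1) g' in auto)
  show ?thesis
    by (rule LIMSEQ_le[OF tendsto_rabs[OF 1] tendsto_mult[OF tendsto_const tendsto_real_sqrt[OF 2]]])
      (use bound in auto)
qed

text \<open>The test functions reach \<open>h\<close> itself through two bounded pointwise limits: from continuously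
  differentiable to continuous functions, and from these to truncations of \<open>h\<close>.\<close>

lemma dual_norm_bound:
  fixes z Z :: "real \<Rightarrow> real"
  assumes w: "weight w" and h: "L2_on {0..1} h" and C: "0 \<le> C"
    and z: "continuous_on UNIV z" "z 0 = 0" "strict_mono z" and Z: "continuous_on UNIV Z" "\<And>x. Z (z x) = x" "\<And>s. z (Z s) = s"
    and bound: "\<And>p p'. (\<And>s. (p has_real_derivative p' s) (at s)) \<Longrightarrow> continuous_on UNIV p' \<Longrightarrow>
      (\<And>s. s \<le> 0 \<or> b \<le> s \<Longrightarrow> p s = 0) \<Longrightarrow>
      \<bar>LINT x|U01. w x * (p (z x) * h x)\<bar> \<le> C * sqrt (LINT x|U01. w x * (p (z x))\<^sup>2)"
  shows "wnorm (\<lambda>x. indicator {..<Z b} x * w x) h \<le> C"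
proof -
  have less: "x < Z b \<longleftrightarrow> z x < b" for x
    by (metis Z(3) strict_mono_less[OF z(3)])
  have pos: "0 < z x \<longleftrightarrow> 0 < x" for x
    by (metis z(2) strict_mono_less[OF z(3)])
  have wm: "w \<in> borel_measurable U01" and w0: "\<And>x. x \<in> {0..1} \<Longrightarrow> 0 \<le> w x"
    using w by (auto simp: weight_def)
  have hm: "h \<in> borel_measurable U01"
    by (rule L2_on_measurable[OF h])
  have zc: "continuous_on {0..1} (\<lambda>x. p (z x))" if "continuous_on UNIV p" for p :: "real \<Rightarrow> real"
    by (rule continuous_on_compose2[OF that continuous_on_subset[OF z(1)]]) auto
  have cont: "\<bar>LINT x|U01. w x * (p (z x) * h x)\<bar> \<le> C * sqrt (LINT x|U01. w x * (p (z x))\<^sup>2)"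
    if p: "continuous_on UNIV p" "\<And>s. \<bar>p s\<bar> \<le> K" "\<And>s. s \<le> a \<or> b \<le> s \<Longrightarrow> p s = 0" "0 < a" for p K a
  proof -
    obtain P P' where P: "\<And>n s. (P n has_real_derivative P' n s) (at s)" "\<And>n. continuous_on UNIV (P' n)"
      "\<And>n s. \<bar>P n s\<bar> \<le> K" "\<And>n s. s \<le> a - a \<or> b \<le> s \<Longrightarrow> P n s = (0::real)" "\<And>s. (\<lambda>n. P n s) \<longlonglongrightarrow> p s"
      using C1_approximation[OF p(1,2,3,4)] by blast
    have Pc: "continuous_on UNIV (P n)" for n
      using DERIV_continuous_on[of UNIV, OF P(1)] .
    show ?thesis
    proof (rule dual_bound_closed[OF w h, of "\<lambda>n x. P n (z x)" K])
      show "(\<lambda>x. P n (z x)) \<in> borel_measurable U01" for n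
        by (intro continuous_imp_measurable_U01 zc Pc)
      show "(\<lambda>x. p (z x)) \<in> borel_measurable U01"
        by (intro continuous_imp_measurable_U01 zc p)
      show "\<bar>LINT x|U01. w x * (P n (z x) * h x)\<bar> \<le> C * sqrt (LINT x|U01. w x * (P n (z x))\<^sup>2)" for n
        by (rule bound[OF P(1,2)]) (use P(4) in auto)
    qed (use P in auto)
  qed
  \<comment> \<open>Truncated in size, to be reachable by bounded limits, and to the region 0 < z(x)
    < b, outside which all test profiles vanish.\<close>
  define f where "f = (\<lambda>(K::nat) x. if \<bar>h x\<bar> \<le> real K \<and> 0 < x \<and> x < Z b then h x else 0)"
  have fm: "f K \<in> borel_measurable U01" for K
  proof -
    note hm [measurable]
    have [measurable]: "(\<lambda>x::real. x) \<in> borel_measurable U01"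
      by (intro measurable_real_U01) simp
    show ?thesis
      unfolding f_def by measurable
  qed
  have fb: "\<bar>f K x\<bar> \<le> real K" for K x
    by (auto simp: f_def)
  have trunc: "(LINT x|U01. w x * (f K x)\<^sup>2) \<le> C\<^sup>2" for K
  proof -
    have "f K measurable_on {0..1}"
      using fm by (simp add: measurable_on_iff_borel_measurable)
    then obtain N g where N: "negligible N" and g: "\<And>n. continuous_on UNIV (g n)"
      and lim: "\<And>x. x \<notin> N \<Longrightarrow> (\<lambda>n. g n x) \<longlonglongrightarrow> (if x \<in> {0..1} then f K x else 0)"
      unfolding measurable_on_def by blast
    \<comment> \<open>The cutoff tends to 1 on (0, b). It vanishes up to 1 / (n + 1) rather than
      only up to 0, which leaves room for the leftward spreading of supports in
      \<open>C1_approximation\<close>.\<close>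
    define cut where "cut = (\<lambda>n s. max 0 (min 1 (real n * min (s - 1 / real (Suc n)) (b - s))))"
    define p where "p = (\<lambda>n s. max (- real K) (min (real K) (g n (Z s))) * cut n s)"
    have cut: "0 \<le> cut n s" "cut n s \<le> 1" for n s
      by (auto simp: cut_def)
    have pc: "continuous_on UNIV (p n)" for n
      unfolding p_def cut_def
      by (intro continuous_intros continuous_on_compose2[OF g Z(1)]) auto
    have pb: "\<bar>p n s\<bar> \<le> real K" for n s
    proof -
      have "\<bar>p n s\<bar> \<le> real K * 1"
        unfolding p_def abs_mult using cut[of n s] by (intro mult_mono) auto
      then show ?thesis by simp
    qed
    have p0: "p n s = 0" if "s \<le> 1 / real (Suc n) \<or> b \<le> s" for n s
    proof -
      have "min (s - 1 / real (Suc n)) (b - s) \<le> 0"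
        using that by auto
      then have "real n * min (s - 1 / real (Suc n)) (b - s) \<le> 0"
        by (rule mult_nonneg_nonpos[rotated]) simp
      then show ?thesis
        by (simp add: p_def cut_def)
    qed
    have conv: "(\<lambda>n. p n (z x)) \<longlonglongrightarrow> f K x" if "x \<in> {0..1}" "x \<notin> N" for x
    proof (cases "0 < x \<and> x < Z b")
      case True
      then have s: "0 < z x" "z x < b"
        using less pos by auto
      have "filterlim (\<lambda>n. real n * min (z x - 1 / real (Suc n)) (b - z x)) at_top sequentially"
      proof (rule filterlim_at_top_mult_tendsto_pos)
        show "(\<lambda>n. min (z x - 1 / real (Suc n)) (b - z x)) \<longlonglongrightarrow> min (z x - 0) (b - z x)"
          by (intro tendsto_min tendsto_diff tendsto_const LIMSEQ_Suc[OF lim_const_over_n])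
      qed (use s filterlim_real_sequentially in auto)
      then have "eventually (\<lambda>n. 1 \<le> real n * min (z x - 1 / real (Suc n)) (b - z x)) sequentially"
        by (auto simp: filterlim_at_top)
      then have ev: "eventually (\<lambda>n. p n (z x) = max (- real K) (min (real K) (g n x))) sequentially"
        by eventually_elim (simp add: p_def cut_def Z)
      have "(\<lambda>n. max (- real K) (min (real K) (g n x))) \<longlonglongrightarrow> max (- real K) (min (real K) (f K x))"
        using lim[OF that(2)] that(1) by (intro tendsto_max tendsto_min tendsto_const) auto
      also have "max (- real K) (min (real K) (f K x)) = f K x"
        using fb[of K x] by auto
      finally show ?thesis
        using ev by (simp add: tendsto_cong)
    next
      case False
      then have "z x \<le> 0 \<or> b \<le> z x"
        using less pos by force
      then have "z x \<le> 1 / real (Suc n) \<or> b \<le> z x" for n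
        by (auto intro: order_trans)
      then have "p n (z x) = 0" for n
        by (rule p0)
      moreover have "f K x = 0"
        using False by (auto simp: f_def)
      ultimately show ?thesis by simp
    qed
    have "AE x in U01. x \<notin> N"
    proof -
      have "AE x in lebesgue. x \<notin> N"
        using N by (intro AE_not_in) (simp add: negligible_iff_null_sets)
      then show ?thesis
        by (subst AE_restrict_space_iff) (auto elim: eventually_mono)
    qed
    then have "AE x in U01. (\<lambda>n. p n (z x)) \<longlonglongrightarrow> f K x"
      using AE_space[of U01] by eventually_elim (use conv in auto)
    then have "\<bar>LINT x|U01. w x * (f K x * h x)\<bar> \<le> C * sqrt (LINT x|U01. w x * (f K x)\<^sup>2)"
    proof (rule dual_bound_closed[OF w h, of "\<lambda>n x. p n (z x)" "real K", rotated 2])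
      show "(\<lambda>x. p n (z x)) \<in> borel_measurable U01" for n
        by (intro continuous_imp_measurable_U01 zc pc)
      show "\<bar>LINT x|U01. w x * (p n (z x) * h x)\<bar> \<le> C * sqrt (LINT x|U01. w x * (p n (z x))\<^sup>2)" for n
        by (rule cont[OF pc pb p0]) auto
    qed (use pb fm in auto)
    \<comment> \<open>Testing \<open>h\<close> with its own truncation produces the squared norm of
      the truncation; one square root cancels and leaves a bound by \<open>C\<close> that does not
      depend on the truncation.\<close>
    moreover have "f K x * h x = (f K x)\<^sup>2" for x
      by (simp add: f_def power2_eq_square)
    ultimately have "\<bar>LINT x|U01. w x * (f K x)\<^sup>2\<bar> \<le> C * sqrt (LINT x|U01. w x * (f K x)\<^sup>2)"
      by simp
    moreover define I where "I = (LINT x|U01. w x * (f K x)\<^sup>2)"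
    moreover have I0: "0 \<le> I"
      unfolding I_def using w0 by (intro LINT_nonneg_U01) auto
    ultimately have "sqrt I * sqrt I \<le> C * sqrt I"
      by simp
    then have "sqrt I \<le> C"
    proof (cases "I = 0")
      case False
      then have "0 < sqrt I" using I0 by simp
      with \<open>sqrt I * sqrt I \<le> C * sqrt I\<close> show ?thesis
        by (rule mult_right_le_imp_le)
    qed (use C in simp)
    then show ?thesis
      using sqrt_le_D by (simp add: I_def)
  qed
  have "(\<lambda>K. LINT x|U01. w x * (f K x)\<^sup>2) \<longlonglongrightarrow> (LINT x|U01. indicator {..<Z b} x * w x * (h x)\<^sup>2)"
  proof (rule integral_dominated_convergence)
    show "integrable U01 (\<lambda>x. w x * (h x)\<^sup>2)"
      by (rule weight_integrable_square[OF w h])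
    show "AE x in U01. norm (w x * (f K x)\<^sup>2) \<le> w x * (h x)\<^sup>2" for K
      using w0 by (intro AE_I2) (auto simp: f_def)
    have ev: "(\<lambda>K. w x * (f K x)\<^sup>2) \<longlonglongrightarrow> indicator {..<Z b} x * w x * (h x)\<^sup>2" if "0 < x" for x
    proof -
      have "eventually (\<lambda>K. \<bar>h x\<bar> \<le> real K) sequentially"
        using filterlim_real_sequentially by (simp add: filterlim_at_top)
      then have "eventually (\<lambda>K. w x * (f K x)\<^sup>2 = indicator {..<Z b} x * w x * (h x)\<^sup>2) sequentially"
        by eventually_elim (use that in \<open>auto simp: f_def\<close>)
      then show ?thesis
        by (rule tendsto_eventually)
    qed
    have "AE x in U01. 0 < x"
      using AE_U01_neq[of 0] AE_space[of U01] by eventually_elim auto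
    then show "AE x in U01. (\<lambda>K. w x * (f K x)\<^sup>2) \<longlonglongrightarrow> indicator {..<Z b} x * w x * (h x)\<^sup>2"
      by eventually_elim (rule ev)
    show "(\<lambda>x. indicator {..<Z b} x * w x * (h x)\<^sup>2) \<in> borel_measurable U01"
      using weight_integrable_square[OF weight_indicator[OF w] h] by (rule borel_measurable_integrable)
  qed (use wm fm in auto)
  then have "(LINT x|U01. indicator {..<Z b} x * w x * (h x)\<^sup>2) \<le> C\<^sup>2"
    by (rule LIMSEQ_le_const2) (use trunc in auto)
  then show ?thesis
    unfolding wnorm_def by (intro real_le_lsqrt C)
qed

subsection \<open>Volterra operators\<close>

lemma measurable_indicator_U01: "(indicator {..<X} :: real \<Rightarrow> real) \<in> borel_measurable U01"
  "(indicator {X<..} :: real \<Rightarrow> real) \<in> borel_measurable U01"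
  by (intro measurable_real_U01; simp)+

lemma integrable_indicator_U01:
  assumes "integrable U01 (f :: real \<Rightarrow> real)"
  shows "integrable U01 (\<lambda>x. indicator {..<X} x * f x)"
proof (rule Bochner_Integration.integrable_bound[OF assms])
  show "(\<lambda>x. indicator {..<X} x * f x) \<in> borel_measurable U01"
    using assms measurable_indicator_U01(1)[of X] by auto
qed (auto intro!: AE_I2 split: split_indicator)

lemma LINT_indicator_continuous:
  fixes g :: "real \<Rightarrow> real"
  assumes g: "continuous_on {0..1} g" and x: "x \<in> {0..1}"
  shows "(LINT s|U01. indicator {..<x} s * g s) = integral {0..x} g"
    and "(LINT s|U01. indicator {x<..} s * g s) = integral {x..1} g"
proof -
  have m: "(\<lambda>s. indicator A s * g s) \<in> borel_measurable U01" if "A \<in> sets borel" for A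
    using continuous_imp_measurable_U01[OF g] measurable_real_U01[of "indicator A"] that by auto
  have *: "(LINT s|U01. indicator A s * g s) = integral {c..d} g"
    if A: "A \<in> sets borel" and cd: "0 \<le> c" "d \<le> 1" and eq: "\<And>s. s \<in> {0..1} \<Longrightarrow> s \<noteq> x \<Longrightarrow> s \<in> A \<longleftrightarrow> s \<in> {c..d}" for A c d
  proof -
    have "(LINT s|U01. indicator A s * g s) = integral {0..1} (\<lambda>s. indicator A s * g s)"
    proof (rule lebesgue_integral_eq_integral)
      show "integrable U01 (\<lambda>s. indicator A s * g s)"
        by (rule Bochner_Integration.integrable_bound[OF integrable_continuous_U01[OF g] m[OF A]])
          (auto intro!: AE_I2 split: split_indicator)
    qed simp
    also have "\<dots> = integral {0..1} (\<lambda>s. if s \<in> {c..d} then g s else 0)"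
      by (rule integral_spike[of "{x}"]) (use eq in \<open>auto split: split_indicator\<close>)
    also have "\<dots> = integral {c..d} g"
      unfolding integral_restrict_Int using cd by (intro arg_cong2[where f = integral]) auto
    finally show ?thesis .
  qed
  show "(LINT s|U01. indicator {..<x} s * g s) = integral {0..x} g"
    by (rule *) (use x in auto)
  show "(LINT s|U01. indicator {x<..} s * g s) = integral {x..1} g"
    by (rule *) (use x in auto)
qed

section \<open>A Volterra inequality, by Gronwall in the space variable\<close>

abbreviation cut_square :: "real \<Rightarrow> (real \<Rightarrow> real) \<Rightarrow> real" where
  "cut_square X f \<equiv> (LINT x|U01. indicator {..<X} x * (f x)\<^sup>2)"

lemma cut_square_nonneg: "0 \<le> cut_square X f"
  by (intro LINT_nonneg_U01) auto

lemma cut_square_mono: "L2_on {0..1} f \<Longrightarrow> X \<le> X' \<Longrightarrow> cut_square X f \<le> cut_square X' f"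
  by (intro LINT_mono_U01 integrable_indicator_U01 L2_on_square) (auto split: split_indicator)

lemma cut_integral_square:
  assumes f: "L2_on {0..1} f"
  shows "(LINT s|U01. indicator {..<x} s * \<bar>f s\<bar>)\<^sup>2 \<le> cut_square x f"
proof -
  have a: "L2_on {0..1} (\<lambda>s. \<bar>f s\<bar>)"
    using f by (auto simp: L2_on_def)
  have L: "L2_on {0..1} (\<lambda>s. indicator {..<x} s * \<bar>f s\<bar>)"
    by (rule L2_on_bounded_mult[OF measurable_indicator_U01(1) _ a, of x 1]) (auto split: split_indicator)
  have "\<bar>LINT s|U01. indicator {..<x} s * \<bar>f s\<bar> * 1\<bar> \<le>
      sqrt (LINT s|U01. (indicator {..<x} s * \<bar>f s\<bar>)\<^sup>2) * sqrt (LINT s|U01. 1\<^sup>2)"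
    by (rule Cauchy_Schwarz_LINT[OF L L2_on_continuous]) simp
  also have "(LINT s|U01. 1\<^sup>2) = (1::real)"
    by (subst LINT_continuous_U01) auto
  also have "(LINT s|U01. (indicator {..<x} s * \<bar>f s\<bar>)\<^sup>2) = cut_square x f"
    by (intro LINT_cong_U01) (auto split: split_indicator)
  finally have "\<bar>LINT s|U01. indicator {..<x} s * \<bar>f s\<bar>\<bar> \<le> sqrt (cut_square x f)"
    by simp
  then have "\<bar>LINT s|U01. indicator {..<x} s * \<bar>f s\<bar>\<bar>\<^sup>2 \<le> (sqrt (cut_square x f))\<^sup>2"
    by (intro power_mono) auto
  then show ?thesis
    by (simp add: cut_square_nonneg)
qed

lemma square_sum3: "(a + b + c)\<^sup>2 \<le> 3 * a\<^sup>2 + 3 * b\<^sup>2 + 3 * (c::real)\<^sup>2"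
  using zero_le_power2[of "a - b"] zero_le_power2[of "a - c"] zero_le_power2[of "b - c"]
  by (simp add: power2_eq_square algebra_simps)

text \<open>The integrals at x see only s < x, so Gronwall closes on every initial segment, with a
  constant independent of \<open>X\<close>. Squaring three summands costs a factor 3, and
  \<open>B\<close> = 6 K^2 + 1 is chosen to make 3 K^2 / \<open>B\<close> at most 1/2, as
  \<open>gronwall_sup\<close> demands; the summand 1 keeps \<open>B\<close> positive when K =
  0.\<close>

lemma volterra_bound_01:
  assumes u: "L2_on {0..1} u" and v: "L2_on {0..1} v" and b: "L2_on {0..1} b" and K: "0 \<le> K"
    and le: "\<And>x. x \<in> {0..1} \<Longrightarrow> \<bar>v x\<bar> \<le> \<bar>b x\<bar> + K * (LINT s|U01. indicator {..<x} s * \<bar>u s\<bar>)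
      + K * (LINT s|U01. indicator {..<x} s * \<bar>v s\<bar>)"
    and X: "X \<in> {0..1}"
  shows "cut_square X v \<le> 6 * exp (6 * K\<^sup>2 + 1) * (cut_square X b + K\<^sup>2 * cut_square X u)"
proof -
  define B where "B = 6 * K\<^sup>2 + 1"
  have B: "0 < B"
    by (simp add: B_def add_nonneg_pos)
  define A where "A = 3 * cut_square X b + 3 * K\<^sup>2 * cut_square X u"
  have A: "0 \<le> A"
    by (simp add: A_def cut_square_nonneg)
  have point: "(v x)\<^sup>2 \<le> 3 * (b x)\<^sup>2 + 3 * K\<^sup>2 * cut_square x u + 3 * K\<^sup>2 * cut_square x v" if x: "x \<in> {0..1}" for x
  proof -
    have nn: "0 \<le> (LINT s|U01. indicator {..<x} s * \<bar>f s\<bar>)" for f :: "real \<Rightarrow> real"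
      by (intro LINT_nonneg_U01) auto
    have "(v x)\<^sup>2 = \<bar>v x\<bar>\<^sup>2" by simp
    also have "\<dots> \<le> (\<bar>b x\<bar> + K * (LINT s|U01. indicator {..<x} s * \<bar>u s\<bar>) + K * (LINT s|U01. indicator {..<x} s * \<bar>v s\<bar>))\<^sup>2"
      by (rule power_mono[OF le[OF x]]) simp
    also have "\<dots> \<le> 3 * \<bar>b x\<bar>\<^sup>2 + 3 * (K * (LINT s|U01. indicator {..<x} s * \<bar>u s\<bar>))\<^sup>2 + 3 * (K * (LINT s|U01. indicator {..<x} s * \<bar>v s\<bar>))\<^sup>2"
      by (rule square_sum3)
    also have "\<dots> \<le> 3 * (b x)\<^sup>2 + 3 * (K\<^sup>2 * cut_square x u) + 3 * (K\<^sup>2 * cut_square x v)"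
      unfolding power_mult_distrib
      by (intro add_mono mult_left_mono cut_integral_square u v) auto
    finally show ?thesis by simp
  qed
  have "cut_square X v \<le> 2 * A * exp (B * X)"
  proof (rule gronwall_sup[where f = "\<lambda>t. cut_square t v" and T = X and M = "cut_square X v"])
    fix m t assume m: "0 \<le> m" and h: "\<And>s. s \<in> {0..X} \<Longrightarrow> cut_square s v \<le> m * exp (B * s)" and t: "t \<in> {0..X}"
    have i1: "integrable U01 (\<lambda>x. indicator {..<t} x * (3 * (b x)\<^sup>2))"
      by (intro integrable_indicator_U01 integrable_mult_right L2_on_square b)
    have i2: "integrable U01 (\<lambda>x. indicator {..<t} x * (3 * K\<^sup>2 * cut_square X u))"
      by (intro integrable_indicator_U01 integrable_continuous_U01) simp
    have i3: "integrable U01 (\<lambda>x. indicator {..<t} x * (3 * K\<^sup>2 * m * exp (B * x)))"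
      by (intro integrable_indicator_U01 integrable_continuous_U01 continuous_intros)
    have "cut_square t v \<le> (LINT x|U01. indicator {..<t} x * (3 * (b x)\<^sup>2) + indicator {..<t} x * (3 * K\<^sup>2 * cut_square X u)
        + indicator {..<t} x * (3 * K\<^sup>2 * m * exp (B * x)))"
    proof (rule LINT_mono_U01)
      fix x :: real assume x: "x \<in> {0..1}"
      show "indicator {..<t} x * (v x)\<^sup>2 \<le> indicator {..<t} x * (3 * (b x)\<^sup>2) + indicator {..<t} x * (3 * K\<^sup>2 * cut_square X u)
        + indicator {..<t} x * (3 * K\<^sup>2 * m * exp (B * x))"
      proof (cases "x < t")
        case True
        have "K\<^sup>2 * cut_square x u \<le> K\<^sup>2 * cut_square X u"
          using True t by (intro mult_left_mono cut_square_mono u) auto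
        moreover have "K\<^sup>2 * cut_square x v \<le> K\<^sup>2 * (m * exp (B * x))"
          using True t x by (intro mult_left_mono h) auto
        ultimately show ?thesis
          using point[OF x] True by simp
      qed simp
    qed (intro integrable_indicator_U01 L2_on_square v Bochner_Integration.integrable_add i1 i2 i3)+
    also have "\<dots> = (LINT x|U01. indicator {..<t} x * (3 * (b x)\<^sup>2)) + (LINT x|U01. indicator {..<t} x * (3 * K\<^sup>2 * cut_square X u))
        + (LINT x|U01. indicator {..<t} x * (3 * K\<^sup>2 * m * exp (B * x)))"
      using i1 i2 i3 by simp
    also have "(LINT x|U01. indicator {..<t} x * (3 * (b x)\<^sup>2)) \<le> 3 * cut_square X b"
    proof -
      have "(LINT x|U01. indicator {..<t} x * (3 * (b x)\<^sup>2)) = 3 * cut_square t b"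
        by (subst integral_mult_right_zero[symmetric]) (simp add: algebra_simps)
      then show ?thesis
        using cut_square_mono[OF b, of t X] t by simp
    qed
    also have "(LINT x|U01. indicator {..<t} x * (3 * K\<^sup>2 * cut_square X u)) \<le> 3 * K\<^sup>2 * cut_square X u"
    proof -
      have "(LINT x|U01. indicator {..<t} x * (3 * K\<^sup>2 * cut_square X u)) = integral {0..t} (\<lambda>_. 3 * K\<^sup>2 * cut_square X u)"
        using t X by (intro LINT_indicator_continuous) auto
      also have "\<dots> = t * (3 * K\<^sup>2 * cut_square X u)"
        using t by simp
      also have "\<dots> \<le> 1 * (3 * K\<^sup>2 * cut_square X u)"
        using t X by (intro mult_right_mono) (auto simp: cut_square_nonneg)
      finally show ?thesis by simp
    qed
    also have "(LINT x|U01. indicator {..<t} x * (3 * K\<^sup>2 * m * exp (B * x))) \<le> m / 2 * exp (B * t)"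
    proof -
      have "(LINT x|U01. indicator {..<t} x * (3 * K\<^sup>2 * m * exp (B * x))) = integral {0..t} (\<lambda>x. 3 * K\<^sup>2 * m * exp (B * x))"
        using t X by (intro LINT_indicator_continuous continuous_intros) auto
      also have "((\<lambda>x. 3 * K\<^sup>2 * m * exp (B * x)) has_integral
          (3 * K\<^sup>2 * m * (exp (B * t) / B) - 3 * K\<^sup>2 * m * (exp (B * 0) / B))) {0..t}"
        using t B by (intro fundamental_theorem_of_calculus)
          (auto intro!: derivative_eq_intros simp flip: has_real_derivative_iff_has_vector_derivative)
      from integral_unique[OF this]
      have "integral {0..t} (\<lambda>x. 3 * K\<^sup>2 * m * exp (B * x)) = 3 * K\<^sup>2 * m / B * (exp (B * t) - 1)"
        unfolding right_diff_distrib by simp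
      also have "\<dots> \<le> m / 2 * exp (B * t)"
      proof (rule mult_mono)
        have "3 * K\<^sup>2 * m * 2 \<le> m * B"
          using m by (simp add: B_def algebra_simps)
        then show "3 * K\<^sup>2 * m / B \<le> m / 2"
          using B by (simp add: field_simps)
      qed (use m B t in auto)
      finally show ?thesis .
    qed
    finally have "cut_square t v \<le> A + m / 2 * exp (B * t)"
      by (simp add: A_def)
    also have "A \<le> A * exp (B * t)"
      using A B t by (simp add: mult_le_cancel_left1)
    finally show "cut_square t v \<le> A * exp (B * t) + m / 2 * exp (B * t)"
      by simp
  qed (use X B cut_square_nonneg cut_square_mono[OF v] in auto)
  also have "\<dots> \<le> 2 * A * exp B"
    using A X B by (intro mult_left_mono) (auto simp: mult_le_cancel_left2)
  finally show ?thesis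
    by (simp add: A_def B_def algebra_simps)
qed

text \<open>Later \<open>X\<close> is a moving point \<open>Z (t - D)\<close> that may lie outside
  the unit interval. Replacing it by the nearest point of the interval changes the integrands at
  most at the null point 1.\<close>

lemma volterra_bound:
  assumes u: "L2_on {0..1} u" and v: "L2_on {0..1} v" and b: "L2_on {0..1} b" and K: "0 \<le> K"
    and le: "\<And>x. x \<in> {0..1} \<Longrightarrow> \<bar>v x\<bar> \<le> \<bar>b x\<bar> + K * (LINT s|U01. indicator {..<x} s * \<bar>u s\<bar>)
      + K * (LINT s|U01. indicator {..<x} s * \<bar>v s\<bar>)"
  shows "cut_square X v \<le> 6 * exp (6 * K\<^sup>2 + 1) * (cut_square X b + K\<^sup>2 * cut_square X u)"
proof -
  have "\<exists>X'\<in>{0..1}. \<forall>f. L2_on {0..1} f \<longrightarrow> cut_square X f = cut_square X' f"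
  proof (cases "X < 0")
    case True
    have "cut_square X f = cut_square 0 f" for f
      using True by (intro LINT_cong_U01) (auto split: split_indicator)
    then show ?thesis by (intro bexI[of _ 0]) auto
  next
    case False
    show ?thesis
    proof (cases "X \<le> 1")
      case True
      with False show ?thesis by (intro bexI[of _ X]) auto
    next
      case X: False
      have "cut_square X f = cut_square 1 f" if f: "L2_on {0..1} f" for f
      proof (rule integral_cong_AE)
        have "(\<lambda>x. (f x)\<^sup>2) \<in> borel_measurable U01"
          using L2_on_measurable[OF f] by simp
        then show "(\<lambda>x. indicator {..<X} x * (f x)\<^sup>2) \<in> borel_measurable U01"
          "(\<lambda>x. indicator {..<1} x * (f x)\<^sup>2) \<in> borel_measurable U01"
          using measurable_indicator_U01(1) by auto
        show "AE x in U01. indicator {..<X} x * (f x)\<^sup>2 = indicator {..<1} x * (f x)\<^sup>2"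
          using AE_U01_neq[of 1] AE_space[of U01] by eventually_elim (use X in \<open>auto split: split_indicator\<close>)
      qed
      then show ?thesis by (intro bexI[of _ 1]) auto
    qed
  qed
  then obtain X' where X': "X' \<in> {0..1}" "\<And>f. L2_on {0..1} f \<Longrightarrow> cut_square X f = cut_square X' f"
    by blast
  show ?thesis
    unfolding X'(2)[OF u] X'(2)[OF v] X'(2)[OF b] by (rule volterra_bound_01[OF assms X'(1)])
qed

section \<open>Volterra operators with continuous kernels\<close>

text \<open>The variable limit is encoded by an indicator over the fixed unit interval, so that
  transposition becomes Fubini on a square.\<close>

definition volterra :: "(real \<Rightarrow> real \<Rightarrow> real) \<Rightarrow> (real \<Rightarrow> real) \<Rightarrow> real \<Rightarrow> real" where
  "volterra K f x = (LINT \<xi>|U01. indicator {..<x} \<xi> * (K x \<xi> * f \<xi>))"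

lemma kernel_bounded:
  fixes K :: "real \<Rightarrow> real \<Rightarrow> real"
  assumes "continuous_on UNIV (\<lambda>(x, \<xi>). K x \<xi>)"
  obtains B where "0 < B" "\<And>x \<xi>. x \<in> {0..1} \<Longrightarrow> \<xi> \<in> {0..1} \<Longrightarrow> \<bar>K x \<xi>\<bar> \<le> B"
proof -
  have "compact ((\<lambda>(x, \<xi>). K x \<xi>) ` ({0..1} \<times> {0..1}))"
    by (intro compact_continuous_image compact_Times continuous_on_subset[OF assms]) auto
  then have "bounded ((\<lambda>(x, \<xi>). K x \<xi>) ` ({0..1} \<times> {0..1}))"
    by (rule compact_imp_bounded)
  then obtain B where B: "0 < B" "\<forall>y \<in> (\<lambda>(x, \<xi>). K x \<xi>) ` ({0..1} \<times> {0..1}). norm y \<le> B"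
    unfolding bounded_pos by blast
  show ?thesis
    by (rule that[OF B(1)]) (use B(2) in force)
qed

lemma fst_measurable_U01: "(\<lambda>p. fst p) \<in> borel_measurable (U01 \<Otimes>\<^sub>M U01)"
  and snd_measurable_U01: "(\<lambda>p. snd p) \<in> borel_measurable (U01 \<Otimes>\<^sub>M U01)"
  using measurable_compose[OF measurable_fst measurable_real_U01[of "\<lambda>x. x"]]
    measurable_compose[OF measurable_snd measurable_real_U01[of "\<lambda>x. x"]] by simp_all

lemma volterra_integrand_measurable:
  fixes K :: "real \<Rightarrow> real \<Rightarrow> real" and f :: "real \<Rightarrow> real"
  assumes K: "continuous_on UNIV (\<lambda>(x, \<xi>). K x \<xi>)" and f: "f \<in> borel_measurable U01" and g: "g \<in> borel_measurable U01"
  shows "(\<lambda>(x, \<xi>). g x * (indicator {..<x} \<xi> * (K x \<xi> * f \<xi>)) :: real) \<in> borel_measurable (U01 \<Otimes>\<^sub>M U01)"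
proof -
  note fst_measurable_U01 [measurable] snd_measurable_U01 [measurable]
  have [measurable]: "(\<lambda>p. K (fst p) (snd p)) \<in> borel_measurable (U01 \<Otimes>\<^sub>M U01)"
    by (rule borel_measurable_continuous_Pair[OF fst_measurable_U01 snd_measurable_U01])
      (use K in \<open>simp add: case_prod_unfold\<close>)
  have [measurable]: "(\<lambda>p. f (snd p)) \<in> borel_measurable (U01 \<Otimes>\<^sub>M U01)"
    by (rule measurable_compose[OF measurable_snd f])
  have [measurable]: "(\<lambda>p. g (fst p)) \<in> borel_measurable (U01 \<Otimes>\<^sub>M U01)"
    by (rule measurable_compose[OF measurable_fst g])
  have "(\<lambda>p. g (fst p) * ((if snd p < fst p then 1 else 0) * (K (fst p) (snd p) * f (snd p)))) \<in> borel_measurable (U01 \<Otimes>\<^sub>M U01)"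
    by measurable
  also have "(\<lambda>p. g (fst p) * ((if snd p < fst p then 1 else 0) * (K (fst p) (snd p) * f (snd p)))) =
      (\<lambda>(x, \<xi>). g x * (indicator {..<x} \<xi> * (K x \<xi> * f \<xi>)))"
    by (auto simp: fun_eq_iff indicator_def)
  finally show ?thesis .
qed

lemma volterra_integrable:
  fixes K :: "real \<Rightarrow> real \<Rightarrow> real" and f :: "real \<Rightarrow> real"
  assumes K: "continuous_on UNIV (\<lambda>(x, \<xi>). K x \<xi>)" and f: "integrable U01 f" and x: "x \<in> {0..1}"
  shows "integrable U01 (\<lambda>\<xi>. indicator {..<x} \<xi> * (K x \<xi> * f \<xi>))"
proof -
  obtain B where B: "0 < B" "\<And>x \<xi>. x \<in> {0..1} \<Longrightarrow> \<xi> \<in> {0..1} \<Longrightarrow> \<bar>K x \<xi>\<bar> \<le> B"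
    using kernel_bounded[OF K] by blast
  have Kx: "continuous_on {0..1} (K x)"
    using cont_compose2[OF K continuous_on_const continuous_on_id, of "{0..1}" x] by simp
  have "integrable U01 (\<lambda>\<xi>. K x \<xi> * f \<xi>)"
  proof (rule Bochner_Integration.integrable_bound)
    show "integrable U01 (\<lambda>\<xi>. B * f \<xi>)"
      using f by simp
    show "(\<lambda>\<xi>. K x \<xi> * f \<xi>) \<in> borel_measurable U01"
      using continuous_imp_measurable_U01[OF Kx] f by simp
    show "AE \<xi> in U01. norm (K x \<xi> * f \<xi>) \<le> norm (B * f \<xi>)"
      using B x by (intro AE_I2) (auto simp: abs_mult intro!: mult_right_mono)
  qed
  then show ?thesis
    by (rule integrable_indicator_U01)
qed

lemma volterra_abs_le:
  fixes K :: "real \<Rightarrow> real \<Rightarrow> real" and f :: "real \<Rightarrow> real"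
  assumes K: "continuous_on UNIV (\<lambda>(x, \<xi>). K x \<xi>)" and f: "integrable U01 f"
    and B: "\<And>x \<xi>. x \<in> {0..1} \<Longrightarrow> \<xi> \<in> {0..1} \<Longrightarrow> \<bar>K x \<xi>\<bar> \<le> B" and x: "x \<in> {0..1}"
  shows "(LINT \<xi>|U01. \<bar>indicator {..<x} \<xi> * (K x \<xi> * f \<xi>)\<bar>) \<le> B * (LINT \<xi>|U01. indicator {..<x} \<xi> * \<bar>f \<xi>\<bar>)"
proof -
  have "(LINT \<xi>|U01. \<bar>indicator {..<x} \<xi> * (K x \<xi> * f \<xi>)\<bar>) \<le> (LINT \<xi>|U01. B * (indicator {..<x} \<xi> * \<bar>f \<xi>\<bar>))"
  proof (rule LINT_mono_U01)
    show "\<bar>indicator {..<x} \<xi> * (K x \<xi> * f \<xi>)\<bar> \<le> B * (indicator {..<x} \<xi> * \<bar>f \<xi>\<bar>)" if "\<xi> \<in> {0..1}" for \<xi>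
      using B[OF x that] by (auto simp: abs_mult split: split_indicator intro!: mult_right_mono)
  qed (use volterra_integrable[OF K f x] integrable_indicator_U01[OF integrable_abs[OF f], of x] in auto)
  then show ?thesis
    by simp
qed

lemma volterra_le:
  fixes K :: "real \<Rightarrow> real \<Rightarrow> real" and f :: "real \<Rightarrow> real"
  assumes K: "continuous_on UNIV (\<lambda>(x, \<xi>). K x \<xi>)" and f: "integrable U01 f"
    and B: "\<And>x \<xi>. x \<in> {0..1} \<Longrightarrow> \<xi> \<in> {0..1} \<Longrightarrow> \<bar>K x \<xi>\<bar> \<le> B" and x: "x \<in> {0..1}"
  shows "\<bar>volterra K f x\<bar> \<le> B * (LINT \<xi>|U01. indicator {..<x} \<xi> * \<bar>f \<xi>\<bar>)"
  using order_trans[OF integral_abs_bound volterra_abs_le[OF assms]] by (simp add: volterra_def)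

lemma volterra_measurable:
  fixes K :: "real \<Rightarrow> real \<Rightarrow> real" and f :: "real \<Rightarrow> real"
  assumes K: "continuous_on UNIV (\<lambda>(x, \<xi>). K x \<xi>)" and f: "f \<in> borel_measurable U01"
  shows "volterra K f \<in> borel_measurable U01"
proof -
  have "(\<lambda>(x, \<xi>). 1 * (indicator {..<x} \<xi> * (K x \<xi> * f \<xi>))) \<in> borel_measurable (U01 \<Otimes>\<^sub>M U01)"
    by (rule volterra_integrand_measurable[OF K f]) simp
  from sigma_finite_measure.borel_measurable_lebesgue_integral[OF sigma_finite_U01 this] show ?thesis
    unfolding volterra_def[abs_def] by simp
qed

lemma L2_on_volterra:
  fixes K :: "real \<Rightarrow> real \<Rightarrow> real" and f :: "real \<Rightarrow> real"
  assumes K: "continuous_on UNIV (\<lambda>(x, \<xi>). K x \<xi>)" and f: "L2_on {0..1} f"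
  shows "L2_on {0..1} (volterra K f)"
proof -
  obtain B where B: "0 < B" "\<And>x \<xi>. x \<in> {0..1} \<Longrightarrow> \<xi> \<in> {0..1} \<Longrightarrow> \<bar>K x \<xi>\<bar> \<le> B"
    using kernel_bounded[OF K] by blast
  have fi: "integrable U01 f"
    by (rule L2_on_integrable[OF f])
  show ?thesis
  proof (rule L2_on_bounded[OF volterra_measurable[OF K L2_on_measurable[OF f]]])
    fix x :: real assume x: "x \<in> {0..1}"
    have "(LINT \<xi>|U01. indicator {..<x} \<xi> * \<bar>f \<xi>\<bar>) \<le> (LINT \<xi>|U01. \<bar>f \<xi>\<bar>)"
      using fi by (intro LINT_mono_U01 integrable_indicator_U01) (auto split: split_indicator)
    then show "\<bar>volterra K f x\<bar> \<le> B * (LINT \<xi>|U01. \<bar>f \<xi>\<bar>)"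
      using volterra_le[OF K fi B(2) x] B(1) by (meson mult_left_mono less_imp_le order_trans)
  qed
qed

text \<open>Exchanging the integrals over the triangle \<xi> < x moves the operator from
  \<open>f\<close> to \<open>g\<close>. The integrand is integrable on the square because
  \<open>K\<close> and \<open>g\<close> are bounded there and \<open>f\<close> is
  integrable.\<close>

lemma volterra_Fubini:
  fixes K :: "real \<Rightarrow> real \<Rightarrow> real" and f g :: "real \<Rightarrow> real"
  assumes K: "continuous_on UNIV (\<lambda>(x, \<xi>). K x \<xi>)" and f: "L2_on {0..1} f" and g: "continuous_on {0..1} g"
  shows "(LINT x|U01. g x * volterra K f x) =
    (LINT \<xi>|U01. (LINT x|U01. indicator {\<xi><..} x * (g x * K x \<xi>)) * f \<xi>)"
proof -
  interpret P: pair_sigma_finite U01 U01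
    by (simp add: pair_sigma_finite_def sigma_finite_U01)
  obtain B where B: "0 < B" "\<And>x \<xi>. x \<in> {0..1} \<Longrightarrow> \<xi> \<in> {0..1} \<Longrightarrow> \<bar>K x \<xi>\<bar> \<le> B"
    using kernel_bounded[OF K] by blast
  obtain G where G: "0 < G" "\<And>x. x \<in> {0..1} \<Longrightarrow> \<bar>g x\<bar> \<le> G"
    using continuous_bounded_01[OF g] by blast
  have fi: "integrable U01 f"
    by (rule L2_on_integrable[OF f])
  have gm: "g \<in> borel_measurable U01"
    by (rule continuous_imp_measurable_U01[OF g])
  let ?h = "\<lambda>(x, \<xi>). g x * (indicator {..<x} \<xi> * (K x \<xi> * f \<xi>))"
  have hm: "?h \<in> borel_measurable (U01 \<Otimes>\<^sub>M U01)"
    by (rule volterra_integrand_measurable[OF K L2_on_measurable[OF f] gm])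
  have int: "integrable (U01 \<Otimes>\<^sub>M U01) ?h"
  proof (rule P.Fubini_integrable[OF hm])
    show "AE x in U01. integrable U01 (\<lambda>\<xi>. ?h (x, \<xi>))"
      using volterra_integrable[OF K fi] by (intro AE_I2) auto
    show "integrable U01 (\<lambda>x. LINT \<xi>|U01. norm (?h (x, \<xi>)))"
    proof (rule integrable_bounded_U01)
      have "(\<lambda>p. norm (?h p)) \<in> borel_measurable (U01 \<Otimes>\<^sub>M U01)"
        using measurable_compose[OF hm borel_measurable_norm] by (simp add: comp_def)
      then have "case_prod (\<lambda>x \<xi>. norm (?h (x, \<xi>))) \<in> borel_measurable (U01 \<Otimes>\<^sub>M U01)"
        by (simp add: case_prod_unfold)
      then show "(\<lambda>x. LINT \<xi>|U01. norm (?h (x, \<xi>))) \<in> borel_measurable U01"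
        by (rule sigma_finite_measure.borel_measurable_lebesgue_integral[OF sigma_finite_U01])
      fix x :: real assume x: "x \<in> {0..1}"
      have "(LINT \<xi>|U01. norm (?h (x, \<xi>))) = \<bar>g x\<bar> * (LINT \<xi>|U01. \<bar>indicator {..<x} \<xi> * (K x \<xi> * f \<xi>)\<bar>)"
        by (simp add: abs_mult)
      also have "\<dots> \<le> G * (B * (LINT \<xi>|U01. \<bar>f \<xi>\<bar>))"
      proof (rule mult_mono[OF G(2)[OF x]])
        have "(LINT \<xi>|U01. indicator {..<x} \<xi> * \<bar>f \<xi>\<bar>) \<le> (LINT \<xi>|U01. \<bar>f \<xi>\<bar>)"
          using fi by (intro LINT_mono_U01 integrable_indicator_U01) (auto split: split_indicator)
        then show "(LINT \<xi>|U01. \<bar>indicator {..<x} \<xi> * (K x \<xi> * f \<xi>)\<bar>) \<le> B * (LINT \<xi>|U01. \<bar>f \<xi>\<bar>)"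
          using volterra_abs_le[OF K fi B(2) x] B(1) by (meson mult_left_mono less_imp_le order_trans)
      qed (use G in \<open>auto intro: LINT_nonneg_U01\<close>)
      finally show "\<bar>LINT \<xi>|U01. norm (?h (x, \<xi>))\<bar> \<le> G * (B * (LINT \<xi>|U01. \<bar>f \<xi>\<bar>))"
        by (subst abs_of_nonneg) (auto intro: LINT_nonneg_U01)
    qed
  qed
  have "(LINT x|U01. g x * volterra K f x) = (LINT x|U01. LINT \<xi>|U01. ?h (x, \<xi>))"
    by (simp add: volterra_def)
  also have "\<dots> = (LINT \<xi>|U01. LINT x|U01. ?h (x, \<xi>))"
    using P.Fubini_integral[of "\<lambda>x \<xi>. ?h (x, \<xi>)"] int by simp
  also have "(\<lambda>\<xi>. LINT x|U01. ?h (x, \<xi>)) = (\<lambda>\<xi>. (LINT x|U01. indicator {\<xi><..} x * (g x * K x \<xi>)) * f \<xi>)"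
  proof
    fix \<xi>
    have "(LINT x|U01. ?h (x, \<xi>)) = (LINT x|U01. indicator {\<xi><..} x * (g x * K x \<xi>) * f \<xi>)"
      by (intro LINT_cong_U01) (auto split: split_indicator)
    then show "(LINT x|U01. ?h (x, \<xi>)) = (LINT x|U01. indicator {\<xi><..} x * (g x * K x \<xi>)) * f \<xi>"
      by simp
  qed
  finally show ?thesis .
qed

subsection \<open>The dual identity for weak solutions\<close>

context backstepping
begin

abbreviation w1 :: "real \<Rightarrow> real" where "w1 x \<equiv> 1 / e1 (clip x)"
abbreviation w2 :: "real \<Rightarrow> real" where "w2 x \<equiv> 1 / e2 (clip x)"

lemma continuous_w: "continuous_on S w1" "continuous_on S w2"
proof -
  have "e1 (clip x) \<noteq> 0" "e2 (clip x) \<noteq> 0" for x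
    using e_nonzero[of "clip x"] by auto
  then show "continuous_on S w1" "continuous_on S w2"
    by (intro continuous_on_divide continuous_on_const continuous_on_compose_clip[OF e_continuous(1)]
      continuous_on_compose_clip[OF e_continuous(2)] continuous_on_id; simp)+
qed

lemma w_pos: "0 < w1 x" "0 < w2 x"
  using e1_pos[of "clip x"] e2_pos[of "clip x"] by auto

lemma weight_w: "weight w1" "weight w2"
proof -
  have "weight w" if w: "continuous_on {0..1} w" "\<And>x. 0 < w x" for w
  proof -
    obtain B where "\<And>x. x \<in> {0..1} \<Longrightarrow> \<bar>w x\<bar> \<le> B"
      using continuous_bounded_01[OF w(1)] by blast
    then show ?thesis
      using continuous_imp_measurable_U01[OF w(1)] w(2) unfolding weight_def by (meson abs_le_D1 less_imp_le)
  qed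
  then show "weight w1" "weight w2"
    using continuous_w w_pos by blast+
qed

lemma cont_yz: "continuous_on S y" "continuous_on S z"
  using continuous_coordinates continuous_on_subset by blast+

definition beta :: "(real \<Rightarrow> real) \<Rightarrow> (real \<Rightarrow> real) \<Rightarrow> real \<Rightarrow> real" where
  "beta u v x = v x - volterra Ku u x - volterra Kv v x"

lemma L2_on_beta: "L2_on {0..1} u \<Longrightarrow> L2_on {0..1} v \<Longrightarrow> L2_on {0..1} (beta u v)"
  unfolding beta_def[abs_def] by (intro L2_on_diff L2_on_volterra continuous_Ku_Kv)

text \<open>The weight \<open>w2\<close> is the Jacobian of the substitution \<eta> = y(x). This
  identifies \<open>H\<close> with the transposed Volterra operator.\<close>

lemma H_eq_LINT:
  assumes F: "continuous_on UNIV F" and K: "continuous_on UNIV (\<lambda>(x, \<xi>). K x \<xi>)" and \<xi>: "\<xi> \<in> {0..1}"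
  shows "(LINT x|U01. indicator {\<xi><..} x * (w2 x * F (t + y x) * K x \<xi>)) = H K F t \<xi>"
proof -
  have c: "continuous_on S (\<lambda>x. F (t + y x) * K (Y (y x)) \<xi> * w2 x)" for S
    by (intro continuous_on_mult continuous_w cont_compose[OF F] cont_compose2[OF K]
      continuous_on_add continuous_on_const cont_Y cont_yz)
  have "(LINT x|U01. indicator {\<xi><..} x * (w2 x * F (t + y x) * K x \<xi>)) =
      (LINT x|U01. indicator {\<xi><..} x * (F (t + y x) * K (Y (y x)) \<xi> * w2 x))"
    by (simp add: Yy mult_ac)
  also have "\<dots> = integral {\<xi>..1} (\<lambda>x. F (t + y x) * K (Y (y x)) \<xi> * w2 x)"
    by (rule LINT_indicator_continuous(2)[OF c \<xi>])
  also have "\<dots> = oint \<xi> 1 (\<lambda>x. F (t + y x) * K (Y (y x)) \<xi> * w2 x)"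
    using \<xi> by (intro oint_eq_integral[symmetric] c) auto
  also have "\<dots> = oint (y \<xi>) (y 1) (\<lambda>\<eta>. F (t + \<eta>) * K (Y \<eta>) \<xi>)"
    by (rule oint_subst[symmetric, OF _ Dy])
      (intro continuous_on_mult cont_compose[OF F] cont_compose2[OF K]
        continuous_on_add continuous_on_const continuous_on_id continuous_coordinates)
  finally show ?thesis
    by (simp add: H_def)
qed

lemma volterra_dual:
  assumes F: "continuous_on UNIV F" and K: "continuous_on UNIV (\<lambda>(x, \<xi>). K x \<xi>)" and f: "L2_on {0..1} f"
  shows "(LINT x|U01. w2 x * F (t + y x) * volterra K f x) = (LINT x|U01. H K F t x * f x)"
proof -
  have "continuous_on {0..1} (\<lambda>x. w2 x * F (t + y x))"
    by (intro continuous_on_mult continuous_w cont_compose[OF F] continuous_on_add continuous_on_const cont_yz)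
  from volterra_Fubini[OF K f this] show ?thesis
    by (simp only:) (intro LINT_cong_U01, simp only: H_eq_LINT[OF F K])
qed

lemma L2_on_continuous_mult: "continuous_on {0..1} g \<Longrightarrow> L2_on {0..1} f \<Longrightarrow> L2_on {0..1} (\<lambda>x. g x * f x)"
  using continuous_bounded_01[of g] L2_on_bounded_mult[of g _ f] continuous_imp_measurable_U01 by metis

lemma integrable_continuous_mult: "continuous_on {0..1} g \<Longrightarrow> L2_on {0..1} f \<Longrightarrow> integrable U01 (\<lambda>x. g x * f x)"
  by (intro L2_on_integrable L2_on_continuous_mult)

lemma continuous_H_x:
  assumes F: "continuous_on UNIV F" and K: "continuous_on UNIV (\<lambda>(x, \<xi>). K x \<xi>)"
  shows "continuous_on S (H K F t)"
  using continuous_on_compose2[OF continuous_H[OF F K, of UNIV], of S "\<lambda>x. (t, x)"]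
  by (simp add: continuous_on_Pair)

text \<open>By \<open>volterra_dual\<close> the kernel integrals move from the test pair onto the
  solution, where they complete \<open>v\<close> to \<open>beta\<close>. The profile
  \<open>P\<close> meets \<open>u\<close> itself.\<close>

lemma dual_pairing:
  assumes F: "continuous_on UNIV F" and P: "continuous_on UNIV P" and u: "L2_on {0..1} u" and v: "L2_on {0..1} v"
  shows "(LINT x|U01. (P (z x - t) / e1 x - H Ku F t x) * u x + (F (t + y x) / e2 x - H Kv F t x) * v x) =
    (LINT x|U01. w1 x * (P (z x - t) * u x)) + (LINT x|U01. w2 x * (F (t + y x) * beta u v x))"
proof -
  have cP: "continuous_on {0..1} (\<lambda>x. w1 x * P (z x - t))" and cF: "continuous_on {0..1} (\<lambda>x. w2 x * F (t + y x))"
    by (intro continuous_on_mult continuous_w cont_compose[OF F] cont_compose[OF P]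
      continuous_on_add continuous_on_diff continuous_on_const cont_yz)+
  note i1 = integrable_continuous_mult[OF cP u] and i2 = integrable_continuous_mult[OF cF v]
    and i3 = integrable_continuous_mult[OF continuous_H_x[OF F continuous_Ku_Kv(1)] u, of t]
    and i4 = integrable_continuous_mult[OF continuous_H_x[OF F continuous_Ku_Kv(2)] v, of t]
    and i5 = integrable_continuous_mult[OF cF L2_on_volterra[OF continuous_Ku_Kv(1) u]]
    and i6 = integrable_continuous_mult[OF cF L2_on_volterra[OF continuous_Ku_Kv(2) v]]
  have "(LINT x|U01. (P (z x - t) / e1 x - H Ku F t x) * u x + (F (t + y x) / e2 x - H Kv F t x) * v x) =
    (LINT x|U01. w1 x * P (z x - t) * u x + w2 x * F (t + y x) * v x - H Ku F t x * u x - H Kv F t x * v x)"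
    by (intro LINT_cong_U01) (simp add: clip_id algebra_simps)
  also have "\<dots> = (LINT x|U01. w1 x * P (z x - t) * u x) + (LINT x|U01. w2 x * F (t + y x) * v x)
      - (LINT x|U01. H Ku F t x * u x) - (LINT x|U01. H Kv F t x * v x)"
    by (simp only: i1 i2 i3 i4 Bochner_Integration.integral_diff Bochner_Integration.integral_add
      Bochner_Integration.integrable_add Bochner_Integration.integrable_diff)
  finally have e1: "(LINT x|U01. (P (z x - t) / e1 x - H Ku F t x) * u x + (F (t + y x) / e2 x - H Kv F t x) * v x) = \<dots>" .
  have "(LINT x|U01. w2 x * F (t + y x) * v x) - (LINT x|U01. w2 x * F (t + y x) * volterra Ku u x)
      - (LINT x|U01. w2 x * F (t + y x) * volterra Kv v x) = (LINT x|U01. w2 x * F (t + y x) * v x -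
        w2 x * F (t + y x) * volterra Ku u x - w2 x * F (t + y x) * volterra Kv v x)"
    by (simp only: i2 i5 i6 Bochner_Integration.integral_diff Bochner_Integration.integrable_diff)
  then have e2: "(LINT x|U01. w2 x * F (t + y x) * v x) - (LINT x|U01. H Ku F t x * u x) - (LINT x|U01. H Kv F t x * v x)
    = (LINT x|U01. w2 x * (F (t + y x) * beta u v x))"
    unfolding volterra_dual[OF F continuous_Ku_Kv(1) u] volterra_dual[OF F continuous_Ku_Kv(2) v]
    by (simp add: beta_def algebra_simps)
  show ?thesis
    unfolding e1 e2[symmetric] by (simp add: mult.assoc)
qed

definition solution ::
    "(real \<Rightarrow> real) \<Rightarrow> (real \<Rightarrow> real) \<Rightarrow> (real \<Rightarrow> real \<Rightarrow> real) \<Rightarrow> (real \<Rightarrow> real \<Rightarrow> real) \<Rightarrow> bool" where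
  "solution u0 v0 u v \<longleftrightarrow> L2_on {0..1} u0 \<and> L2_on {0..1} v0 \<and>
     weak_solution e1 e1' e2 e2' c1 c2 q (feedback Kvu Kvv u v) u0 v0 u v"

text \<open>What remains of the interior term once the feedback has cancelled: the coupling tested
  with the freely transported profile.\<close>

definition source :: "(real \<Rightarrow> real) \<Rightarrow> (real \<Rightarrow> real \<Rightarrow> real) \<Rightarrow> real \<Rightarrow> real" where
  "source P v t = (LINT x|U01. w1 x * (P (z x - t) * (c1 x * v t x)))"

section \<open>Weak solutions: continuity in time and the tested identity\<close>

context
  fixes u0 v0 :: "real \<Rightarrow> real" and u v :: "real \<Rightarrow> real \<Rightarrow> real"
  assumes sol: "solution u0 v0 u v"
begin

lemma sol_L2: "L2_on {0..1} u0" "L2_on {0..1} v0" "0 \<le> t \<Longrightarrow> L2_on {0..1} (u t)" "0 \<le> t \<Longrightarrow> L2_on {0..1} (v t)"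
  using sol by (auto simp: solution_def weak_solution_def)

lemma sol_initial: "AE x in U01. u 0 x = u0 x" "AE x in U01. v 0 x = v0 x"
  using sol by (auto simp: solution_def weak_solution_def)

lemma sol_limit:
  assumes t: "\<And>n. 0 \<le> t n" and a: "0 \<le> a" and lim: "t \<longlonglongrightarrow> a"
  shows "(\<lambda>n. L2_norm (\<lambda>x. u (t n) x - u a x) (\<lambda>x. v (t n) x - v a x)) \<longlonglongrightarrow> 0"
proof -
  have "((\<lambda>t. L2_norm (\<lambda>x. u t x - u a x) (\<lambda>x. v t x - v a x)) \<longlongrightarrow> 0) (at a within {0..})"
    using sol a by (auto simp: solution_def weak_solution_def)
  then have "continuous (at a within {0..}) (\<lambda>t. L2_norm (\<lambda>x. u t x - u a x) (\<lambda>x. v t x - v a x))"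
    by (simp add: continuous_within L2_norm_def)
  from continuous_within_tendsto_compose'[OF this _ lim] t show ?thesis
    by (simp add: L2_norm_def)
qed

lemma L2_norm_component:
  assumes "L2_on {0..1} f" "L2_on {0..1} g"
  shows "sqrt (LINT x|U01. (f x)\<^sup>2) \<le> L2_norm f g" "sqrt (LINT x|U01. (g x)\<^sup>2) \<le> L2_norm f g"
  unfolding L2_norm_def using L2_on_square[OF assms(1)] L2_on_square[OF assms(2)]
  by (intro real_sqrt_le_mono LINT_mono_U01; simp)+

text \<open>Expanded around g(a), the squared norm changes by the squared norm of the difference
  plus twice its pairing with g(a), and both tend to 0.\<close>

lemma LINT_square_continuous:
  fixes g :: "real \<Rightarrow> real \<Rightarrow> real"
  assumes g: "\<And>t. 0 \<le> t \<Longrightarrow> L2_on {0..1} (g t)"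
    and lim: "\<And>t a. (\<And>n. 0 \<le> t n) \<Longrightarrow> 0 \<le> a \<Longrightarrow> t \<longlonglongrightarrow> a \<Longrightarrow> (\<lambda>n. sqrt (LINT x|U01. (g (t n) x - g a x)\<^sup>2)) \<longlonglongrightarrow> 0"
  shows "continuous_on {0..T} (\<lambda>t. LINT x|U01. (g t x)\<^sup>2)"
proof (rule continuous_on_sequentiallyI)
  fix t :: "nat \<Rightarrow> real" and a assume t: "\<forall>n. t n \<in> {0..T}" and a: "a \<in> {0..T}" and ta: "t \<longlonglongrightarrow> a"
  have t0: "0 \<le> t n" for n using t by auto
  have a0: "0 \<le> a" using a by auto
  let ?d = "\<lambda>n x. g (t n) x - g a x"
  let ?D = "\<lambda>n. sqrt (LINT x|U01. (?d n x)\<^sup>2)"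
  have D: "?D \<longlonglongrightarrow> 0"
    by (rule lim[OF t0 a0 ta])
  have d: "L2_on {0..1} (?d n)" for n
    by (intro L2_on_diff g t0 a0)
  have split: "(LINT x|U01. (g (t n) x)\<^sup>2) = (LINT x|U01. (g a x)\<^sup>2) + (?D n)\<^sup>2 + 2 * (LINT x|U01. ?d n x * g a x)" for n
  proof -
    have "(?D n)\<^sup>2 = (LINT x|U01. (?d n x)\<^sup>2)"
      by (intro real_sqrt_pow2 LINT_nonneg_U01) simp
    moreover have "(\<lambda>x. (g (t n) x)\<^sup>2) = (\<lambda>x. (g a x)\<^sup>2 + (?d n x)\<^sup>2 + 2 * (?d n x * g a x))"
      by (auto simp: power2_eq_square algebra_simps)
    ultimately show ?thesis
      using L2_on_square[OF g[OF a0]] L2_on_square[OF d[of n]] L2_on_mult_integrable[OF d[of n] g[OF a0]] by simp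
  qed
  have "(\<lambda>n. LINT x|U01. ?d n x * g a x) \<longlonglongrightarrow> 0"
  proof (rule Lim_null_comparison)
    show "\<forall>\<^sub>F n in sequentially. norm (LINT x|U01. ?d n x * g a x) \<le> ?D n * sqrt (LINT x|U01. (g a x)\<^sup>2)"
      using Cauchy_Schwarz_LINT[OF d g[OF a0]] by simp
    show "(\<lambda>n. ?D n * sqrt (LINT x|U01. (g a x)\<^sup>2)) \<longlonglongrightarrow> 0"
      using tendsto_mult_left_zero[OF D] .
  qed
  then have "(\<lambda>n. (LINT x|U01. (g a x)\<^sup>2) + (?D n)\<^sup>2 + 2 * (LINT x|U01. ?d n x * g a x)) \<longlonglongrightarrow> (LINT x|U01. (g a x)\<^sup>2) + 0\<^sup>2 + 2 * 0"
    by (intro tendsto_intros D)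
  then show "(\<lambda>n. LINT x|U01. (g (t n) x)\<^sup>2) \<longlonglongrightarrow> (LINT x|U01. (g a x)\<^sup>2)"
    by (simp add: split)
qed

text \<open>This a priori bound keeps the supremum in \<open>gronwall_sup\<close> finite when the
  argument is run for \<open>u\<close>.\<close>

lemma sol_bounded:
  obtains M where "\<And>t. t \<in> {0..T} \<Longrightarrow> (LINT x|U01. (u t x)\<^sup>2) \<le> M"
proof -
  have "continuous_on {0..T} (\<lambda>t. LINT x|U01. (u t x)\<^sup>2)"
  proof (rule LINT_square_continuous)
    fix t :: "nat \<Rightarrow> real" and a assume t: "\<And>n. 0 \<le> t n" "0 \<le> a" "t \<longlonglongrightarrow> a"
    show "(\<lambda>n. sqrt (LINT x|U01. (u (t n) x - u a x)\<^sup>2)) \<longlonglongrightarrow> 0"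
      by (rule Lim_null_comparison[OF _ sol_limit[OF t]])
        (use t in \<open>auto intro!: always_eventually L2_norm_component L2_on_diff sol_L2 LINT_nonneg_U01\<close>)
  qed (rule sol_L2)
  then have "bounded ((\<lambda>t. LINT x|U01. (u t x)\<^sup>2) ` {0..T})"
    by (intro compact_imp_bounded compact_continuous_image) auto
  then obtain M where "\<forall>r \<in> (\<lambda>t. LINT x|U01. (u t x)\<^sup>2) ` {0..T}. norm r \<le> M"
    unfolding bounded_iff by blast
  then show ?thesis
    using that[of M] by force
qed

text \<open>Continuity is the route to integrability in time, since no joint measurability of
  \<open>v\<close> is assumed. Along a sequence, the coefficient is handled by dominated convergence
  against the fixed v(a), and the change of \<open>v\<close> by Cauchy-Schwarz and continuity in the
  norm.\<close>

lemma source_continuous: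
  assumes P: "continuous_on UNIV P"
  shows "continuous_on {0..T} (source P v)"
proof (rule continuous_on_sequentiallyI)
  fix t :: "nat \<Rightarrow> real" and a assume t: "\<forall>n. t n \<in> {0..T}" and a: "a \<in> {0..T}" and ta: "t \<longlonglongrightarrow> a"
  have t0: "0 \<le> t n" for n using t by auto
  have a0: "0 \<le> a" using a by auto
  define \<rho> where "\<rho> = (\<lambda>s x. w1 x * P (z x - s) * c1 x)"
  have src: "source P v s = (LINT x|U01. \<rho> s x * v s x)" for s
    by (simp add: source_def \<rho>_def mult_ac)
  have \<rho>c: "continuous_on ({0..T} \<times> {0..1}) (\<lambda>p. \<rho> (fst p) (snd p))"
    unfolding \<rho>_def
    by (intro continuous_on_mult snd_continuous[OF continuous_w(1)] snd_continuous[OF c1] cont_z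
      cont_compose[OF P] continuous_on_fst continuous_on_snd continuous_on_id continuous_on_diff)
  have "bounded ((\<lambda>p. \<rho> (fst p) (snd p)) ` ({0..T} \<times> {0..1}))"
    by (intro compact_imp_bounded compact_continuous_image \<rho>c compact_Times) auto
  then obtain R where "\<forall>r \<in> (\<lambda>p. \<rho> (fst p) (snd p)) ` ({0..T} \<times> {0..1}). norm r \<le> R"
    unfolding bounded_iff by blast
  then have R: "\<bar>\<rho> s x\<bar> \<le> R" if "s \<in> {0..T}" "x \<in> {0..1}" for s x
    using that by force
  have R0: "0 \<le> R"
    using R[OF a, of 0] by simp
  have \<rho>x: "continuous_on {0..1} (\<rho> s)" for s
    unfolding \<rho>_def by (intro continuous_on_mult continuous_w c1 cont_yz cont_compose[OF P]
      continuous_on_diff continuous_on_const)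
  have \<rho>s: "(\<lambda>n. \<rho> (t n) x) \<longlonglongrightarrow> \<rho> a x" for x
  proof -
    have "isCont P (z x - a)"
      using P continuous_on_eq_continuous_at open_UNIV by blast
    moreover have "(\<lambda>n. z x - t n) \<longlonglongrightarrow> z x - a"
      by (intro tendsto_intros ta)
    ultimately show ?thesis
      unfolding \<rho>_def by (intro tendsto_mult tendsto_const) (rule isCont_tendsto_compose)
  qed
  let ?d = "\<lambda>n x. v (t n) x - v a x"
  have d: "L2_on {0..1} (?d n)" for n
    by (intro L2_on_diff sol_L2 t0 a0)
  have va: "L2_on {0..1} (v a)"
    by (rule sol_L2(4)[OF a0])
  have 1: "(\<lambda>n. LINT x|U01. \<rho> (t n) x * v a x) \<longlonglongrightarrow> (LINT x|U01. \<rho> a x * v a x)"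
  proof (rule integral_dominated_convergence)
    show "integrable U01 (\<lambda>x. R * \<bar>v a x\<bar>)"
      using L2_on_integrable[OF va] by simp
    show "AE x in U01. norm (\<rho> (t n) x * v a x) \<le> R * \<bar>v a x\<bar>" for n
      using R t by (intro AE_I2) (auto simp: abs_mult intro!: mult_right_mono)
    show "AE x in U01. (\<lambda>n. \<rho> (t n) x * v a x) \<longlonglongrightarrow> \<rho> a x * v a x"
      by (intro AE_I2 tendsto_mult \<rho>s tendsto_const)
    show "(\<lambda>x. \<rho> a x * v a x) \<in> borel_measurable U01" "(\<lambda>x. \<rho> (t n) x * v a x) \<in> borel_measurable U01" for n
      using integrable_continuous_mult[OF \<rho>x va] by (auto intro: borel_measurable_integrable)
  qed
  have 2: "(\<lambda>n. LINT x|U01. \<rho> (t n) x * ?d n x) \<longlonglongrightarrow> 0"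
  proof (rule Lim_null_comparison)
    show "\<forall>\<^sub>F n in sequentially. norm (LINT x|U01. \<rho> (t n) x * ?d n x) \<le> R * L2_norm (\<lambda>x. u (t n) x - u a x) (?d n)"
    proof (intro always_eventually allI)
      fix n
      have "\<bar>LINT x|U01. \<rho> (t n) x * ?d n x\<bar> \<le> sqrt (LINT x|U01. (\<rho> (t n) x)\<^sup>2) * sqrt (LINT x|U01. (?d n x)\<^sup>2)"
        by (rule Cauchy_Schwarz_LINT[OF L2_on_continuous[OF \<rho>x] d])
      also have "\<dots> \<le> R * L2_norm (\<lambda>x. u (t n) x - u a x) (?d n)"
      proof (rule mult_mono)
        have "(LINT x|U01. (\<rho> (t n) x)\<^sup>2) \<le> (LINT x|U01. R\<^sup>2)"
          using R t R0 by (intro LINT_mono_U01 L2_on_square L2_on_continuous \<rho>x integrable_continuous_U01)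
            (auto simp: abs_le_square_iff[symmetric])
        also have "\<dots> = R\<^sup>2"
          by (subst LINT_continuous_U01) auto
        finally show "sqrt (LINT x|U01. (\<rho> (t n) x)\<^sup>2) \<le> R"
          by (intro real_le_lsqrt R0)
        show "sqrt (LINT x|U01. (?d n x)\<^sup>2) \<le> L2_norm (\<lambda>x. u (t n) x - u a x) (?d n)"
          by (intro L2_norm_component L2_on_diff sol_L2 t0 a0)
      qed (use R0 in \<open>auto intro: LINT_nonneg_U01\<close>)
      finally show "norm (LINT x|U01. \<rho> (t n) x * ?d n x) \<le> R * L2_norm (\<lambda>x. u (t n) x - u a x) (?d n)"
        by simp
    qed
    show "(\<lambda>n. R * L2_norm (\<lambda>x. u (t n) x - u a x) (?d n)) \<longlonglongrightarrow> 0"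
      using tendsto_mult_right_zero[OF sol_limit[OF t0 a0 ta]] .
  qed
  have "source P v (t n) = (LINT x|U01. \<rho> (t n) x * v a x) + (LINT x|U01. \<rho> (t n) x * ?d n x)" for n
    unfolding src using integrable_continuous_mult[OF \<rho>x va, of "t n"] integrable_continuous_mult[OF \<rho>x d, of "t n" n]
    by (subst Bochner_Integration.integral_add[symmetric]) (auto simp: algebra_simps)
  moreover have "(\<lambda>n. (LINT x|U01. \<rho> (t n) x * v a x) + (LINT x|U01. \<rho> (t n) x * ?d n x)) \<longlonglongrightarrow> (LINT x|U01. \<rho> a x * v a x) + 0"
    by (rule tendsto_add[OF 1 2])
  ultimately show "(\<lambda>n. source P v (t n)) \<longlonglongrightarrow> source P v a"
    by (simp add: src)
qed

lemma dual_identity: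
  assumes F: "\<And>s. (F has_real_derivative F' s) (at s)" "continuous_on UNIV F'"
    and P: "\<And>s. (P has_real_derivative P' s) (at s)" "continuous_on UNIV P'"
    and \<tau>: "0 < \<tau>"
    and bc: "\<And>t. t \<in> {0..\<tau>} \<Longrightarrow> P (z 1 - t) = 0" "\<And>t. t \<in> {0..\<tau>} \<Longrightarrow> F t = q * P (- t)"
  shows "(LINT x|U01. w1 x * (P (z x - \<tau>) * u \<tau> x)) + (LINT x|U01. w2 x * (F (\<tau> + y x) * beta (u \<tau>) (v \<tau>) x)) =
    (LINT x|U01. w1 x * (P (z x) * u0 x)) + (LINT x|U01. w2 x * (F (y x) * beta u0 v0 x))
    + (LINT t|lebesgue_on {0..\<tau>}. source P v t)"
proof -
  have Fc: "continuous_on UNIV F" and Pc: "continuous_on UNIV P"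
    using DERIV_continuous_on[of UNIV, OF F(1)] DERIV_continuous_on[of UNIV, OF P(1)] .
  let ?U = "feedback Kvu Kvv u v"
  \<comment> \<open>The contribution of the control. It enters with a plus sign through
    \<open>e2\<close> \<psi> at x = 1, where the kernel integral vanishes, and with a minus sign
    through the residuals in \<open>dual_equations\<close>. To split it off, it must be integrable
    in time, which follows from the square integrability of the control.\<close>
  define A where "A = (\<lambda>t. F (t + y 1) * ?U t)"
  have "L2_on {0..\<tau>} ?U"
    using sol \<tau> by (simp add: solution_def weak_solution_def)
  moreover have "L2_on {0..\<tau>} (\<lambda>t. F (t + y 1))"
  proof -
    have c: "continuous_on {0..\<tau>} (\<lambda>t. F (t + y 1))"
      by (intro cont_compose[OF Fc] continuous_intros)
    then have "continuous_on {0..\<tau>} (\<lambda>t. (F (t + y 1))\<^sup>2)"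
      by (intro continuous_on_power)
    then show ?thesis
      using continuous_imp_integrable_real[OF c] continuous_imp_integrable_real by (auto simp: L2_on_def)
  qed
  ultimately have A: "integrable (lebesgue_on {0..\<tau>}) A"
    unfolding A_def by (intro L2_on_mult_integrable)
  have S: "integrable (lebesgue_on {0..\<tau>}) (source P v)"
    by (intro continuous_imp_integrable_real source_continuous Pc)
  note weak = sol[unfolded solution_def weak_solution_def, THEN conjunct2, THEN conjunct2, THEN conjunct2, THEN conjunct2,
      THEN conjunct2, THEN conjunct2, rule_format, OF \<tau> dual_test_pair[OF F P bc]]
  have inner: "(LINT x|U01.
      ((- P' (z x - t) / e1 x - H Ku F' t x) + (e1' x * (P (z x - t) / e1 x - H Ku F t x)
      + e1 x * ((P' (z x - t) / e1 x - P (z x - t) * e1' x / e1 x) / e1 x - Hu_x F F' t x))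
      + c2 x * (F (t + y x) / e2 x - H Kv F t x)) * u t x +
      ((F' (t + y x) / e2 x - H Kv F' t x) - (e2' x * (F (t + y x) / e2 x - H Kv F t x)
      + e2 x * ((F' (t + y x) / e2 x - F (t + y x) * e2' x / e2 x) / e2 x - Hv_x F F' t x))
      + c1 x * (P (z x - t) / e1 x - H Ku F t x)) * v t x) = source P v t - A t"
    (is "(LINT x|U01. ?f x) = _") if t: "t \<in> {0..\<tau>}" for t
  proof -
    have ut: "L2_on {0..1} (u t)" and vt: "L2_on {0..1} (v t)"
      using t by (auto intro: sol_L2)
    have K1: "continuous_on {0..1} (Ku 1)" "continuous_on {0..1} (Kv 1)"
      using cont_Ku[OF continuous_on_const continuous_on_id, of "{0..1}" 1]
        cont_Kv[OF continuous_on_const continuous_on_id, of "{0..1}" 1] by simp_all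
    have c: "continuous_on {0..1} (\<lambda>x. w1 x * P (z x - t) * c1 x)"
      by (intro continuous_on_mult continuous_w c1 cont_yz cont_compose[OF Pc]
        continuous_on_diff continuous_on_const)
    note i = integrable_continuous_mult[OF K1(1) ut] integrable_continuous_mult[OF K1(2) vt] integrable_continuous_mult[OF c vt]
    have "(LINT x|U01. ?f x) = (LINT x|U01. w1 x * P (z x - t) * c1 x * v t x
        - F (t + y 1) * (Ku 1 x * u t x) - F (t + y 1) * (Kv 1 x * v t x))"
    proof (rule LINT_cong_U01)
      fix x :: real assume x: "x \<in> {0..1}"
      show "?f x = w1 x * P (z x - t) * c1 x * v t x - F (t + y 1) * (Ku 1 x * u t x) - F (t + y 1) * (Kv 1 x * v t x)"
        unfolding dual_equations[OF F P x] kernel_at_1[OF x] clip_id[OF x] by (simp add: algebra_simps)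
    qed
    also have "\<dots> = (LINT x|U01. w1 x * P (z x - t) * c1 x * v t x)
        - F (t + y 1) * (LINT x|U01. Ku 1 x * u t x) - F (t + y 1) * (LINT x|U01. Kv 1 x * v t x)"
      using i by simp
    also have "(LINT x|U01. Ku 1 x * u t x) = (LINT x|U01. Kvu 1 x * u t x)"
      by (intro LINT_cong_U01) (simp add: kernel_at_1)
    also have "(LINT x|U01. Kv 1 x * v t x) = (LINT x|U01. Kvv 1 x * v t x)"
      by (intro LINT_cong_U01) (simp add: kernel_at_1)
    also have "(LINT x|U01. w1 x * P (z x - t) * c1 x * v t x) = source P v t"
      by (simp add: source_def mult_ac)
    finally show ?thesis
      by (simp add: A_def feedback_def algebra_simps)
  qed
  have boundary: "(LINT t|lebesgue_on {0..\<tau>}. e2 1 * (F (t + y 1) / e2 1 - H Kv F t 1) * ?U t) = (LINT t|lebesgue_on {0..\<tau>}. A t)"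
    using e_nonzero(2)[of 1] by (simp add: A_def H_def)
  have interior: "(LINT t|lebesgue_on {0..\<tau>}. LINT x|U01.
      ((- P' (z x - t) / e1 x - H Ku F' t x) + (e1' x * (P (z x - t) / e1 x - H Ku F t x)
      + e1 x * ((P' (z x - t) / e1 x - P (z x - t) * e1' x / e1 x) / e1 x - Hu_x F F' t x))
      + c2 x * (F (t + y x) / e2 x - H Kv F t x)) * u t x +
      ((F' (t + y x) / e2 x - H Kv F' t x) - (e2' x * (F (t + y x) / e2 x - H Kv F t x)
      + e2 x * ((F' (t + y x) / e2 x - F (t + y x) * e2' x / e2 x) / e2 x - Hv_x F F' t x))
      + c1 x * (P (z x - t) / e1 x - H Ku F t x)) * v t x) = (LINT t|lebesgue_on {0..\<tau>}. source P v t) - (LINT t|lebesgue_on {0..\<tau>}. A t)"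
    by (subst Bochner_Integration.integral_diff[symmetric, OF S A]) (intro Bochner_Integration.integral_cong refl inner; simp)
  have \<tau>0: "0 \<le> \<tau>"
    using \<tau> by simp
  show ?thesis
    using weak unfolding boundary interior dual_pairing[OF Fc Pc sol_L2(3)[OF \<tau>0] sol_L2(4)[OF \<tau>0]] dual_pairing[OF Fc Pc sol_L2(1) sol_L2(2)]
    by simp
qed

end

end

subsection \<open>The backstepping variable\<close>

lemma positive_bounds_01:
  fixes w :: "real \<Rightarrow> real"
  assumes w: "continuous_on {0..1} w" and pos: "\<And>x. 0 < w x"
  obtains m B where "0 < m" "0 < B" "\<And>x. x \<in> {0..1} \<Longrightarrow> m \<le> w x" "\<And>x. x \<in> {0..1} \<Longrightarrow> w x \<le> B"
proof -
  obtain x0 where "\<forall>x\<in>{0..1}. w x0 \<le> w x"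
    using continuous_attains_inf[OF _ _ w] by fastforce
  moreover obtain B where "0 < B" "\<And>x. x \<in> {0..1} \<Longrightarrow> \<bar>w x\<bar> \<le> B"
    using continuous_bounded_01[OF w] by blast
  ultimately show ?thesis
    using that[of "w x0" B] pos[of x0] by (meson abs_le_D1)
qed

text \<open>\<open>G\<close> is nondecreasing and constant outside [0, l], so no window holds more
  energy than the total. This is why translating a profile in travel time does not increase its
  norm.\<close>

lemma antiderivative_square_le:
  fixes p G :: "real \<Rightarrow> real"
  assumes G: "\<And>s. (G has_real_derivative (p s)\<^sup>2) (at s)" and p: "\<And>s. s \<le> 0 \<or> l \<le> s \<Longrightarrow> p s = 0" and l: "0 \<le> l"
  shows "G a - G b \<le> G l - G 0"
proof -
  have mvt: "\<exists>x. s < x \<and> x < t \<and> G t - G s = (t - s) * (p x)\<^sup>2" if "s < t" for s t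
    using MVT2[OF that, of G "\<lambda>x. (p x)\<^sup>2"] G by blast
  have mono: "G s \<le> G t" if "s \<le> t" for s t
  proof (cases "s = t")
    case False
    with that obtain x where "G t - G s = (t - s) * (p x)\<^sup>2"
      using mvt[of s t] by auto
    moreover have "0 \<le> (t - s) * (p x)\<^sup>2"
      using that by simp
    ultimately show ?thesis by linarith
  qed simp
  have const: "G s = G t" if "s \<le> t" "t \<le> 0 \<or> l \<le> s" for s t
  proof (cases "s = t")
    case False
    with that obtain x where "s < x" "x < t" "G t - G s = (t - s) * (p x)\<^sup>2"
      using mvt[of s t] by auto
    moreover from this that have "p x = 0"
      by (intro p) auto
    ultimately show ?thesis by simp
  qed simp
  have "G a \<le> G l"
    using mono[of a l] const[of l a] by (cases "a \<le> l") auto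
  moreover have "G 0 \<le> G b"
    using mono[of 0 b] const[of b 0] by (cases "0 \<le> b") auto
  ultimately show ?thesis by simp
qed

lemma wnorm_mono:
  assumes "integrable U01 (\<lambda>x. w x * (f x)\<^sup>2)" "integrable U01 (\<lambda>x. w' x * (g x)\<^sup>2)"
    "\<And>x. x \<in> {0..1} \<Longrightarrow> w x * (f x)\<^sup>2 \<le> w' x * (g x)\<^sup>2"
  shows "wnorm w f \<le> wnorm w' g"
  unfolding wnorm_def by (intro real_sqrt_le_mono LINT_mono_U01 assms)

lemma wnorm_cmult: "0 \<le> c \<Longrightarrow> wnorm w (\<lambda>x. c * f x) = c * wnorm w f"
proof -
  assume c: "0 \<le> c"
  have "(LINT x|U01. w x * (c * f x)\<^sup>2) = (LINT x|U01. c\<^sup>2 * (w x * (f x)\<^sup>2))"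
    by (intro LINT_cong_U01) (simp add: power_mult_distrib)
  then show ?thesis
    using c by (simp add: wnorm_def real_sqrt_mult)
qed

lemma wnorm_indicator_eq:
  assumes "w \<in> borel_measurable U01" "f \<in> borel_measurable U01" "min 1 X = min 1 X'"
  shows "wnorm (\<lambda>x. indicator {..<X} x * w x) f = wnorm (\<lambda>x. indicator {..<X'} x * w x) f"
  unfolding wnorm_def
proof (intro arg_cong[where f = sqrt] integral_cong_AE)
  show "(\<lambda>x. indicator {..<X} x * w x * (f x)\<^sup>2) \<in> borel_measurable U01"
    "(\<lambda>x. indicator {..<X'} x * w x * (f x)\<^sup>2) \<in> borel_measurable U01"
    using assms(1,2) measurable_indicator_U01(1) by auto
  show "AE x in U01. indicator {..<X} x * w x * (f x)\<^sup>2 = indicator {..<X'} x * w x * (f x)\<^sup>2"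
    using AE_U01_neq[of 1] AE_space[of U01]
    by eventually_elim (use assms(3) in \<open>auto split: split_indicator simp: min_def split: if_splits\<close>)
qed

lemma wnorm_indicator_ge_1:
  assumes "w \<in> borel_measurable U01" "f \<in> borel_measurable U01" "1 \<le> X"
  shows "wnorm (\<lambda>x. indicator {..<X} x * w x) f = wnorm w f"
proof -
  have "wnorm (\<lambda>x. indicator {..<X} x * w x) f = wnorm (\<lambda>x. indicator {..<2} x * w x) f"
    using assms by (intro wnorm_indicator_eq) auto
  also have "\<dots> = wnorm w f"
    unfolding wnorm_def by (intro arg_cong[where f = sqrt] LINT_cong_U01) auto
  finally show ?thesis .
qed

lemma wnorm_indicator_le_0: "X \<le> 0 \<Longrightarrow> wnorm (\<lambda>x. indicator {..<X} x * w x) f = 0"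
proof -
  assume X: "X \<le> 0"
  have "(LINT x|U01. indicator {..<X} x * w x * (f x)\<^sup>2) = (LINT x|U01. 0)"
    using X by (intro LINT_cong_U01) auto
  then show ?thesis
    by (simp add: wnorm_def)
qed

lemma le_scaled: "0 < m \<Longrightarrow> m * a \<le> b \<Longrightarrow> a \<le> 1 / m * b" for m a b :: real
  by (simp add: field_simps)

context backstepping
begin

abbreviation wX :: "real \<Rightarrow> real \<Rightarrow> real" where "wX X x \<equiv> indicator {..<X} x * w1 x"

lemma w_measurable: "w1 \<in> borel_measurable U01" "w2 \<in> borel_measurable U01"
  by (intro continuous_imp_measurable_U01 continuous_w)+

lemma weight_wX: "weight (wX X)"
  by (rule weight_indicator[OF weight_w(1)])

section \<open>Transport as translation in travel time\<close>

text \<open>Because the weights are the derivatives of \<open>z\<close> and \<open>y\<close>, each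
  integrand is an exact derivative, and each norm becomes the energy of \<open>p\<close> in a window
  of length \<open>z 1\<close> or \<open>y 1\<close>.\<close>

lemma LINT_transport:
  assumes G: "\<And>s. (G has_real_derivative (p s)\<^sup>2) (at s)" and p: "continuous_on UNIV p"
  shows "(LINT x|U01. w1 x * (p (z x + a))\<^sup>2) = G (z 1 + a) - G a"
    and "(LINT x|U01. w2 x * (p (y x + a))\<^sup>2) = G (y 1 + a) - G a"
    and "(LINT x|U01. w2 x * (p (a - y x))\<^sup>2) = G a - G (a - y 1)"
proof -
  have FTC: "integral {0..1} f = g 1 - g 0" if "\<And>x. (g has_real_derivative f x) (at x)" for f g :: "real \<Rightarrow> real"
  proof (rule integral_unique, rule fundamental_theorem_of_calculus)
    show "(g has_vector_derivative f x) (at x within {0..1})" for x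
      using that[of x] by (simp add: has_real_derivative_iff_has_vector_derivative has_vector_derivative_at_within)
  qed simp
  have c: "continuous_on {0..1} (\<lambda>x. w1 x * (p (z x + a))\<^sup>2)" "continuous_on {0..1} (\<lambda>x. w2 x * (p (y x + a))\<^sup>2)"
    "continuous_on {0..1} (\<lambda>x. w2 x * (p (a - y x))\<^sup>2)"
    by (intro continuous_on_mult continuous_w continuous_on_power cont_compose[OF p]
      continuous_on_add continuous_on_diff cont_yz continuous_on_const)+
  have "integral {0..1} (\<lambda>x. w1 x * (p (z x + a))\<^sup>2) = G (z 1 + a) - G (z 0 + a)"
  proof (rule FTC)
    show "((\<lambda>x. G (z x + a)) has_real_derivative w1 x * (p (z x + a))\<^sup>2) (at x)" for x
      using DERIV_chain2[OF G DERIV_add[OF Dz[of x] DERIV_const[of a]]] by (simp add: mult.commute)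
  qed
  then show "(LINT x|U01. w1 x * (p (z x + a))\<^sup>2) = G (z 1 + a) - G a"
    by (subst LINT_continuous_U01[OF c(1)]) (simp add: z0)
  have "integral {0..1} (\<lambda>x. w2 x * (p (y x + a))\<^sup>2) = G (y 1 + a) - G (y 0 + a)"
  proof (rule FTC)
    show "((\<lambda>x. G (y x + a)) has_real_derivative w2 x * (p (y x + a))\<^sup>2) (at x)" for x
      using DERIV_chain2[OF G DERIV_add[OF Dy[of x] DERIV_const[of a]]] by (simp add: mult.commute)
  qed
  then show "(LINT x|U01. w2 x * (p (y x + a))\<^sup>2) = G (y 1 + a) - G a"
    by (subst LINT_continuous_U01[OF c(2)]) (simp add: y0)
  have "integral {0..1} (\<lambda>x. w2 x * (p (a - y x))\<^sup>2) = - G (a - y 1) - (- G (a - y 0))"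
  proof (rule FTC)
    show "((\<lambda>x. - G (a - y x)) has_real_derivative w2 x * (p (a - y x))\<^sup>2) (at x)" for x
      using DERIV_minus[OF DERIV_chain2[OF G DERIV_diff[OF DERIV_const[of a] Dy[of x]]]] by (simp add: mult.commute)
  qed
  then show "(LINT x|U01. w2 x * (p (a - y x))\<^sup>2) = G a - G (a - y 1)"
    by (subst LINT_continuous_U01[OF c(3)]) (simp add: y0)
qed

text \<open>The unshifted window already contains the whole support of \<open>p\<close>. The second
  bound concerns the reversed window, met when a profile for \<open>u\<close> is traced back through
  the reflection at x = 0 to the initial \<open>beta\<close>.\<close>

lemma wnorm_transport_le:
  assumes p: "continuous_on UNIV p" and l: "\<And>s. s \<le> 0 \<or> z 1 \<le> s \<Longrightarrow> p s = 0"
  shows "wnorm w1 (\<lambda>x. p (z x + a)) \<le> wnorm w1 (\<lambda>x. p (z x))"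
    and "wnorm w2 (\<lambda>x. p (a - y x)) \<le> wnorm w1 (\<lambda>x. p (z x))"
proof -
  obtain G where G: "\<And>s. (G has_real_derivative (p s)\<^sup>2) (at s)"
    using antiderivative_exists[of "\<lambda>s. (p s)\<^sup>2"] continuous_on_power[OF p] by blast
  have le: "G b - G c \<le> G (z 1) - G 0" for b c
    by (rule antiderivative_square_le[OF G l]) (use T_pos in auto)
  have eq: "(LINT x|U01. w1 x * (p (z x))\<^sup>2) = G (z 1) - G 0"
    using LINT_transport(1)[OF G p, of 0] by simp
  show "wnorm w1 (\<lambda>x. p (z x + a)) \<le> wnorm w1 (\<lambda>x. p (z x))"
    unfolding wnorm_def eq LINT_transport(1)[OF G p] by (intro real_sqrt_le_mono le)
  show "wnorm w2 (\<lambda>x. p (a - y x)) \<le> wnorm w1 (\<lambda>x. p (z x))"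
    unfolding wnorm_def eq LINT_transport(3)[OF G p] by (intro real_sqrt_le_mono le)
qed

lemma wnorm_transport_right_le:
  assumes p: "continuous_on UNIV p" and l: "\<And>s. s \<le> 0 \<or> y 1 \<le> s \<Longrightarrow> p s = 0"
  shows "wnorm w2 (\<lambda>x. p (y x + a)) \<le> wnorm w2 (\<lambda>x. p (y x))"
proof -
  obtain G where G: "\<And>s. (G has_real_derivative (p s)\<^sup>2) (at s)"
    using antiderivative_exists[of "\<lambda>s. (p s)\<^sup>2"] continuous_on_power[OF p] by blast
  have le: "G b - G c \<le> G (y 1) - G 0" for b c
    by (rule antiderivative_square_le[OF G l]) (use T_pos in auto)
  have eq: "(LINT x|U01. w2 x * (p (y x))\<^sup>2) = G (y 1) - G 0"
    using LINT_transport(2)[OF G p, of 0] by simp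
  show ?thesis
    unfolding wnorm_def eq LINT_transport(2)[OF G p] by (intro real_sqrt_le_mono le)
qed

lemma kernels_bounded:
  obtains K where "0 \<le> K" "\<And>u v x. L2_on {0..1} u \<Longrightarrow> L2_on {0..1} v \<Longrightarrow> x \<in> {0..1} \<Longrightarrow>
    \<bar>v x - beta u v x\<bar> \<le> K * (LINT s|U01. indicator {..<x} s * \<bar>u s\<bar>) + K * (LINT s|U01. indicator {..<x} s * \<bar>v s\<bar>)"
proof -
  obtain B where B: "0 < B" "\<And>x \<xi>. x \<in> {0..1} \<Longrightarrow> \<xi> \<in> {0..1} \<Longrightarrow> \<bar>Ku x \<xi>\<bar> \<le> B"
    using kernel_bounded[OF continuous_Ku_Kv(1)] by blast
  obtain B' where B': "0 < B'" "\<And>x \<xi>. x \<in> {0..1} \<Longrightarrow> \<xi> \<in> {0..1} \<Longrightarrow> \<bar>Kv x \<xi>\<bar> \<le> B'"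
    using kernel_bounded[OF continuous_Ku_Kv(2)] by blast
  show ?thesis
  proof (rule that[of "max B B'"])
    fix u v :: "real \<Rightarrow> real" and x :: real
    assume u: "L2_on {0..1} u" and v: "L2_on {0..1} v" and x: "x \<in> {0..1}"
    have 1: "\<bar>volterra Ku u x\<bar> \<le> max B B' * (LINT s|U01. indicator {..<x} s * \<bar>u s\<bar>)"
      by (rule volterra_le[OF continuous_Ku_Kv(1) L2_on_integrable[OF u] _ x]) (meson B(2) max.coboundedI1)
    have 2: "\<bar>volterra Kv v x\<bar> \<le> max B B' * (LINT s|U01. indicator {..<x} s * \<bar>v s\<bar>)"
      by (rule volterra_le[OF continuous_Ku_Kv(2) L2_on_integrable[OF v] _ x]) (meson B'(2) max.coboundedI2)
    show "\<bar>v x - beta u v x\<bar> \<le> max B B' * (LINT s|U01. indicator {..<x} s * \<bar>u s\<bar>) + max B B' * (LINT s|U01. indicator {..<x} s * \<bar>v s\<bar>)"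
      unfolding beta_def using 1 2 by linarith
  qed (use B in auto)
qed

text \<open>The definition of \<open>beta\<close> is a Volterra equation for \<open>v\<close>,
  solved by \<open>volterra_bound\<close>. One constant must serve every \<open>X\<close>, because
  the region on which the estimate is used moves with time.\<close>

lemma inverse_bound:
  obtains C where "0 \<le> C" "\<And>u v X. L2_on {0..1} u \<Longrightarrow> L2_on {0..1} v \<Longrightarrow>
    wnorm (wX X) v \<le> C * (wnorm w2 (beta u v) + wnorm (wX X) u)"
proof -
  obtain K where K: "0 \<le> K" "\<And>u v x. L2_on {0..1} u \<Longrightarrow> L2_on {0..1} v \<Longrightarrow> x \<in> {0..1} \<Longrightarrow>
    \<bar>v x - beta u v x\<bar> \<le> K * (LINT s|U01. indicator {..<x} s * \<bar>u s\<bar>) + K * (LINT s|U01. indicator {..<x} s * \<bar>v s\<bar>)"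
    using kernels_bounded by blast
  obtain m1 B1 where m1: "0 < m1" "0 < B1" "\<And>x. x \<in> {0..1} \<Longrightarrow> m1 \<le> w1 x" "\<And>x. x \<in> {0..1} \<Longrightarrow> w1 x \<le> B1"
    using positive_bounds_01[OF continuous_w(1) w_pos(1)] by blast
  obtain m2 B2 where m2: "0 < m2" "0 < B2" "\<And>x. x \<in> {0..1} \<Longrightarrow> m2 \<le> w2 x" "\<And>x. x \<in> {0..1} \<Longrightarrow> w2 x \<le> B2"
    using positive_bounds_01[OF continuous_w(2) w_pos(2)] by blast
  define E where "E = 6 * exp (6 * K\<^sup>2 + 1)"
  have E: "0 \<le> E" by (simp add: E_def)
  \<comment> \<open>\<open>B1\<close> passes from plain squares to the weight \<open>w1\<close> for
    \<open>v\<close>; the reciprocals of \<open>m2\<close> and \<open>m1\<close> pass back from the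
    weighted norms of \<open>beta\<close> and of \<open>u\<close>.\<close>
  define c where "c = B1 * E * (1 / m2 + K\<^sup>2 / m1)"
  have c: "0 \<le> c"
    using m1 m2 E by (simp add: c_def)
  show ?thesis
  proof (rule that[of "sqrt c"])
    fix u v :: "real \<Rightarrow> real" and X :: real
    assume u: "L2_on {0..1} u" and v: "L2_on {0..1} v"
    note b = L2_on_beta[OF u v]
    define a where "a = wnorm w2 (beta u v)"
    define d where "d = wnorm (wX X) u"
    have a0: "0 \<le> a" and d0: "0 \<le> d"
      unfolding a_def d_def by (intro wnorm_nonneg weight_w weight_wX)+
    have "cut_square X v \<le> E * (cut_square X (beta u v) + K\<^sup>2 * cut_square X u)"
      unfolding E_def
    proof (rule volterra_bound[OF u v b K(1)])
      fix x :: real assume x: "x \<in> {0..1}"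
      show "\<bar>v x\<bar> \<le> \<bar>beta u v x\<bar> + K * (LINT s|U01. indicator {..<x} s * \<bar>u s\<bar>) + K * (LINT s|U01. indicator {..<x} s * \<bar>v s\<bar>)"
        using K(2)[OF u v x] by linarith
    qed
    moreover have "cut_square X (beta u v) \<le> 1 / m2 * a\<^sup>2"
    proof -
      have "cut_square X (beta u v) \<le> (LINT x|U01. 1 / m2 * (w2 x * (beta u v x)\<^sup>2))"
      proof (rule LINT_mono_U01)
        fix x :: real assume x: "x \<in> {0..1}"
        have "m2 * (beta u v x)\<^sup>2 \<le> w2 x * (beta u v x)\<^sup>2"
          using m2(3)[OF x] by (intro mult_right_mono) auto
        then have b: "(beta u v x)\<^sup>2 \<le> 1 / m2 * (w2 x * (beta u v x)\<^sup>2)"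
          by (rule le_scaled[OF m2(1)])
        have "indicator {..<X} x * (beta u v x)\<^sup>2 \<le> (beta u v x)\<^sup>2"
          by (auto split: split_indicator)
        then show "indicator {..<X} x * (beta u v x)\<^sup>2 \<le> 1 / m2 * (w2 x * (beta u v x)\<^sup>2)"
          using b by (rule order_trans)
      qed (intro integrable_indicator_U01 L2_on_square b integrable_mult_right weight_integrable_square weight_w)+
      then show ?thesis
        unfolding a_def wnorm_square[OF weight_w(2)] by (simp only: integral_mult_right_zero)
    qed
    moreover have "cut_square X u \<le> 1 / m1 * d\<^sup>2"
    proof -
      have "cut_square X u \<le> (LINT x|U01. 1 / m1 * (wX X x * (u x)\<^sup>2))"
      proof (rule LINT_mono_U01)
        fix x :: real assume x: "x \<in> {0..1}"
        have "m1 * (u x)\<^sup>2 \<le> w1 x * (u x)\<^sup>2"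
          using m1(3)[OF x] by (intro mult_right_mono) auto
        then have "(u x)\<^sup>2 \<le> 1 / m1 * (w1 x * (u x)\<^sup>2)"
          by (rule le_scaled[OF m1(1)])
        then show "indicator {..<X} x * (u x)\<^sup>2 \<le> 1 / m1 * (wX X x * (u x)\<^sup>2)"
          by (auto split: split_indicator)
      qed (intro integrable_indicator_U01 L2_on_square u integrable_mult_right weight_integrable_square weight_wX)+
      then show ?thesis
        unfolding d_def wnorm_square[OF weight_wX] by (simp only: integral_mult_right_zero)
    qed
    moreover have "(wnorm (wX X) v)\<^sup>2 \<le> B1 * cut_square X v"
    proof -
      have "(LINT x|U01. wX X x * (v x)\<^sup>2) \<le> (LINT x|U01. B1 * (indicator {..<X} x * (v x)\<^sup>2))"
      proof (rule LINT_mono_U01)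
        fix x :: real assume x: "x \<in> {0..1}"
        have "w1 x * (v x)\<^sup>2 \<le> B1 * (v x)\<^sup>2"
          using m1(4)[OF x] by (intro mult_right_mono) auto
        then show "wX X x * (v x)\<^sup>2 \<le> B1 * (indicator {..<X} x * (v x)\<^sup>2)"
          by (cases "x < X") simp_all
      qed (intro integrable_indicator_U01 L2_on_square v integrable_mult_right weight_integrable_square weight_wX)+
      then show ?thesis
        unfolding wnorm_square[OF weight_wX] by (simp only: integral_mult_right_zero)
    qed
    ultimately have "(wnorm (wX X) v)\<^sup>2 \<le> B1 * (E * (1 / m2 * a\<^sup>2 + K\<^sup>2 * (1 / m1 * d\<^sup>2)))"
      using m1(2) E by (smt (verit) mult_left_mono zero_le_power2)
    also have "\<dots> \<le> c * (a\<^sup>2 + d\<^sup>2)"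
    proof -
      have "c * (a\<^sup>2 + d\<^sup>2) - B1 * (E * (1 / m2 * a\<^sup>2 + K\<^sup>2 * (1 / m1 * d\<^sup>2))) = B1 * E * (1 / m2 * d\<^sup>2 + K\<^sup>2 / m1 * a\<^sup>2)"
        by (simp add: c_def algebra_simps add_divide_distrib)
      moreover have "0 \<le> \<dots>"
        using m1 m2 E by simp
      ultimately show ?thesis by linarith
    qed
    also have "\<dots> \<le> c * (a + d)\<^sup>2"
      using a0 d0 by (intro mult_left_mono c) (simp add: power2_sum)
    finally have "wnorm (wX X) v \<le> sqrt (c * (a + d)\<^sup>2)"
      by (rule real_le_rsqrt)
    then show "wnorm (wX X) v \<le> sqrt c * (a + d)"
      using a0 d0 by (simp add: real_sqrt_mult)
  qed (use c in simp)
qed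

section \<open>Transport of the backstepping variable\<close>

context
  fixes u0 v0 :: "real \<Rightarrow> real" and u v :: "real \<Rightarrow> real \<Rightarrow> real"
  assumes sol: "solution u0 v0 u v"
begin

text \<open>Choosing \<open>P\<close> = 0 removes both \<open>u\<close> and the source. Then F(s) =
  p(s - t) vanishes up to time t, as the boundary condition requires, and at time t it tests
  \<open>beta\<close> with p(y(x)); hence \<open>beta\<close> at time t is tested by shifting the
  profile on the initial data.\<close>

lemma beta_bound:
  assumes t: "0 \<le> t" and C: "0 \<le> C"
    and bound: "\<And>p. continuous_on UNIV p \<Longrightarrow> (\<And>s. s \<le> 0 \<or> y 1 \<le> s \<Longrightarrow> p s = 0) \<Longrightarrow> 0 < t \<Longrightarrow>
      \<bar>LINT x|U01. w2 x * (p (y x - t) * beta u0 v0 x)\<bar> \<le> C * wnorm w2 (\<lambda>x. p (y x))"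
    and init: "wnorm w2 (beta u0 v0) \<le> C \<or> 0 < t"
  shows "wnorm w2 (beta (u t) (v t)) \<le> C"
proof (cases "t = 0")
  \<comment> \<open>The weak identity is available only for positive times. At time 0 the data agree
    almost everywhere, and the Volterra integrals do not see the exceptional set.\<close>
  case True
  have eq: "volterra K (f 0) x = volterra K f0 x" if "AE x in U01. f 0 x = f0 x" "L2_on {0..1} (f 0)" "L2_on {0..1} f0"
    "continuous_on UNIV (\<lambda>(x, \<xi>). K x \<xi>)" "x \<in> {0..1}" for K f0 x and f :: "real \<Rightarrow> real \<Rightarrow> real"
    unfolding volterra_def
  proof (rule integral_cong_AE)
    show "AE \<xi> in U01. indicator {..<x} \<xi> * (K x \<xi> * f 0 \<xi>) = indicator {..<x} \<xi> * (K x \<xi> * f0 \<xi>)"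
      using that(1) by eventually_elim simp
  qed (intro borel_measurable_integrable volterra_integrable that L2_on_integrable)+
  note L = sol_L2[OF sol]
  have "AE x in U01. beta (u 0) (v 0) x = beta u0 v0 x"
    using sol_initial(2)[OF sol] AE_space[of U01]
    by eventually_elim (simp add: beta_def eq[where f = u, OF sol_initial(1)[OF sol] _ _ continuous_Ku_Kv(1)]
      eq[where f = v, OF sol_initial(2)[OF sol] _ _ continuous_Ku_Kv(2)] L)
  then have "wnorm w2 (beta (u 0) (v 0)) = wnorm w2 (beta u0 v0)"
    by (intro wnorm_cong_AE w_measurable L2_on_measurable L2_on_beta L) auto
  then show ?thesis
    using init True by auto
next
  case False
  with t have t: "0 < t" by simp
  have L: "L2_on {0..1} (beta (u t) (v t))"
    using t by (intro L2_on_beta sol_L2[OF sol]) auto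
  have "wnorm (\<lambda>x. indicator {..<Y (y 1)} x * w2 x) (beta (u t) (v t)) \<le> C"
  proof (rule dual_norm_bound[OF weight_w(2) L C continuous_coordinates(3) y0 my continuous_coordinates(4) Yy yY])
    fix p p' :: "real \<Rightarrow> real"
    assume p: "\<And>s. (p has_real_derivative p' s) (at s)" "continuous_on UNIV p'" "\<And>s. s \<le> 0 \<or> y 1 \<le> s \<Longrightarrow> p s = 0"
    have pc: "continuous_on UNIV p"
      using DERIV_continuous_on[of UNIV, OF p(1)] .
    have d: "((\<lambda>s. p (s - t)) has_real_derivative p' (s - t)) (at s)" for s
      using DERIV_shift_add[OF p(1), of "- t"] by simp
    have "(LINT x|U01. w2 x * (p (y x) * beta (u t) (v t) x)) = (LINT x|U01. w2 x * (p (y x - t) * beta u0 v0 x))"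
      using dual_identity[OF sol d _ DERIV_const continuous_on_const t, of 0] p(3) cont_compose[OF p(2), of UNIV "\<lambda>s. s - t"]
      by (simp add: source_def continuous_on_diff)
    then show "\<bar>LINT x|U01. w2 x * (p (y x) * beta (u t) (v t) x)\<bar> \<le> C * sqrt (LINT x|U01. w2 x * (p (y x))\<^sup>2)"
      using bound[OF pc p(3) t] by (simp add: wnorm_def)
  qed
  then show ?thesis
    unfolding Yy wnorm_indicator_ge_1[OF w_measurable(2) L2_on_measurable[OF L] order_refl] .
qed

lemma beta_le_initial:
  assumes t: "0 \<le> t"
  shows "wnorm w2 (beta (u t) (v t)) \<le> wnorm w2 (beta u0 v0)"
proof (rule beta_bound[OF t wnorm_nonneg[OF weight_w(2)]])
  fix p :: "real \<Rightarrow> real" assume p: "continuous_on UNIV p" "\<And>s. s \<le> 0 \<or> y 1 \<le> s \<Longrightarrow> p s = 0"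
  have "L2_on {0..1} (\<lambda>x. p (y x - t))"
    by (intro L2_on_continuous cont_compose[OF p(1)] continuous_on_diff cont_yz continuous_on_const)
  from wnorm_Cauchy_Schwarz[OF weight_w(2) this L2_on_beta[OF sol_L2(1,2)[OF sol]]]
  have "\<bar>LINT x|U01. w2 x * (p (y x - t) * beta u0 v0 x)\<bar> \<le> wnorm w2 (\<lambda>x. p (y x - t)) * wnorm w2 (beta u0 v0)" .
  also have "\<dots> \<le> wnorm w2 (\<lambda>x. p (y x)) * wnorm w2 (beta u0 v0)"
    using wnorm_transport_right_le[OF p, of "- t"] by (intro mult_right_mono wnorm_nonneg weight_w) auto
  finally show "\<bar>LINT x|U01. w2 x * (p (y x - t) * beta u0 v0 x)\<bar> \<le> wnorm w2 (beta u0 v0) * wnorm w2 (\<lambda>x. p (y x))"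
    by (simp add: mult.commute)
qed simp

text \<open>For t at least \<open>y 1\<close> the shift pushes the profile off the interval: y(x) -
  t is nonpositive for all x.\<close>

lemma beta_vanishes:
  assumes t: "y 1 \<le> t"
  shows "wnorm w2 (beta (u t) (v t)) = 0"
proof -
  have "wnorm w2 (beta (u t) (v t)) \<le> 0"
  proof (rule beta_bound)
    fix p :: "real \<Rightarrow> real" assume p: "\<And>s. s \<le> 0 \<or> y 1 \<le> s \<Longrightarrow> p s = 0"
    have "(LINT x|U01. w2 x * (p (y x - t) * beta u0 v0 x)) = (LINT x|U01. 0)"
    proof (rule LINT_cong_U01)
      fix x :: real assume "x \<in> {0..1}"
      then have "y x \<le> y 1" by simp
      with t have "y x - t \<le> 0" by linarith
      then have "p (y x - t) = 0" by (intro p) simp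
      then show "w2 x * (p (y x - t) * beta u0 v0 x) = 0" by simp
    qed
    then show "\<bar>LINT x|U01. w2 x * (p (y x - t) * beta u0 v0 x)\<bar> \<le> 0 * wnorm w2 (\<lambda>x. p (y x))"
      by simp
  qed (use t T_pos in auto)
  then show ?thesis
    using wnorm_nonneg[OF weight_w(2)] by (simp add: antisym)
qed

end

end

subsection \<open>Finite-time extinction\<close>

context backstepping
begin

context
  fixes u0 v0 :: "real \<Rightarrow> real" and u v :: "real \<Rightarrow> real \<Rightarrow> real"
  assumes sol: "solution u0 v0 u v"
begin

lemma u_bounded:
  obtains M where "\<And>t. t \<in> {0..T} \<Longrightarrow> wnorm (wX X) (u t) \<le> M"
proof -
  obtain m B where "0 < m" and B: "0 < B" and "\<And>x. x \<in> {0..1} \<Longrightarrow> m \<le> w1 x" and B': "\<And>x. x \<in> {0..1} \<Longrightarrow> w1 x \<le> B"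
    using positive_bounds_01[OF continuous_w(1) w_pos(1)] by blast
  obtain M where M: "\<And>t. t \<in> {0..T} \<Longrightarrow> (LINT x|U01. (u t x)\<^sup>2) \<le> M"
    using sol_bounded[OF sol] by blast
  show ?thesis
  proof (rule that)
    fix t assume t: "t \<in> {0..T}"
    then have ut: "L2_on {0..1} (u t)"
      by (intro sol_L2[OF sol]) simp
    have "(LINT x|U01. wX X x * (u t x)\<^sup>2) \<le> (LINT x|U01. B * (u t x)\<^sup>2)"
    proof (rule LINT_mono_U01)
      fix x :: real assume x: "x \<in> {0..1}"
      have "wX X x \<le> B"
        using B B'[OF x] by (cases "x < X") simp_all
      then show "wX X x * (u t x)\<^sup>2 \<le> B * (u t x)\<^sup>2"
        by (intro mult_right_mono) auto
    qed (intro L2_on_square ut integrable_mult_right weight_integrable_square weight_wX)+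
    also have "\<dots> \<le> B * M"
      using M[OF t] B by (simp only: integral_mult_right_zero) (intro mult_left_mono; simp)
    finally show "wnorm (wX X) (u t) \<le> sqrt (B * M)"
      unfolding wnorm_def by (rule real_sqrt_le_mono)
  qed
qed

text \<open>The parameter \<open>D\<close> restricts the estimate to \<open>z(x) < t - D\<close>: below it is used with
  \<open>D = y(1)\<close>, where the initial data drop out, and with \<open>D = -z(1)\<close>, where the restriction is void.\<close>

lemma u_estimate:
  assumes T: "0 \<le> T" and A: "0 \<le> A" and C: "0 \<le> C" and c: "0 \<le> c" "\<And>x. x \<in> {0..1} \<Longrightarrow> \<bar>c1 x\<bar> \<le> c"
    and init: "wnorm (wX (Z (- D))) (u 0) \<le> A"
    and data: "\<And>p \<tau>. continuous_on UNIV p \<Longrightarrow> (\<And>s. s \<le> 0 \<or> min (z 1) (\<tau> - D) \<le> s \<Longrightarrow> p s = 0) \<Longrightarrow> 0 < \<tau> \<Longrightarrow>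
      \<bar>(LINT x|U01. w1 x * (p (z x + \<tau>) * u0 x)) + (LINT x|U01. w2 x * (q * p (\<tau> - y x) * beta u0 v0 x))\<bar>
        \<le> A * wnorm w1 (\<lambda>x. p (z x))"
    and v_le: "\<And>t. t \<in> {0..T} \<Longrightarrow> wnorm (wX (Z (t - D))) (v t) \<le> A + C * wnorm (wX (Z (t - D))) (u t)"
    and t: "t \<in> {0..T}"
  shows "wnorm (wX (Z (t - D))) (u t) \<le> 2 * (A * (1 + c * T)) * exp ((2 * c * C + 1) * t)"
proof -
  \<comment> \<open>Chosen to make c C / \<open>B\<close> at most 1/2, the share allowed by
    \<open>gronwall_sup\<close>; the summand 1 keeps it positive when c C = 0.\<close>
  define B where "B = 2 * c * C + 1"
  have B: "0 < B" "2 * (c * C) \<le> B"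
    using c C by (auto simp: B_def add_nonneg_pos)
  have A': "0 \<le> A * (1 + c * T)"
    using A c T by simp
  let ?f = "\<lambda>t. wnorm (wX (Z (t - D))) (u t)"
  obtain M where M: "\<And>s. s \<in> {0..T} \<Longrightarrow> wnorm (wX 2) (u s) \<le> M"
    using u_bounded by blast
  have fM: "?f s \<le> M" if "s \<in> {0..T}" for s
  proof -
    have us: "L2_on {0..1} (u s)"
      using that by (intro sol_L2[OF sol]) simp
    have "?f s \<le> wnorm (wX 2) (u s)"
    proof (rule wnorm_mono)
      fix x :: real assume "x \<in> {0..1}"
      then show "wX (Z (s - D)) x * (u s x)\<^sup>2 \<le> wX 2 x * (u s x)\<^sup>2"
        using w_pos(1)[of x] by (intro mult_right_mono) (auto split: split_indicator)
    qed (intro weight_integrable_square weight_wX us)+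
    then show ?thesis
      using M[OF that] by simp
  qed
  have "?f t \<le> 2 * (A * (1 + c * T)) * exp (B * t)"
  proof (rule gronwall_sup[where f = ?f and T = T and M = M, OF T fM])
    fix m \<tau> assume m: "0 \<le> m" and h: "\<And>s. s \<in> {0..T} \<Longrightarrow> ?f s \<le> m * exp (B * s)" and \<tau>: "\<tau> \<in> {0..T}"
    define e where "e = m / 2 * exp (B * \<tau>)"
    have e: "0 \<le> e"
      using m by (simp add: e_def)
    have "?f \<tau> \<le> A * (1 + c * T) + e"
    proof (cases "\<tau> = 0")
      case True
      have "A * 1 \<le> A * (1 + c * T)"
        using A c T by (intro mult_left_mono) auto
      with True init e show ?thesis by simp
    next
      case False
      with \<tau> have \<tau>0: "0 < \<tau>" by simp
      have ut: "L2_on {0..1} (u \<tau>)"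
        using \<tau> by (intro sol_L2[OF sol]) simp
      \<comment> \<open>The cap at \<open>z 1\<close> secures the boundary condition at x = 1 and
        costs nothing on the unit interval; \<open>\<tau> - D\<close> restricts the test to the
        region under study.\<close>
      define b where "b = min (z 1) (\<tau> - D)"
      have "wnorm (\<lambda>x. indicator {..<Z b} x * w1 x) (u \<tau>) \<le> A * (1 + c * T) + e"
      proof (rule dual_norm_bound[OF weight_w(1) ut _ continuous_coordinates(1) z0 mz continuous_coordinates(2) Zz zZ])
        show "0 \<le> A * (1 + c * T) + e"
          using A' e by simp
        fix p p' :: "real \<Rightarrow> real"
        assume p: "\<And>s. (p has_real_derivative p' s) (at s)" "continuous_on UNIV p'" and p0: "\<And>s. s \<le> 0 \<or> b \<le> s \<Longrightarrow> p s = 0"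
        have pc: "continuous_on UNIV p"
          using DERIV_continuous_on[of UNIV, OF p(1)] .
        have pz: "p s = 0" if "s \<le> 0 \<or> z 1 \<le> s" for s
          by (rule p0) (use that in \<open>auto simp: b_def\<close>)
        define N where "N = wnorm w1 (\<lambda>x. p (z x))"
        have N: "0 \<le> N"
          unfolding N_def by (rule wnorm_nonneg[OF weight_w(1)])
        \<comment> \<open>Shifted so that the profile at time \<tau> is p(z(x)). Its form at x = 0
          then dictates \<open>F\<close>, and P(z(1) - s) = 0 for s up to \<tau> because
          \<open>p\<close> vanishes beyond \<open>z 1\<close>.\<close>
        define P where "P = (\<lambda>s. p (s + \<tau>))"
        define F where "F = (\<lambda>s. q * p (\<tau> - s))"
        have dP: "(P has_real_derivative p' (s + \<tau>)) (at s)" for s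
          unfolding P_def using DERIV_shift_add[OF p(1), of \<tau>] by (simp add: add.commute[of _ \<tau>])
        have cP': "continuous_on UNIV (\<lambda>s. p' (s + \<tau>))"
          by (intro cont_compose[OF p(2)] continuous_intros)
        have dF: "(F has_real_derivative q * (p' (\<tau> - s) * (0 - 1))) (at s)" for s
          unfolding F_def by (intro DERIV_cmult DERIV_chain2[OF p(1)] DERIV_diff DERIV_const DERIV_ident)
        have cF': "continuous_on UNIV (\<lambda>s. q * (p' (\<tau> - s) * (0 - 1)))"
          by (intro continuous_on_mult continuous_on_const cont_compose[OF p(2)] continuous_intros)
        have bc1: "P (z 1 - s) = 0" and bc2: "F s = q * P (- s)" if "s \<in> {0..\<tau>}" for s
          using that by (auto simp: P_def F_def intro!: pz)
        have cP: "continuous_on UNIV P"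
          using DERIV_continuous_on[of UNIV, OF dP] .
        \<comment> \<open>At time \<tau> the profile attached to \<open>beta\<close> is q p(-y(x)),
          which is zero, so the identity isolates \<open>u\<close>.\<close>
        have outflow: "(LINT x|U01. w2 x * (F (\<tau> + y x) * beta (u \<tau>) (v \<tau>) x)) = (LINT x|U01. 0)"
        proof (rule LINT_cong_U01)
          fix x :: real assume "x \<in> {0..1}"
          then have "y 0 \<le> y x" by simp
          then have "F (\<tau> + y x) = 0"
            by (simp add: F_def y0 pz)
          then show "w2 x * (F (\<tau> + y x) * beta (u \<tau>) (v \<tau>) x) = 0"
            by simp
        qed
        have dual: "(LINT x|U01. w1 x * (p (z x) * u \<tau> x)) =
            (LINT x|U01. w1 x * (p (z x + \<tau>) * u0 x)) + (LINT x|U01. w2 x * (q * p (\<tau> - y x) * beta u0 v0 x))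
            + (LINT s|lebesgue_on {0..\<tau>}. source P v s)"
          using dual_identity[OF sol dF cF' dP cP' \<tau>0 bc1 bc2] outflow by (simp add: P_def F_def)
        have src: "\<bar>source P v s\<bar> \<le> N * (c * A) + N * (c * C * m) * exp (B * s)" if s: "s \<in> {0..\<tau>}" for s
        proof -
          have sT: "s \<in> {0..T}"
            using s \<tau> by auto
          have vs: "L2_on {0..1} (v s)"
            using s by (intro sol_L2[OF sol]) simp
          have cg: "continuous_on {0..1} (\<lambda>x. c1 x * P (z x - s))"
            by (intro continuous_on_mult c1 cont_compose[OF cP] continuous_on_diff cont_yz continuous_on_const)
          have cP1: "continuous_on {0..1} (\<lambda>x. P (z x - s))"
            by (intro cont_compose[OF cP] continuous_on_diff cont_yz continuous_on_const)
          \<comment> \<open>The profile p(z(x) + \<tau> - s) vanishes for z(x) \<ge> s - D. At each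
            earlier time only the corresponding region is seen, so the inequality involves the same
            quantity and closes.\<close>
          have "source P v s = (LINT x|U01. wX (Z (s - D)) x * (c1 x * P (z x - s) * v s x))"
            unfolding source_def
          proof (rule LINT_cong_U01)
            fix x :: real
            show "w1 x * (P (z x - s) * (c1 x * v s x)) = wX (Z (s - D)) x * (c1 x * P (z x - s) * v s x)"
            proof (cases "x < Z (s - D)")
              case False
              then have "s - D \<le> z x"
                by (simp add: not_less Z_le_iff)
              then have "P (z x - s) = 0"
                unfolding P_def by (intro p0) (auto simp: b_def)
              then show ?thesis by simp
            qed simp
          qed
          then have "\<bar>source P v s\<bar> \<le> wnorm (wX (Z (s - D))) (\<lambda>x. c1 x * P (z x - s)) * wnorm (wX (Z (s - D))) (v s)"
            using wnorm_Cauchy_Schwarz[OF weight_wX L2_on_continuous[OF cg] vs] by simp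
          also have "\<dots> \<le> (c * N) * (A + C * (m * exp (B * s)))"
          proof (rule mult_mono)
            have "wnorm (wX (Z (s - D))) (\<lambda>x. c1 x * P (z x - s)) \<le> wnorm w1 (\<lambda>x. c * P (z x - s))"
            proof (rule wnorm_mono)
              fix x :: real assume x: "x \<in> {0..1}"
              have "(c1 x)\<^sup>2 \<le> c\<^sup>2"
                using c(2)[OF x] c(1) by (simp add: abs_le_square_iff[symmetric])
              then have "(c1 x * P (z x - s))\<^sup>2 \<le> (c * P (z x - s))\<^sup>2"
                unfolding power_mult_distrib by (intro mult_right_mono) auto
              moreover have "wX (Z (s - D)) x \<le> w1 x"
                using w_pos(1)[of x] by (auto split: split_indicator)
              ultimately show "wX (Z (s - D)) x * (c1 x * P (z x - s))\<^sup>2 \<le> w1 x * (c * P (z x - s))\<^sup>2"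
                using w_pos(1)[of x] by (intro mult_mono) auto
            qed (intro weight_integrable_square weight_wX weight_w L2_on_continuous cg continuous_on_mult cP1 continuous_on_const)+
            also have "\<dots> = c * wnorm w1 (\<lambda>x. P (z x - s))"
              by (rule wnorm_cmult[OF c(1)])
            also have "wnorm w1 (\<lambda>x. P (z x - s)) \<le> N"
              using wnorm_transport_le(1)[OF pc pz, of "\<tau> - s"] by (simp add: N_def P_def algebra_simps)
            finally show "wnorm (wX (Z (s - D))) (\<lambda>x. c1 x * P (z x - s)) \<le> c * N"
              using c(1) by (simp add: mult_left_mono)
            show "wnorm (wX (Z (s - D))) (v s) \<le> A + C * (m * exp (B * s))"
              using v_le[OF sT] mult_left_mono[OF h[OF sT] C] by linarith
            show "0 \<le> wnorm (wX (Z (s - D))) (v s)"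
              by (rule wnorm_nonneg[OF weight_wX])
          qed (use c N in simp)
          finally show ?thesis
            by (simp add: algebra_simps)
        qed
        have "\<bar>LINT s|lebesgue_on {0..\<tau>}. source P v s\<bar> \<le> N * (c * A * T + e)"
        proof -
          have si: "integrable (lebesgue_on {0..\<tau>}) (source P v)"
            by (intro continuous_imp_integrable_real source_continuous[OF sol] cP)
          let ?g = "\<lambda>s. N * (c * A) + N * (c * C * m) * exp (B * s)"
          have gi: "integrable (lebesgue_on {0..\<tau>}) ?g"
            by (intro continuous_imp_integrable_real continuous_intros)
          have "\<bar>LINT s|lebesgue_on {0..\<tau>}. source P v s\<bar> \<le> (LINT s|lebesgue_on {0..\<tau>}. \<bar>source P v s\<bar>)"
            by (rule integral_abs_bound)
          also have "\<dots> \<le> (LINT s|lebesgue_on {0..\<tau>}. ?g s)"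
            by (intro Bochner_Integration.integral_mono integrable_abs si gi) (use src in auto)
          also have "\<dots> = integral {0..\<tau>} ?g"
            by (rule lebesgue_integral_eq_integral[OF gi]) simp
          also have "\<dots> = (N * (c * A) * \<tau> + N * (c * C * m) * (exp (B * \<tau>) / B))
              - (N * (c * A) * 0 + N * (c * C * m) * (exp (B * 0) / B))"
          proof (rule integral_unique, rule fundamental_theorem_of_calculus)
            show "((\<lambda>s. N * (c * A) * s + N * (c * C * m) * (exp (B * s) / B)) has_vector_derivative ?g s) (at s within {0..\<tau>})" for s
              using B(1) by (auto intro!: derivative_eq_intros simp flip: has_real_derivative_iff_has_vector_derivative)
          qed (use \<tau> in simp)
          also have "\<dots> \<le> N * (c * A) * \<tau> + N * (c * C * m) * (exp (B * \<tau>) / B)"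
          proof -
            have "0 \<le> N * (c * C * m) * (exp (B * 0) / B)"
              using N c C m B by simp
            then show ?thesis by simp
          qed
          also have "N * (c * A) * \<tau> \<le> N * (c * A * T)"
            using N c A \<tau> by (simp add: mult_left_mono mult.assoc)
          also have "N * (c * C * m) * (exp (B * \<tau>) / B) \<le> N * e"
          proof -
            have "c * C * m / B \<le> m / 2"
              using mult_right_mono[OF B(2) m] B(1) by (simp add: field_simps)
            then have "N * (c * C * m / B) * exp (B * \<tau>) \<le> N * (m / 2) * exp (B * \<tau>)"
              using N by (intro mult_right_mono mult_left_mono) auto
            then show ?thesis
              by (simp add: e_def mult_ac)
          qed
          finally show ?thesis
            by (simp add: algebra_simps)
        qed
        moreover have "\<bar>(LINT x|U01. w1 x * (p (z x + \<tau>) * u0 x)) + (LINT x|U01. w2 x * (q * p (\<tau> - y x) * beta u0 v0 x))\<bar> \<le> A * N"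
          unfolding N_def by (rule data[OF pc _ \<tau>0]) (use p0 in \<open>simp add: b_def\<close>)
        ultimately have "\<bar>LINT x|U01. w1 x * (p (z x) * u \<tau> x)\<bar> \<le> (A * (1 + c * T) + e) * N"
          unfolding dual by (simp add: algebra_simps abs_le_iff)
        then show "\<bar>LINT x|U01. w1 x * (p (z x) * u \<tau> x)\<bar> \<le> (A * (1 + c * T) + e) * sqrt (LINT x|U01. w1 x * (p (z x))\<^sup>2)"
          by (simp only: N_def wnorm_def)
      qed
      \<comment> \<open>The cap in \<open>b\<close> becomes invisible on the unit interval, since
        \<open>Z (z 1)\<close> = 1.\<close>
      moreover have "min 1 (Z b) = min 1 (Z (\<tau> - D))"
      proof -
        have "Z b = min (Z (z 1)) (Z (\<tau> - D))"
          by (simp add: b_def min_def)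
        then show ?thesis by (simp add: Zz)
      qed
      ultimately show ?thesis
        using wnorm_indicator_eq[OF w_measurable(1) L2_on_measurable[OF ut], of "Z b" "Z (\<tau> - D)"] by simp
    qed
    also have "A * (1 + c * T) \<le> A * (1 + c * T) * exp (B * \<tau>)"
    proof -
      have "1 \<le> exp (B * \<tau>)"
        using B(1) \<tau> by simp
      from mult_left_mono[OF this A'] show ?thesis by simp
    qed
    finally show "?f \<tau> \<le> A * (1 + c * T) * exp (B * \<tau>) + m / 2 * exp (B * \<tau>)"
      by (simp add: e_def)
  qed (use t B wnorm_nonneg weight_wX in auto)
  then show ?thesis
    by (simp add: B_def)
qed

end

text \<open>With D = \<open>y 1\<close> the estimate runs with A = 0: for s \<ge> \<open>y 1\<close>
  the variable \<open>beta\<close> is zero, for smaller s the region is empty, and the profiles miss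
  the initial data. A homogeneous Gronwall inequality leaves only zero, and from the settling time
  on the region omits at most the end point x = 1.\<close>

lemma finite_time:
  assumes sol: "solution u0 v0 u v" and t: "z 1 + y 1 \<le> t"
  shows "AE x in U01. u t x = 0 \<and> v t x = 0"
proof -
  obtain C where C: "0 \<le> C" "\<And>u v X. L2_on {0..1} u \<Longrightarrow> L2_on {0..1} v \<Longrightarrow>
    wnorm (wX X) v \<le> C * (wnorm w2 (beta u v) + wnorm (wX X) u)"
    using inverse_bound by blast
  obtain c where c: "0 < c" "\<And>x. x \<in> {0..1} \<Longrightarrow> \<bar>c1 x\<bar> \<le> c"
    using continuous_bounded_01[OF c1] by blast
  have t0: "0 \<le> t"
    using t T_pos by simp
  note L = sol_L2(3)[OF sol t0] sol_L2(4)[OF sol t0]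
  have Z0: "Z 0 = 0"
    using Zz[of 0] by (simp add: z0)
  have v_le: "wnorm (wX (Z (s - y 1))) (v s) \<le> 0 + C * wnorm (wX (Z (s - y 1))) (u s)" if s: "0 \<le> s" for s
  proof (cases "y 1 \<le> s")
    case True
    then show ?thesis
      using C(2)[OF sol_L2(3)[OF sol s] sol_L2(4)[OF sol s], of "Z (s - y 1)"] beta_vanishes[OF sol True] by simp
  next
    case False
    then have "Z (s - y 1) \<le> Z 0"
      by simp
    then have "Z (s - y 1) \<le> 0"
      by (simp only: Z0)
    then show ?thesis
      by (simp only: wnorm_indicator_le_0)
  qed
  have u0: "wnorm (wX (Z (t - y 1))) (u t) \<le> 2 * (0 * (1 + c * t)) * exp ((2 * c * C + 1) * t)"
  proof (rule u_estimate[OF sol t0 order_refl C(1) less_imp_le[OF c(1)] c(2)])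
    have "Z (- y 1) \<le> Z 0"
      using T_pos by simp
    then have "Z (- y 1) \<le> 0"
      by (simp only: Z0)
    then show "wnorm (wX (Z (- y 1))) (u 0) \<le> 0"
      by (simp only: wnorm_indicator_le_0)
    fix p :: "real \<Rightarrow> real" and \<tau>
    assume p: "\<And>s. s \<le> 0 \<or> min (z 1) (\<tau> - y 1) \<le> s \<Longrightarrow> p s = 0"
    have "p (z x + \<tau>) = 0" "p (\<tau> - y x) = 0" if "x \<in> {0..1}" for x
    proof -
      have "z 0 \<le> z x" "y x \<le> y 1"
        using that by simp_all
      then have "min (z 1) (\<tau> - y 1) \<le> z x + \<tau>" "min (z 1) (\<tau> - y 1) \<le> \<tau> - y x"
        using T_pos z0 by linarith+
      then show "p (z x + \<tau>) = 0" "p (\<tau> - y x) = 0"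
        by (simp_all add: p)
    qed
    then have "(LINT x|U01. w1 x * (p (z x + \<tau>) * u0 x)) = (LINT x|U01. 0)"
      "(LINT x|U01. w2 x * (q * p (\<tau> - y x) * beta u0 v0 x)) = (LINT x|U01. 0)"
      by (intro LINT_cong_U01; simp)+
    then show "\<bar>(LINT x|U01. w1 x * (p (z x + \<tau>) * u0 x)) + (LINT x|U01. w2 x * (q * p (\<tau> - y x) * beta u0 v0 x))\<bar>
        \<le> 0 * wnorm w1 (\<lambda>x. p (z x))"
      by simp
  qed (use v_le t0 in auto)
  have "z 1 \<le> t - y 1"
    using t by simp
  then have Z1: "1 \<le> Z (t - y 1)"
    by (simp add: Z_le_iff)
  have "wnorm (wX (Z (t - y 1))) (u t) = 0"
    using u0 wnorm_nonneg[OF weight_wX] by (simp add: antisym)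
  moreover from this have "wnorm (wX (Z (t - y 1))) (v t) = 0"
    using v_le[OF t0] wnorm_nonneg[OF weight_wX] by (simp add: antisym)
  ultimately have "wnorm w1 (u t) = 0" "wnorm w1 (v t) = 0"
    using wnorm_indicator_ge_1[OF w_measurable(1) _ Z1] L2_on_measurable[OF L(1)] L2_on_measurable[OF L(2)] by simp_all
  then have "AE x in U01. u t x = 0" "AE x in U01. v t x = 0"
    using w_pos(1) by (auto intro!: wnorm_eq_0_imp_AE[OF weight_w(1)] L)
  then show ?thesis
    by (rule AE_conjI)
qed

end

subsection \<open>The decay estimate\<close>

lemma L2_norm_square:
  assumes "L2_on {0..1} f" "L2_on {0..1} g"
  shows "(L2_norm f g)\<^sup>2 = (LINT x|U01. (f x)\<^sup>2) + (LINT x|U01. (g x)\<^sup>2)"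
proof -
  have "(L2_norm f g)\<^sup>2 = (LINT x|U01. (f x)\<^sup>2 + (g x)\<^sup>2)"
    unfolding L2_norm_def by (intro real_sqrt_pow2 LINT_nonneg_U01) simp
  then show ?thesis
    using L2_on_square[OF assms(1)] L2_on_square[OF assms(2)] by simp
qed

lemma LINT_square_nonneg: "0 \<le> (LINT x|U01. (f x)\<^sup>2)" for f :: "real \<Rightarrow> real"
  by (rule LINT_nonneg_U01) simp

lemma L2_norm_nonneg: "0 \<le> L2_norm f g"
  unfolding L2_norm_def by (intro real_sqrt_ge_zero LINT_nonneg_U01) simp

lemma wnorm_le_bound:
  assumes B: "\<And>x. x \<in> {0..1} \<Longrightarrow> w x \<le> B" and w: "weight w" and f: "L2_on {0..1} f"
  shows "(wnorm w f)\<^sup>2 \<le> B * (LINT x|U01. (f x)\<^sup>2)"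
proof -
  have "(LINT x|U01. w x * (f x)\<^sup>2) \<le> (LINT x|U01. B * (f x)\<^sup>2)"
    using B by (intro LINT_mono_U01 weight_integrable_square w f L2_on_square integrable_mult_right mult_right_mono) auto
  then show ?thesis
    unfolding wnorm_square[OF w] by (simp only: integral_mult_right_zero)
qed

lemma wnorm_ge_bound:
  assumes m: "0 < m" "\<And>x. x \<in> {0..1} \<Longrightarrow> m \<le> w x" and w: "weight w" and f: "L2_on {0..1} f"
  shows "(LINT x|U01. (f x)\<^sup>2) \<le> 1 / m * (wnorm w f)\<^sup>2"
proof -
  have "(LINT x|U01. m * (f x)\<^sup>2) \<le> (LINT x|U01. w x * (f x)\<^sup>2)"
    using m by (intro LINT_mono_U01 weight_integrable_square w f L2_on_square integrable_mult_right mult_right_mono) auto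
  then show ?thesis
    unfolding wnorm_square[OF w] using m(1) by (intro le_scaled) simp_all
qed

context backstepping
begin

lemma beta_norm_bound:
  obtains C where "0 \<le> C" "\<And>u v. L2_on {0..1} u \<Longrightarrow> L2_on {0..1} v \<Longrightarrow> wnorm w2 (beta u v) \<le> C * L2_norm u v"
proof -
  obtain K where K: "0 \<le> K" "\<And>u v x. L2_on {0..1} u \<Longrightarrow> L2_on {0..1} v \<Longrightarrow> x \<in> {0..1} \<Longrightarrow>
    \<bar>v x - beta u v x\<bar> \<le> K * (LINT s|U01. indicator {..<x} s * \<bar>u s\<bar>) + K * (LINT s|U01. indicator {..<x} s * \<bar>v s\<bar>)"
    using kernels_bounded by blast
  obtain m2 B2 where B2: "0 < m2" "0 < B2" "\<And>x. x \<in> {0..1} \<Longrightarrow> m2 \<le> w2 x" "\<And>x. x \<in> {0..1} \<Longrightarrow> w2 x \<le> B2"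
    using positive_bounds_01[OF continuous_w(2) w_pos(2)] by blast
  show ?thesis
  proof (rule that)
    show "0 \<le> sqrt (B2 * (3 + 3 * K\<^sup>2))"
      using B2 by simp
    fix u v :: "real \<Rightarrow> real" assume u: "L2_on {0..1} u" and v: "L2_on {0..1} v"
    define n where "n = L2_norm u v"
    have n: "0 \<le> n"
      unfolding n_def by (rule L2_norm_nonneg)
    note b = L2_on_beta[OF u v]
    have cut: "cut_square x f \<le> (LINT x|U01. (f x)\<^sup>2)" if "L2_on {0..1} f" for f x
      by (intro LINT_mono_U01 integrable_indicator_U01 L2_on_square that) (auto split: split_indicator)
    define k where "k = 3 * K\<^sup>2 * (LINT x|U01. (u x)\<^sup>2) + 3 * K\<^sup>2 * (LINT x|U01. (v x)\<^sup>2)"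
    have "(LINT x|U01. (beta u v x)\<^sup>2) \<le> (LINT x|U01. 3 * (v x)\<^sup>2 + k)"
    proof (rule LINT_mono_U01)
      fix x :: real assume x: "x \<in> {0..1}"
      let ?i = "\<lambda>f. LINT s|U01. indicator {..<x} s * \<bar>f s :: real\<bar>"
      have nn: "0 \<le> ?i f" for f
        by (intro LINT_nonneg_U01) auto
      have "\<bar>beta u v x\<bar> \<le> \<bar>v x\<bar> + K * ?i u + K * ?i v"
        using K(2)[OF u v x] by linarith
      then have "\<bar>beta u v x\<bar>\<^sup>2 \<le> (\<bar>v x\<bar> + K * ?i u + K * ?i v)\<^sup>2"
        by (rule power_mono) simp
      also have "\<dots> \<le> 3 * \<bar>v x\<bar>\<^sup>2 + 3 * (K * ?i u)\<^sup>2 + 3 * (K * ?i v)\<^sup>2"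
        by (rule square_sum3)
      also have "\<dots> \<le> 3 * (v x)\<^sup>2 + 3 * (K\<^sup>2 * (LINT x|U01. (u x)\<^sup>2)) + 3 * (K\<^sup>2 * (LINT x|U01. (v x)\<^sup>2))"
        unfolding power_mult_distrib
        by (intro add_mono mult_left_mono order_trans[OF cut_integral_square[OF u] cut[OF u]]
          order_trans[OF cut_integral_square[OF v] cut[OF v]]) auto
      finally show "(beta u v x)\<^sup>2 \<le> 3 * (v x)\<^sup>2 + k"
        by (simp add: k_def)
    qed (intro L2_on_square b v Bochner_Integration.integrable_add integrable_mult_right integrable_continuous_U01 continuous_on_const)+
    also have "\<dots> = 3 * (LINT x|U01. (v x)\<^sup>2) + k"
    proof -
      have "(LINT x|U01. k) = k"
        by (subst LINT_continuous_U01) auto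
      moreover have "integrable U01 (\<lambda>x. k)"
        by (rule integrable_continuous_U01) simp
      ultimately show ?thesis
        using L2_on_square[OF v] by simp
    qed
    also have "\<dots> \<le> (3 + 3 * K\<^sup>2) * n\<^sup>2"
      unfolding n_def L2_norm_square[OF u v] k_def using LINT_square_nonneg[of u] by (simp add: algebra_simps)
    finally have "B2 * (LINT x|U01. (beta u v x)\<^sup>2) \<le> B2 * ((3 + 3 * K\<^sup>2) * n\<^sup>2)"
      using B2(2) by (intro mult_left_mono) auto
    with wnorm_le_bound[OF B2(4) weight_w(2) b] have "(wnorm w2 (beta u v))\<^sup>2 \<le> B2 * (3 + 3 * K\<^sup>2) * n\<^sup>2"
      by (simp add: mult.assoc)
    then have "wnorm w2 (beta u v) \<le> sqrt (B2 * (3 + 3 * K\<^sup>2) * n\<^sup>2)"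
      by (rule real_le_rsqrt)
    then show "wnorm w2 (beta u v) \<le> sqrt (B2 * (3 + 3 * K\<^sup>2)) * L2_norm u v"
      using n by (simp add: real_sqrt_mult n_def)
  qed
qed

text \<open>All constants are obtained before a solution is fixed, from bounds on coefficients and
  kernels, so \<open>E\<close> is uniform in the initial data. The choice D = -\<open>z 1\<close>
  makes the region the whole interval for every s \<ge> 0.\<close>

lemma short_time_bound:
  assumes T: "0 \<le> T"
  obtains E where "0 < E" "\<And>u0 v0 u v t. solution u0 v0 u v \<Longrightarrow> t \<in> {0..T} \<Longrightarrow> L2_norm (u t) (v t) \<le> E * L2_norm u0 v0"
proof -
  obtain C where C: "0 \<le> C" "\<And>u v X. L2_on {0..1} u \<Longrightarrow> L2_on {0..1} v \<Longrightarrow>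
    wnorm (wX X) v \<le> C * (wnorm w2 (beta u v) + wnorm (wX X) u)"
    using inverse_bound by blast
  obtain c where c: "0 < c" "\<And>x. x \<in> {0..1} \<Longrightarrow> \<bar>c1 x\<bar> \<le> c"
    using continuous_bounded_01[OF c1] by blast
  obtain m1 B1 where m1: "0 < m1" "0 < B1" "\<And>x. x \<in> {0..1} \<Longrightarrow> m1 \<le> w1 x" "\<And>x. x \<in> {0..1} \<Longrightarrow> w1 x \<le> B1"
    using positive_bounds_01[OF continuous_w(1) w_pos(1)] by blast
  obtain Cb where Cb: "0 \<le> Cb" "\<And>u v. L2_on {0..1} u \<Longrightarrow> L2_on {0..1} v \<Longrightarrow> wnorm w2 (beta u v) \<le> Cb * L2_norm u v"
    using beta_norm_bound by blast
  \<comment> \<open>Three shares of the single constant in \<open>u_estimate\<close>: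
    \<open>sqrt B1\<close> for the initial \<open>u\<close>, \<open>\<bar>q\<bar> * Cb\<close> for
    the initial \<open>beta\<close> reflected into \<open>u\<close> at x = 0, and
    \<open>C * Cb\<close> for recovering \<open>v\<close> from \<open>beta\<close>.\<close>
  define KA where "KA = sqrt B1 + (\<bar>q\<bar> + C) * Cb"
  have KA: "0 < KA"
    using m1 Cb C by (auto simp: KA_def intro!: add_pos_nonneg)
  define G where "G = 2 * (KA * (1 + c * T)) * exp ((2 * c * C + 1) * T)"
  have G: "0 \<le> G"
    using KA c T by (simp add: G_def)
  \<comment> \<open>\<open>G\<close> bounds the weighted norm of \<open>u\<close> and
    \<open>KA + C * G\<close> that of \<open>v\<close>; the square root returns to the unweighted
    norm.\<close>
  define E where "E = sqrt (1 / m1) * (G + (KA + C * G))"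
  have E: "0 < E"
    unfolding E_def using add_nonneg_pos[OF G add_pos_nonneg[OF KA mult_nonneg_nonneg[OF C(1) G]]] m1(1)
    by (intro mult_pos_pos) simp_all
  show ?thesis
  proof (rule that[OF E])
    fix u0 v0 :: "real \<Rightarrow> real" and u v :: "real \<Rightarrow> real \<Rightarrow> real" and t
    assume sol: "solution u0 v0 u v" and t: "t \<in> {0..T}"
    define n where "n = L2_norm u0 v0"
    have n: "0 \<le> n"
      unfolding n_def by (rule L2_norm_nonneg)
    note L0 = sol_L2(1)[OF sol] sol_L2(2)[OF sol]
    have bn: "wnorm w2 (beta u0 v0) \<le> Cb * n"
      unfolding n_def by (rule Cb(2)[OF L0])
    have un: "wnorm w1 u0 \<le> sqrt B1 * n"
    proof -
      have "(wnorm w1 u0)\<^sup>2 \<le> B1 * n\<^sup>2"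
      proof (rule order_trans[OF wnorm_le_bound[OF m1(4) weight_w(1) L0(1)]])
        show "B1 * (LINT x|U01. (u0 x)\<^sup>2) \<le> B1 * n\<^sup>2"
          unfolding n_def L2_norm_square[OF L0] using m1(2) LINT_square_nonneg[of v0] by (intro mult_left_mono) auto
      qed
      then have "wnorm w1 u0 \<le> sqrt (B1 * n\<^sup>2)"
        by (rule real_le_rsqrt)
      then show ?thesis
        using n by (simp add: real_sqrt_mult)
    qed
    define A where "A = KA * n"
    have A: "0 \<le> A"
      using KA n by (simp add: A_def)
    have A_ge: "wnorm w1 u0 + \<bar>q\<bar> * wnorm w2 (beta u0 v0) + C * wnorm w2 (beta u0 v0) \<le> A"
    proof -
      have "wnorm w1 u0 + \<bar>q\<bar> * wnorm w2 (beta u0 v0) + C * wnorm w2 (beta u0 v0) \<le>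
          sqrt B1 * n + \<bar>q\<bar> * (Cb * n) + C * (Cb * n)"
        using bn un C by (intro add_mono mult_left_mono) auto
      also have "\<dots> = A"
        by (simp add: A_def KA_def algebra_simps)
      finally show ?thesis .
    qed
    have nb: "0 \<le> wnorm w2 (beta u0 v0)" and nu: "0 \<le> wnorm w1 u0"
      by (intro wnorm_nonneg weight_w)+
    have Z1: "1 \<le> Z (s - (- z 1))" if "0 \<le> s" for s
      using that by (simp add: Z_le_iff)
    have whole: "wnorm (wX (Z (s - (- z 1)))) f = wnorm w1 f" if "0 \<le> s" "L2_on {0..1} f" for s f
      by (rule wnorm_indicator_ge_1[OF w_measurable(1) L2_on_measurable[OF that(2)] Z1[OF that(1)]])
    have v_le: "wnorm w1 (v s) \<le> A + C * wnorm w1 (u s)" if s: "0 \<le> s" for s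
    proof -
      note Ls = sol_L2(3)[OF sol s] sol_L2(4)[OF sol s]
      have "wnorm w1 (v s) \<le> C * (wnorm w2 (beta (u s) (v s)) + wnorm w1 (u s))"
        using C(2)[OF Ls, of "Z (s - (- z 1))"] unfolding whole[OF s Ls(1)] whole[OF s Ls(2)] .
      also have "\<dots> \<le> C * wnorm w2 (beta u0 v0) + C * wnorm w1 (u s)"
        unfolding distrib_left using beta_le_initial[OF sol s] C(1) by (intro add_right_mono mult_left_mono)
      also have "C * wnorm w2 (beta u0 v0) \<le> A"
        using A_ge nb nu mult_nonneg_nonneg[OF abs_ge_zero nb, of q] by linarith
      finally show ?thesis by simp
    qed
    have t0: "0 \<le> t"
      using t by simp
    note Lt = sol_L2(3)[OF sol t0] sol_L2(4)[OF sol t0]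
    have "wnorm (wX (Z (t - (- z 1)))) (u t) \<le> 2 * (A * (1 + c * T)) * exp ((2 * c * C + 1) * t)"
    proof (rule u_estimate[OF sol T A C(1) less_imp_le[OF c(1)] c(2) _ _ _ t])
      have Lu: "L2_on {0..1} (u 0)"
        by (rule sol_L2(3)[OF sol order_refl])
      have "wnorm (wX (Z (- (- z 1)))) (u 0) = wnorm w1 (u 0)"
        using whole[OF order_refl Lu] by (simp only: diff_0)
      also have "\<dots> = wnorm w1 u0"
        by (intro wnorm_cong_AE L2_on_measurable Lu L0 w_measurable sol_initial[OF sol])
      also have "\<dots> \<le> A"
        using A_ge nb nu mult_nonneg_nonneg[OF abs_ge_zero nb, of q] mult_nonneg_nonneg[OF C(1) nb] by linarith
      finally show "wnorm (wX (Z (- (- z 1)))) (u 0) \<le> A" .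
    next
      fix p :: "real \<Rightarrow> real" and \<tau> :: real
      assume pc: "continuous_on UNIV p" and p: "\<And>s. s \<le> 0 \<or> min (z 1) (\<tau> - (- z 1)) \<le> s \<Longrightarrow> p s = 0" and \<tau>: "0 < \<tau>"
      define N where "N = wnorm w1 (\<lambda>x. p (z x))"
      have N: "0 \<le> N"
        unfolding N_def by (rule wnorm_nonneg[OF weight_w(1)])
      have pz: "p s = 0" if "s \<le> 0 \<or> z 1 \<le> s" for s
        by (rule p) (use that \<tau> in auto)
      have L1: "L2_on {0..1} (\<lambda>x. p (z x + \<tau>))"
        by (intro L2_on_continuous cont_compose[OF pc] continuous_on_add cont_yz continuous_on_const)
      have L2: "L2_on {0..1} (\<lambda>x. q * p (\<tau> - y x))"
        by (intro L2_on_continuous continuous_on_mult cont_compose[OF pc] continuous_on_diff cont_yz continuous_on_const)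
      have "\<bar>LINT x|U01. w1 x * (p (z x + \<tau>) * u0 x)\<bar> \<le> wnorm w1 (\<lambda>x. p (z x + \<tau>)) * wnorm w1 u0"
        by (rule wnorm_Cauchy_Schwarz[OF weight_w(1) L1 L0(1)])
      also have "\<dots> \<le> N * wnorm w1 u0"
        unfolding N_def by (intro mult_right_mono wnorm_transport_le(1)[OF pc pz] nu)
      finally have 1: "\<bar>LINT x|U01. w1 x * (p (z x + \<tau>) * u0 x)\<bar> \<le> N * wnorm w1 u0" .
      have "\<bar>LINT x|U01. w2 x * (q * p (\<tau> - y x) * beta u0 v0 x)\<bar> \<le> wnorm w2 (\<lambda>x. q * p (\<tau> - y x)) * wnorm w2 (beta u0 v0)"
        by (rule wnorm_Cauchy_Schwarz[OF weight_w(2) L2 L2_on_beta[OF L0]])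
      also have "wnorm w2 (\<lambda>x. q * p (\<tau> - y x)) = wnorm w2 (\<lambda>x. \<bar>q\<bar> * p (\<tau> - y x))"
        by (simp add: wnorm_def power_mult_distrib)
      also have "\<dots> = \<bar>q\<bar> * wnorm w2 (\<lambda>x. p (\<tau> - y x))"
        by (rule wnorm_cmult) simp
      also have "\<dots> * wnorm w2 (beta u0 v0) \<le> \<bar>q\<bar> * N * wnorm w2 (beta u0 v0)"
        unfolding N_def by (intro mult_right_mono mult_left_mono wnorm_transport_le(2)[OF pc pz] nb abs_ge_zero) simp_all
      finally have 2: "\<bar>LINT x|U01. w2 x * (q * p (\<tau> - y x) * beta u0 v0 x)\<bar> \<le> \<bar>q\<bar> * N * wnorm w2 (beta u0 v0)" .
      have "wnorm w1 u0 + \<bar>q\<bar> * wnorm w2 (beta u0 v0) \<le> A"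
        using A_ge mult_nonneg_nonneg[OF C(1) nb] by linarith
      from mult_right_mono[OF this N]
      have "N * wnorm w1 u0 + \<bar>q\<bar> * N * wnorm w2 (beta u0 v0) \<le> A * N"
        by (simp add: algebra_simps)
      then show "\<bar>(LINT x|U01. w1 x * (p (z x + \<tau>) * u0 x)) + (LINT x|U01. w2 x * (q * p (\<tau> - y x) * beta u0 v0 x))\<bar>
          \<le> A * wnorm w1 (\<lambda>x. p (z x))"
        unfolding N_def[symmetric] using 1 2 by linarith
    next
      fix s assume s: "s \<in> {0..T}"
      then have s0: "0 \<le> s" by simp
      show "wnorm (wX (Z (s - (- z 1)))) (v s) \<le> A + C * wnorm (wX (Z (s - (- z 1)))) (u s)"
        unfolding whole[OF s0 sol_L2(3)[OF sol s0]] whole[OF s0 sol_L2(4)[OF sol s0]] by (rule v_le[OF s0])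
    qed
    then have "wnorm w1 (u t) \<le> 2 * (A * (1 + c * T)) * exp ((2 * c * C + 1) * t)"
      unfolding whole[OF t0 Lt(1)] .
    also have "\<dots> \<le> 2 * (A * (1 + c * T)) * exp ((2 * c * C + 1) * T)"
      using A c C T t by (intro mult_left_mono) (auto intro!: mult_left_mono)
    also have "\<dots> = G * n"
      by (simp add: G_def A_def)
    finally have ut: "wnorm w1 (u t) \<le> G * n" .
    have vt: "wnorm w1 (v t) \<le> (KA + C * G) * n"
      using v_le[OF t0] mult_left_mono[OF ut C(1)] by (simp add: A_def algebra_simps)
    have "(L2_norm (u t) (v t))\<^sup>2 \<le> 1 / m1 * (wnorm w1 (u t))\<^sup>2 + 1 / m1 * (wnorm w1 (v t))\<^sup>2"
      unfolding L2_norm_square[OF Lt] by (intro add_mono wnorm_ge_bound m1 weight_w Lt)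
    also have "\<dots> \<le> 1 / m1 * (G * n)\<^sup>2 + 1 / m1 * ((KA + C * G) * n)\<^sup>2"
      using m1(1) by (intro add_mono mult_left_mono power_mono ut vt wnorm_nonneg weight_w) auto
    also have "\<dots> \<le> 1 / m1 * (G * n + (KA + C * G) * n)\<^sup>2"
    proof -
      have "(G * n)\<^sup>2 + ((KA + C * G) * n)\<^sup>2 \<le> (G * n + (KA + C * G) * n)\<^sup>2"
        unfolding power2_sum using G n KA C by simp
      from mult_left_mono[OF this, of "1 / m1"] m1(1) show ?thesis
        by (simp only: distrib_left) simp
    qed
    also have "\<dots> = (E * n)\<^sup>2"
      using m1(1) by (simp add: E_def power_mult_distrib flip: distrib_right)
    finally show "L2_norm (u t) (v t) \<le> E * L2_norm u0 v0"
      unfolding n_def[symmetric] by (rule power2_le_imp_le) (use E n in simp)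
  qed
qed

text \<open>Extinction allows every rate: up to the settling time the factor exp(r T) compensates
  for exp(-r t), and afterwards the left-hand side is zero.\<close>

lemma exponential_decay:
  assumes r: "0 < r"
  shows "\<exists>c>0. \<forall>u0 v0 u v. solution u0 v0 u v \<longrightarrow>
    (\<forall>t\<ge>0. L2_norm (u t) (v t) \<le> c * exp (- r * t) * L2_norm u0 v0)"
proof -
  define T where "T = z 1 + y 1"
  have T: "0 \<le> T"
    using T_pos by (simp add: T_def)
  obtain E where E: "0 < E" "\<And>u0 v0 u v t. solution u0 v0 u v \<Longrightarrow> t \<in> {0..T} \<Longrightarrow> L2_norm (u t) (v t) \<le> E * L2_norm u0 v0"
    using short_time_bound[OF T] by blast
  show ?thesis
  proof (intro exI[of _ "E * exp (r * T)"] conjI allI impI)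
    show "0 < E * exp (r * T)"
      using E(1) by simp
    fix u0 v0 :: "real \<Rightarrow> real" and u v :: "real \<Rightarrow> real \<Rightarrow> real" and t :: real
    assume sol: "solution u0 v0 u v" and t: "0 \<le> t"
    show "L2_norm (u t) (v t) \<le> E * exp (r * T) * exp (- r * t) * L2_norm u0 v0"
    proof (cases "t \<le> T")
      case True
      then have "0 \<le> r * T + - r * t"
        using r by simp
      then have "1 \<le> exp (r * T) * exp (- r * t)"
        unfolding exp_add[symmetric] by simp
      then have "E * L2_norm u0 v0 * 1 \<le> E * L2_norm u0 v0 * (exp (r * T) * exp (- r * t))"
        using E(1) L2_norm_nonneg by (intro mult_left_mono) auto
      with E(2)[OF sol, of t] True t show ?thesis
        by (simp add: mult_ac)
    next
      case False
      then have AE: "AE x in U01. u t x = 0 \<and> v t x = 0"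
        by (intro finite_time[OF sol]) (simp add: T_def)
      have "(LINT x|U01. (u t x)\<^sup>2 + (v t x)\<^sup>2) = (LINT x|U01. 0)"
      proof (rule integral_cong_AE)
        show "(\<lambda>x. (u t x)\<^sup>2 + (v t x)\<^sup>2) \<in> borel_measurable U01"
          using L2_on_measurable[OF sol_L2(3)[OF sol t]] L2_on_measurable[OF sol_L2(4)[OF sol t]] by simp
        show "AE x in U01. (u t x)\<^sup>2 + (v t x)\<^sup>2 = 0"
          using AE by eventually_elim simp
      qed simp
      then have "L2_norm (u t) (v t) = 0"
        by (simp add: L2_norm_def)
      then show ?thesis
        using E(1) L2_norm_nonneg[of u0 v0] by simp
    qed
  qed
qed

lemma settling_time: "integral {0..1} (\<lambda>\<xi>. 1 / e1 \<xi> + 1 / e2 \<xi>) = z 1 + y 1"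
proof -
  have "((\<lambda>\<xi>. w1 \<xi> + w2 \<xi>) has_integral (z 1 + y 1 - (z 0 + y 0))) {0..1}"
  proof (rule fundamental_theorem_of_calculus)
    show "((\<lambda>x. z x + y x) has_vector_derivative w1 x + w2 x) (at x within {0..1})" for x
      using DERIV_add[OF Dz[of x] Dy[of x]]
      by (simp add: has_real_derivative_iff_has_vector_derivative has_vector_derivative_at_within)
  qed simp
  then have "integral {0..1} (\<lambda>\<xi>. w1 \<xi> + w2 \<xi>) = z 1 + y 1"
    by (simp add: integral_unique z0 y0)
  moreover have "integral {0..1} (\<lambda>\<xi>. w1 \<xi> + w2 \<xi>) = integral {0..1} (\<lambda>\<xi>. 1 / e1 \<xi> + 1 / e2 \<xi>)"
    by (rule integral_cong) (simp add: clip_id)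
  ultimately show ?thesis by simp
qed

end

theorem theorem3p2:
  fixes c\<^sub>1 c\<^sub>2 \<epsilon>\<^sub>1 \<epsilon>\<^sub>1' \<epsilon>\<^sub>2 \<epsilon>\<^sub>2' :: "real \<Rightarrow> real"
    and q :: real
    and Kvu Kvv :: "real \<Rightarrow> real \<Rightarrow> real"
  assumes "continuous_on {0..1} c\<^sub>1" and "continuous_on {0..1} c\<^sub>2"
    and "C1_on {0..1} \<epsilon>\<^sub>1 \<epsilon>\<^sub>1'" and "C1_on {0..1} \<epsilon>\<^sub>2 \<epsilon>\<^sub>2'"
    and "\<And>x. x \<in> {0..1} \<Longrightarrow> \<epsilon>\<^sub>1 x > 0" and "\<And>x. x \<in> {0..1} \<Longrightarrow> \<epsilon>\<^sub>2 x > 0"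
    and "q \<noteq> 0"
    and "kernel_solution \<epsilon>\<^sub>1 \<epsilon>\<^sub>1' \<epsilon>\<^sub>2 \<epsilon>\<^sub>2' c\<^sub>1 c\<^sub>2 q Kvu Kvv"
  shows "(\<forall>r>0. \<exists>c>0. \<forall>u0 v0 u v.
            L2_on {0..1} u0 \<and> L2_on {0..1} v0 \<and>
            weak_solution \<epsilon>\<^sub>1 \<epsilon>\<^sub>1' \<epsilon>\<^sub>2 \<epsilon>\<^sub>2' c\<^sub>1 c\<^sub>2 q (feedback Kvu Kvv u v) u0 v0 u v \<longrightarrow>
            (\<forall>t\<ge>0. L2_norm (u t) (v t) \<le> c * exp (- r * t) * L2_norm u0 v0)) \<and>
         (\<forall>u0 v0 u v.
            L2_on {0..1} u0 \<and> L2_on {0..1} v0 \<and>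
            weak_solution \<epsilon>\<^sub>1 \<epsilon>\<^sub>1' \<epsilon>\<^sub>2 \<epsilon>\<^sub>2' c\<^sub>1 c\<^sub>2 q (feedback Kvu Kvv u v) u0 v0 u v \<longrightarrow>
            (\<forall>t\<ge>integral {0..1} (\<lambda>\<xi>. 1 / \<epsilon>\<^sub>1 \<xi> + 1 / \<epsilon>\<^sub>2 \<xi>).
               AE x in lebesgue_on {0..1}. u t x = 0 \<and> v t x = 0))"
proof -
  define e1 where "e1 = (\<lambda>x. \<epsilon>\<^sub>1 (clip x))"
  define e2 where "e2 = (\<lambda>x. \<epsilon>\<^sub>2 (clip x))"
  have cont: "continuous_on {0..1} \<epsilon>\<^sub>1" "continuous_on {0..1} \<epsilon>\<^sub>2"
    using assms(3,4) DERIV_continuous_on unfolding C1_on_def by blast+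
  have e_cont: "continuous_on UNIV e1" "continuous_on UNIV e2"
    unfolding e1_def e2_def
    by (rule continuous_on_compose_clip[OF cont(1) continuous_on_id] continuous_on_compose_clip[OF cont(2) continuous_on_id])+
  have e_pos: "0 < e1 x" "0 < e2 x" for x
    unfolding e1_def e2_def by (intro assms; simp)+
  obtain E1 E2 where E: "\<And>x. e1 x \<le> E1" "\<And>x. e2 x \<le> E2"
  proof -
    obtain E1 where "0 < E1" "\<And>x. x \<in> {0..1} \<Longrightarrow> \<bar>\<epsilon>\<^sub>1 x\<bar> \<le> E1"
      using continuous_bounded_01[OF cont(1)] by blast
    moreover obtain E2 where "0 < E2" "\<And>x. x \<in> {0..1} \<Longrightarrow> \<bar>\<epsilon>\<^sub>2 x\<bar> \<le> E2"
      using continuous_bounded_01[OF cont(2)] by blast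
    ultimately show ?thesis
      using that[of E1 E2] by (simp add: e1_def e2_def abs_le_iff)
  qed
  obtain z Z where z: "z 0 = 0" "\<And>x. (z has_real_derivative 1 / e1 x) (at x)"
    "\<And>s. (Z has_real_derivative e1 (Z s)) (at s)" "\<And>x. Z (z x) = x" "\<And>s. z (Z s) = s" "strict_mono z" "strict_mono Z"
    by (rule flow_coordinates[OF e_cont(1) e_pos(1) E(1)]) (rule that)
  obtain y Y where y: "y 0 = 0" "\<And>x. (y has_real_derivative 1 / e2 x) (at x)"
    "\<And>s. (Y has_real_derivative e2 (Y s)) (at s)" "\<And>x. Y (y x) = x" "\<And>s. y (Y s) = s" "strict_mono y" "strict_mono Y"
    by (rule flow_coordinates[OF e_cont(2) e_pos(2) E(2)]) (rule that)
  \<comment> \<open>The speed with 1 / \<open>e\<close> = 1 / \<open>e1\<close> + 1 /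
    \<open>e2\<close>: its travel time is \<open>y + z\<close>, so its flow is the inverse
    \<open>W\<close> wanted by the locale. It is bounded by \<open>e1\<close>, as
    \<open>flow_coordinates\<close> requires.\<close>
  define e where "e = (\<lambda>x. 1 / (1 / e1 x + 1 / e2 x))"
  have sum_pos: "0 < 1 / e1 x + 1 / e2 x" for x
    using e_pos by (intro add_pos_pos) simp_all
  have ne: "e1 x \<noteq> 0" "e2 x \<noteq> 0" "1 / e1 x + 1 / e2 x \<noteq> 0" for x
    using e_pos[of x] sum_pos[of x] by linarith+
  have ec: "continuous_on UNIV e"
    unfolding e_def using ne by (intro continuous_on_divide continuous_on_add continuous_on_const e_cont) blast+
  have ep: "0 < e x" for x
    unfolding e_def using sum_pos by simp
  have eE: "e x \<le> E1" for x
  proof -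
    have "e x \<le> 1 / (1 / e1 x)"
      unfolding e_def using e_pos[of x] by (intro divide_left_mono mult_pos_pos sum_pos) auto
    then show ?thesis
      using E(1)[of x] by simp
  qed
  obtain \<omega> W where \<omega>: "\<omega> 0 = 0" "\<And>x. (\<omega> has_real_derivative 1 / e x) (at x)"
    "\<And>s. (W has_real_derivative e (W s)) (at s)" "\<And>x. W (\<omega> x) = x" "\<And>s. \<omega> (W s) = s" "strict_mono \<omega>" "strict_mono W"
    by (rule flow_coordinates[OF ec ep eE]) (rule that)
  have yz: "y x + z x = \<omega> x" for x
  proof -
    have "((\<lambda>x. y x + z x - \<omega> x) has_real_derivative 0) (at x)" for x
      using DERIV_diff[OF DERIV_add[OF y(2)[of x] z(2)[of x]] \<omega>(2)[of x]] by (simp add: e_def add.commute)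
    then have "y x + z x - \<omega> x = y 0 + z 0 - \<omega> 0"
      by (rule DERIV_isconst_all[rule_format, of "\<lambda>x. y x + z x - \<omega> x"])
    then show ?thesis
      by (simp add: y z \<omega>)
  qed
  have Wc: "continuous_on UNIV W"
    using DERIV_continuous_on[of UNIV, OF \<omega>(3)] .
  have yzW: "y (W s) + z (W s) = s" for s
    by (simp add: yz \<omega>(5))
  interpret backstepping c\<^sub>1 c\<^sub>2 \<epsilon>\<^sub>1 \<epsilon>\<^sub>1' \<epsilon>\<^sub>2 \<epsilon>\<^sub>2' q Kvu Kvv z Z y Y W
    by unfold_locales (fact assms z[unfolded e1_def] y[unfolded e2_def] Wc yzW)+
  show ?thesis
    unfolding settling_time using exponential_decay finite_time by (simp only: solution_def) blast
qed

end
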